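(* Let $R$ be a commutative ring with unity for which $\mathrm{End}_R(M)$ is local for each indecomposable $R$-module $M$. Then $R$ is a clean elementary divisor ring.
   Context: $R$ is clean if each element of $R$ is the sum of a unit and an idempotent. $R$ is an elementary divisor ring if each finitely presented $R$-module is a direct sum of cyclic submodules. A (possibly noncommutative) ring is local if it is nonzero and its non-units form a two-sided ideal. Indecomposable modules are nonzero. *)

theory Defs
  imports "HOL-Algebra.Module" "HOL-Algebra.Ideal"
begin

section \<open>Clean rings and local rings\<close>

definition clean_ring :: "('a, 'r) ring_scheme \<Rightarrow> bool" where
  "clean_ring R \<longleftrightarrow>
    (\<forall>x \<in> carrier R. \<exists>u \<in> Units R. \<exists>e \<in> carrier R. e \<otimes>\<^bsub>R\<^esub> e = e \<and> x = u \<oplus>\<^bsub>R\<^esub> e)"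

text \<open>The ring need not be commutative; \<^locale>\<open>ideal\<close> means a two-sided ideal, and
  \<^const>\<open>Units\<close> consists of the elements with a two-sided inverse.\<close>

definition local_ring :: "('a, 'r) ring_scheme \<Rightarrow> bool" where
  "local_ring E \<longleftrightarrow>
    ring E \<and> carrier E \<noteq> {\<zero>\<^bsub>E\<^esub>} \<and> ideal (carrier E - Units E) E"


section \<open>Homomorphisms and endomorphism rings of modules\<close>

text \<open>Homomorphisms are taken extensional, so that two of them are equal as soon as they agree on
  the carrier. In particular units and idempotents of the endomorphism ring are the intended ones.\<close>

definition module_homs ::
    "('a, 'r) ring_scheme \<Rightarrow> ('a, 'm, 'k) module_scheme \<Rightarrow> ('a, 'n, 'l) module_scheme \<Rightarrow> ('m \<Rightarrow> 'n) set"
  where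
  "module_homs R M N =
    {f \<in> carrier M \<rightarrow>\<^sub>E carrier N.
      (\<forall>x \<in> carrier M. \<forall>y \<in> carrier M. f (x \<oplus>\<^bsub>M\<^esub> y) = f x \<oplus>\<^bsub>N\<^esub> f y) \<and>
      (\<forall>a \<in> carrier R. \<forall>x \<in> carrier M. f (a \<odot>\<^bsub>M\<^esub> x) = a \<odot>\<^bsub>N\<^esub> f x)}"

definition End_ring :: "('a, 'r) ring_scheme \<Rightarrow> ('a, 'm, 'k) module_scheme \<Rightarrow> ('m \<Rightarrow> 'm) ring" where
  "End_ring R M =
    \<lparr>carrier = module_homs R M M,
     mult = (\<lambda>f g. \<lambda>x \<in> carrier M. f (g x)),
     one = (\<lambda>x \<in> carrier M. x),
     zero = (\<lambda>x \<in> carrier M. \<zero>\<^bsub>M\<^esub>),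
     add = (\<lambda>f g. \<lambda>x \<in> carrier M. f x \<oplus>\<^bsub>M\<^esub> g x)\<rparr>"

lemma (in module) ring_End_ring: "ring (End_ring R M)"
proof (intro ringI abelian_groupI monoidI)
  fix f assume "f \<in> carrier (End_ring R M)"
  then show "\<exists>g \<in> carrier (End_ring R M). g \<oplus>\<^bsub>End_ring R M\<^esub> f = \<zero>\<^bsub>End_ring R M\<^esub>"
    by (intro bexI[of _ "\<lambda>x \<in> carrier M. \<ominus>\<^bsub>M\<^esub> f x"])
      (auto simp: End_ring_def module_homs_def PiE_iff Pi_iff M.l_neg M.minus_add
        smult_r_minus[symmetric] restrict_def extensional_def simp flip: smult_l_minus)
qed (auto simp: End_ring_def module_homs_def PiE_iff Pi_iff M.a_ac smult_r_distr restrict_def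
    extensional_def fun_eq_iff)


section \<open>Direct sums and indecomposable modules\<close>

definition indecomposable_module :: "('a, 'r) ring_scheme \<Rightarrow> ('a, 'm, 'k) module_scheme \<Rightarrow> bool" where
  "indecomposable_module R M \<longleftrightarrow>
    carrier M \<noteq> {\<zero>\<^bsub>M\<^esub>} \<and>
    (\<forall>A B. submodule A R M \<and> submodule B R M \<and>
        A \<inter> B = {\<zero>\<^bsub>M\<^esub>} \<and> A <+>\<^bsub>M\<^esub> B = carrier M \<longrightarrow>
      A = {\<zero>\<^bsub>M\<^esub>} \<or> B = {\<zero>\<^bsub>M\<^esub>})"

text \<open>\<open>M\<close> is the internal direct sum of the (possibly infinite) set \<open>\<C>\<close> of submodules: every
  element is, in exactly one way, a finitely supported sum of elements of the members of \<open>\<C>\<close>.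
  Using a set rather than a family loses nothing, since a nonzero submodule can occur only
  once in an internal direct sum.\<close>

definition internal_direct_sum ::
    "('a, 'r) ring_scheme \<Rightarrow> ('a, 'm, 'k) module_scheme \<Rightarrow> 'm set set \<Rightarrow> bool" where
  "internal_direct_sum R M \<C> \<longleftrightarrow>
    (\<forall>N \<in> \<C>. submodule N R M) \<and>
    (\<forall>x \<in> carrier M. \<exists>!y. y \<in> (\<Pi>\<^sub>E N \<in> \<C>. N) \<and> finite {N \<in> \<C>. y N \<noteq> \<zero>\<^bsub>M\<^esub>} \<and>
      x = (\<Oplus>\<^bsub>M\<^esub>N \<in> {N \<in> \<C>. y N \<noteq> \<zero>\<^bsub>M\<^esub>}. y N))"

definition cyclic_submodule :: "('a, 'r) ring_scheme \<Rightarrow> ('a, 'm, 'k) module_scheme \<Rightarrow> 'm set \<Rightarrow> bool" where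
  "cyclic_submodule R M N \<longleftrightarrow> (\<exists>x \<in> carrier M. N = (\<lambda>a. a \<odot>\<^bsub>M\<^esub> x) ` carrier R)"


section \<open>Finitely presented modules and elementary divisor rings\<close>

text \<open>The module of \<open>n\<close>-tuples over \<open>R\<close>. The fields \<^const>\<open>mult\<close> and \<^const>\<open>one\<close>, which every
  module record inherits from the ring record, are irrelevant.\<close>

definition free_module :: "('a, 'r) ring_scheme \<Rightarrow> nat \<Rightarrow> ('a, nat \<Rightarrow> 'a) module" where
  "free_module R n =
    \<lparr>carrier = {..<n} \<rightarrow>\<^sub>E carrier R,
     mult = undefined,
     one = undefined,
     zero = (\<lambda>i \<in> {..<n}. \<zero>\<^bsub>R\<^esub>),
     add = (\<lambda>x y. \<lambda>i \<in> {..<n}. x i \<oplus>\<^bsub>R\<^esub> y i),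
     smult = (\<lambda>a x. \<lambda>i \<in> {..<n}. a \<otimes>\<^bsub>R\<^esub> x i)\<rparr>"

lemma (in cring) module_free_module: "module R (free_module R n)"
proof (intro moduleI abelian_groupI)
  fix x assume "x \<in> carrier (free_module R n)"
  then show "\<exists>y \<in> carrier (free_module R n). y \<oplus>\<^bsub>free_module R n\<^esub> x = \<zero>\<^bsub>free_module R n\<^esub>"
    by (intro bexI[of _ "\<lambda>i \<in> {..<n}. \<ominus> x i"])
      (auto simp: free_module_def PiE_iff l_neg restrict_def extensional_def)
qed (auto simp: free_module_def PiE_iff a_ac m_assoc l_distr r_distr restrict_def
    extensional_def fun_eq_iff is_cring)

text \<open>There is an exact sequence \<open>R\<^sup>m \<rightarrow> R\<^sup>n \<rightarrow> M \<rightarrow> 0\<close>.\<close>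

definition finitely_presented :: "('a, 'r) ring_scheme \<Rightarrow> ('a, 'm, 'k) module_scheme \<Rightarrow> bool" where
  "finitely_presented R M \<longleftrightarrow>
    (\<exists>m n. \<exists>g \<in> module_homs R (free_module R m) (free_module R n).
      \<exists>f \<in> module_homs R (free_module R n) M.
        f ` carrier (free_module R n) = carrier M \<and>
        {x \<in> carrier (free_module R n). f x = \<zero>\<^bsub>M\<^esub>} = g ` carrier (free_module R m))"

text \<open>HOL cannot quantify over types inside a formula, so the type \<open>'n\<close> in which the modules have
  their carriers is a parameter. It is meant to be left as a free type variable of a theorem that
  concludes \<open>elementary_divisor_ring TYPE('n) R\<close>.\<close>

definition elementary_divisor_ring :: "'n itself \<Rightarrow> ('a, 'r) ring_scheme \<Rightarrow> bool" where
  "elementary_divisor_ring _ R \<longleftrightarrow>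
    (\<forall>M :: ('a, 'n) module. module R M \<and> finitely_presented R M \<longrightarrow>
      (\<exists>\<C>. (\<forall>N \<in> \<C>. cyclic_submodule R M N) \<and> internal_direct_sum R M \<C>))"

text \<open>Hypotheses on all \<open>R\<close>-modules have to be stated for the modules carried by subsets of one
  type \<open>'m\<close>, which then plays the role of a universe. For a small type, such as a finite one, such
  a hypothesis says too little; a reasonable universe is infinite and contains a copy of \<open>R\<close>, so
  that it represents every module of cardinality at most \<open>max(|R|, \<aleph>\<^sub>0)\<close> up to isomorphism.\<close>

end

theory Submission
  imports Defs "HOL-Algebra.UnivPoly"
begin

text \<open>A property of ideals that passes from the union of a chain to a member, and from \<open>I + R e\<close> and
  \<open>I + R (1 - e)\<close> to \<open>I\<close> whenever \<open>e (1 - e) \<in> I\<close>, holds for every ideal as soon as it holds for the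
  ideals \<open>I\<close> such that \<open>R / I\<close> has no nontrivial idempotents: consider a maximal counterexample. Both
  ``\<open>x\<close> is the sum of a unit and an idempotent modulo \<open>I\<close>'' and ``\<open>M / I M\<close> is a direct sum of cyclic
  modules'', for a finitely presented \<open>M\<close>, are such properties. So it is enough to show that \<open>R / I\<close> is
  a local chain ring whenever it has no nontrivial idempotents; over a local chain ring the first
  property is clear and the second one is Gaussian elimination.

  If \<open>R / I\<close> has no nontrivial idempotents, it is an indecomposable module and hence local. Suppose that
  it has incomparable elements \<open>a\<close>, \<open>b\<close> and let \<open>m\<close> be its maximal ideal. After enlarging \<open>I\<close> by
  \<open>m a + m b\<close>, the elements \<open>a\<close> and \<open>b\<close> span a two-dimensional vector space over the residue field. Then
  \<open>Q = R[t] / (b - a t, I)\<close> is indecomposable over \<open>R\<close>: an endomorphism commutes with \<open>t\<close> modulo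
  \<open>m Q = {x. a x = 0}\<close>, so an idempotent one is \<open>0\<close> or \<open>1\<close> modulo \<open>m Q\<close>, and Nakayama's lemma applies.
  But neither \<open>t\<close> nor \<open>1 - t\<close> is surjective on \<open>Q\<close>, so its endomorphism ring is not local.\<close>

section \<open>Ideals and clean rings\<close>

text \<open>Three points decide the form of the argument. Finite presentation lets a decomposition
  of \<open>M / I M\<close> pass from the union of a chain to a member, because it reduces the
  decomposition to finitely many memberships. And \<open>Q\<close>, a quotient of
  \<open>R[t]\<close>, has to live in the type \<open>'m\<close> of which the hypothesis speaks;
  hence \<open>'m\<close> is infinite, and quotients are carried by chosen representatives instead
  of cosets.

  An endomorphism \<open>e\<close> nearly commutes with \<open>t\<close> because
  \<open>a t = b\<close> in \<open>Q\<close>: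
  \<open>a (e (t x)) = e (b x) = b (e x) = a (t (e x))\<close>. Enlarging \<open>I\<close> by
  \<open>m a + m b\<close>, with \<open>a\<close> and \<open>b\<close> still independent, makes the
  annihilator of \<open>a\<close> exactly \<open>m Q\<close>. Modulo \<open>m Q\<close>,
  \<open>e\<close> is therefore multiplication by a polynomial over a field, and an idempotent in
  this polynomial ring is trivial because the ring is a domain.\<close>

definition add_multiples :: "('a, 'r) ring_scheme \<Rightarrow> 'a set \<Rightarrow> 'a set \<Rightarrow> 'a \<Rightarrow> 'a set" where
  "add_multiples R I J x = {s \<oplus>\<^bsub>R\<^esub> m \<otimes>\<^bsub>R\<^esub> x | s m. s \<in> I \<and> m \<in> J}"

text \<open>Here and in the next two definitions, a property of \<open>R / I\<close> is expressed by
  elements of \<open>R\<close>, so that \<open>I\<close> can vary in a Zorn argument without any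
  quotient ring being formed.\<close>

definition connected_ideal :: "('a, 'r) ring_scheme \<Rightarrow> 'a set \<Rightarrow> bool" where
  "connected_ideal R I \<longleftrightarrow> \<one>\<^bsub>R\<^esub> \<notin> I \<and>
    (\<forall>e \<in> carrier R. e \<otimes>\<^bsub>R\<^esub> (\<one>\<^bsub>R\<^esub> \<ominus>\<^bsub>R\<^esub> e) \<in> I \<longrightarrow> e \<in> I \<or> \<one>\<^bsub>R\<^esub> \<ominus>\<^bsub>R\<^esub> e \<in> I)"

text \<open>Of two elements with sum 1 in \<open>R / I\<close>, one is a unit. This elementwise form
  of locality is what a local endomorphism ring delivers and what cleanness consumes.\<close>

definition local_ideal :: "('a, 'r) ring_scheme \<Rightarrow> 'a set \<Rightarrow> bool" where
  "local_ideal R I \<longleftrightarrow> \<one>\<^bsub>R\<^esub> \<notin> I \<and>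
    (\<forall>a \<in> carrier R. (\<exists>b \<in> carrier R. a \<otimes>\<^bsub>R\<^esub> b \<ominus>\<^bsub>R\<^esub> \<one>\<^bsub>R\<^esub> \<in> I) \<or>
      (\<exists>b \<in> carrier R. (\<one>\<^bsub>R\<^esub> \<ominus>\<^bsub>R\<^esub> a) \<otimes>\<^bsub>R\<^esub> b \<ominus>\<^bsub>R\<^esub> \<one>\<^bsub>R\<^esub> \<in> I))"

definition chain_ideal :: "('a, 'r) ring_scheme \<Rightarrow> 'a set \<Rightarrow> bool" where
  "chain_ideal R I \<longleftrightarrow> (\<forall>a \<in> carrier R. \<forall>b \<in> carrier R. \<exists>c \<in> carrier R.
    a \<ominus>\<^bsub>R\<^esub> c \<otimes>\<^bsub>R\<^esub> b \<in> I \<or> b \<ominus>\<^bsub>R\<^esub> c \<otimes>\<^bsub>R\<^esub> a \<in> I)"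

lemma (in abelian_group) minus_eq_zeroD:
  assumes "x \<in> carrier G" "y \<in> carrier G" "x \<ominus> y = \<zero>"
  shows "x = y"
proof -
  have "x = (x \<ominus> y) \<oplus> y"
    using assms(1,2) by (simp add: minus_eq a_assoc l_neg)
  then show ?thesis
    using assms by simp
qed

section \<open>Arithmetic of ideals\<close>

context cring begin

lemma ideal_in_carrier: "ideal I R \<Longrightarrow> x \<in> I \<Longrightarrow> x \<in> carrier R"
  by (rule ideal.Icarr)

lemma ideal_zero: "ideal I R \<Longrightarrow> \<zero> \<in> I"
  by (simp add: additive_subgroup.zero_closed ideal.axioms(1))

lemma ideal_add: "ideal I R \<Longrightarrow> x \<in> I \<Longrightarrow> y \<in> I \<Longrightarrow> x \<oplus> y \<in> I"
  by (simp add: additive_subgroup.a_closed ideal.axioms(1))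

lemma ideal_uminus: "ideal I R \<Longrightarrow> x \<in> I \<Longrightarrow> \<ominus> x \<in> I"
  by (simp add: additive_subgroup.a_inv_closed ideal.axioms(1))

lemma ideal_diff: "ideal I R \<Longrightarrow> x \<in> I \<Longrightarrow> y \<in> I \<Longrightarrow> x \<ominus> y \<in> I"
  by (simp add: a_minus_def ideal_add ideal_uminus)

lemma ideal_mult_left: "ideal I R \<Longrightarrow> x \<in> I \<Longrightarrow> r \<in> carrier R \<Longrightarrow> r \<otimes> x \<in> I"
  by (rule ideal.I_l_closed)

lemma ideal_mult_right: "ideal I R \<Longrightarrow> x \<in> I \<Longrightarrow> r \<in> carrier R \<Longrightarrow> x \<otimes> r \<in> I"
  by (rule ideal.I_r_closed)

lemma ideal_cong:
  assumes "ideal I R" "x \<in> carrier R" "y \<in> carrier R" "x \<ominus> y \<in> I" "y \<in> I"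
  shows "x \<in> I"
proof -
  have "(x \<ominus> y) \<oplus> y \<in> I"
    using assms ideal_add by blast
  moreover have "(x \<ominus> y) \<oplus> y = x"
    using assms by algebra
  ultimately show ?thesis by simp
qed

lemma ideal_finsum:
  assumes "ideal I R" "finite A" "\<And>i. i \<in> A \<Longrightarrow> f i \<in> I"
  shows "finsum R f A \<in> I"
  using assms(2,3)
proof (induction A)
  case empty
  then show ?case by (simp add: ideal_zero assms(1))
next
  case (insert x F)
  then have "f \<in> F \<rightarrow> carrier R" "f x \<in> carrier R"
    using ideal_in_carrier[OF assms(1)] by auto
  with insert show ?case by (simp add: ideal_add assms(1))
qed

lemma idealI':
  assumes "I \<subseteq> carrier R" "\<zero> \<in> I" "\<And>x y. x \<in> I \<Longrightarrow> y \<in> I \<Longrightarrow> x \<oplus> y \<in> I"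
    "\<And>r x. r \<in> carrier R \<Longrightarrow> x \<in> I \<Longrightarrow> r \<otimes> x \<in> I"
  shows "ideal I R"
proof (rule idealI)
  show "ring R" by (rule ring_axioms)
  have "\<ominus> x \<in> I" if "x \<in> I" for x
    using assms(4)[of "\<ominus> \<one>" x] that assms(1) by (simp add: l_minus subset_iff)
  then show "subgroup I (add_monoid R)"
    using assms by (intro add.subgroupI) (auto simp: a_inv_def)
  show "x \<otimes> a \<in> I" "a \<otimes> x \<in> I" if "a \<in> I" "x \<in> carrier R" for a x
    using assms(1) assms(4)[OF that(2,1)] m_comm[of a x] that by auto
qed

text \<open>The coefficient ideal \<open>J\<close> is arbitrary because two cases occur:
  \<open>I + R x\<close> splits off an idempotent or collects the multiples of a pivot, while
  \<open>I + m x\<close> absorbs products with a maximal ideal and forms the steps of the Nakayama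
  filtration.\<close>

lemma ideal_add_multiples:
  assumes I: "ideal I R" and J: "ideal J R" and x: "x \<in> carrier R"
  shows "ideal (add_multiples R I J x) R"
proof (rule idealI')
  note carr = ideal_in_carrier[OF I] ideal_in_carrier[OF J]
  show "add_multiples R I J x \<subseteq> carrier R"
    using carr x by (auto simp: add_multiples_def)
  have "\<zero> = \<zero> \<oplus> \<zero> \<otimes> x"
    using x by simp
  then show "\<zero> \<in> add_multiples R I J x"
    unfolding add_multiples_def using ideal_zero[OF I] ideal_zero[OF J] by blast
  fix u v assume "u \<in> add_multiples R I J x" "v \<in> add_multiples R I J x"
  then obtain s m s' m' where *: "s \<in> I" "m \<in> J" "u = s \<oplus> m \<otimes> x" "s' \<in> I" "m' \<in> J" "v = s' \<oplus> m' \<otimes> x"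
    unfolding add_multiples_def by blast
  then have "s \<in> carrier R" "m \<in> carrier R" "s' \<in> carrier R" "m' \<in> carrier R"
    using carr by auto
  then have "u \<oplus> v = (s \<oplus> s') \<oplus> (m \<oplus> m') \<otimes> x"
    unfolding * using x by algebra
  then show "u \<oplus> v \<in> add_multiples R I J x"
    unfolding add_multiples_def using * ideal_add[OF I] ideal_add[OF J] by blast
next
  note carr = ideal_in_carrier[OF I] ideal_in_carrier[OF J]
  fix r u assume r: "r \<in> carrier R" and "u \<in> add_multiples R I J x"
  then obtain s m where *: "s \<in> I" "m \<in> J" "u = s \<oplus> m \<otimes> x"
    unfolding add_multiples_def by blast
  then have "s \<in> carrier R" "m \<in> carrier R"
    using carr by auto
  then have "r \<otimes> u = r \<otimes> s \<oplus> (r \<otimes> m) \<otimes> x"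
    unfolding * using x r by algebra
  then show "r \<otimes> u \<in> add_multiples R I J x"
    unfolding add_multiples_def using * r ideal_mult_left[OF I] ideal_mult_left[OF J] by blast
qed

lemma add_multiplesI:
  "s \<in> I \<Longrightarrow> m \<in> J \<Longrightarrow> s \<oplus> m \<otimes> x \<in> add_multiples R I J x"
  unfolding add_multiples_def by blast

lemma subset_add_multiples:
  assumes "ideal I R" "ideal J R" "x \<in> carrier R"
  shows "I \<subseteq> add_multiples R I J x"
proof
  fix s assume "s \<in> I"
  then have "s \<oplus> \<zero> \<otimes> x \<in> add_multiples R I J x"
    using assms by (intro add_multiplesI ideal_zero)
  with \<open>s \<in> I\<close> show "s \<in> add_multiples R I J x"
    using assms ideal_in_carrier by simp
qed

lemma multiple_in_add_multiples:
  assumes "ideal I R" "ideal J R" "x \<in> carrier R" "m \<in> J"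
  shows "m \<otimes> x \<in> add_multiples R I J x"
proof -
  have "\<zero> \<oplus> m \<otimes> x \<in> add_multiples R I J x"
    using assms by (intro add_multiplesI ideal_zero)
  then show ?thesis
    using assms ideal_in_carrier by simp
qed

lemma mem_add_multiples_self:
  assumes "ideal I R" "x \<in> carrier R"
  shows "x \<in> add_multiples R I (carrier R) x"
  using multiple_in_add_multiples[OF assms(1) oneideal assms(2), of \<one>] assms(2) by simp

lemma add_multiples_annihilated:
  assumes "ideal I R" "e \<in> carrier R" "f \<in> carrier R" "e \<otimes> f \<in> I" "x \<in> add_multiples R I (carrier R) e"
  shows "f \<otimes> x \<in> I"
proof -
  obtain s m where *: "s \<in> I" "m \<in> carrier R" "x = s \<oplus> m \<otimes> e"
    using assms(5) unfolding add_multiples_def by blast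
  then have "s \<in> carrier R"
    using ideal_in_carrier assms(1) by blast
  then have "f \<otimes> x = f \<otimes> s \<oplus> m \<otimes> (e \<otimes> f)"
    unfolding * using assms * by algebra
  then show ?thesis
    using assms * ideal_add ideal_mult_left by simp
qed

section \<open>Induction over ideals by a maximal counterexample\<close>

lemma ideal_chain_Union:
  assumes C: "subset.chain {I. ideal I R} C" "C \<noteq> {}"
  shows "ideal (\<Union>C) R"
proof (rule idealI')
  have C': "ideal I R" if "I \<in> C" for I
    using that C(1) by (auto simp: subset.chain_def)
  show "\<Union>C \<subseteq> carrier R"
    using C' ideal_in_carrier by blast
  show "\<zero> \<in> \<Union>C"
    using C' C(2) ideal_zero by blast
  fix x y assume "x \<in> \<Union>C" "y \<in> \<Union>C"
  then have "{x, y} \<subseteq> \<Union>C"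
    by simp
  have "\<exists>I\<in>C. {x, y} \<subseteq> I"
    by (rule finite_subset_Union_chain[OF _ \<open>{x, y} \<subseteq> \<Union>C\<close> C(2,1)]) auto
  then obtain I where "I \<in> C" "x \<in> I" "y \<in> I"
    by auto
  then show "x \<oplus> y \<in> \<Union>C"
    using C'[of I] ideal_add[of I x y] by blast
next
  fix r x assume r: "r \<in> carrier R" and "x \<in> \<Union>C"
  then obtain I where I: "I \<in> C" "x \<in> I" by blast
  then have "ideal I R"
    using C(1) by (auto simp: subset.chain_def)
  then show "r \<otimes> x \<in> \<Union>C"
    using ideal_mult_left[OF _ I(2) r] I(1) by blast
qed

text \<open>\<open>x = (1 - e) x + e x\<close>, where \<open>1 - e\<close> multiplies the first
  ideal into \<open>I\<close> and \<open>e\<close> multiplies the second one into \<open>I\<close>.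
  This is the injectivity half of the Chinese remainder theorem, for an \<open>e\<close> that is
  idempotent modulo \<open>I\<close>.\<close>

lemma annihilated_pair_mem:
  assumes I: "ideal I R" and e: "e \<in> carrier R" "e \<otimes> (\<one> \<ominus> e) \<in> I"
    and x: "x \<in> add_multiples R I (carrier R) e" "x \<in> add_multiples R I (carrier R) (\<one> \<ominus> e)"
  shows "x \<in> I"
proof -
  have "x \<in> carrier R"
    using ideal_in_carrier[OF ideal_add_multiples[OF I oneideal e(1)] x(1)] .
  then have "x = (\<one> \<ominus> e) \<otimes> x \<oplus> e \<otimes> x"
    using e by algebra
  moreover have "(\<one> \<ominus> e) \<otimes> e \<in> I"
    using e by (simp add: m_comm)
  ultimately show ?thesis
    using add_multiples_annihilated[OF I e(1) _ e(2) x(1)] e(1)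
      add_multiples_annihilated[OF I _ e(1) _ x(2)] ideal_add[OF I] by (metis minus_closed one_closed)
qed

text \<open>By \<open>chain\<close>, the failures of \<open>P\<close> are closed under unions of
  chains, so there is a maximal failure \<open>M\<close>, and \<open>improper\<close> makes it a
  proper ideal. If some \<open>e\<close> showed that \<open>M\<close> is not connected, adding
  \<open>e\<close> or \<open>1 - e\<close> would give strictly larger ideals, which satisfy
  \<open>P\<close>, and \<open>split\<close> would yield \<open>P M\<close>.\<close>

theorem ideal_property_connected_induct:
  assumes chain: "\<And>C. C \<noteq> {} \<Longrightarrow> subset.chain {I. ideal I R} C \<Longrightarrow> P (\<Union>C) \<Longrightarrow> \<exists>I\<in>C. P I"
    and split: "\<And>I e. ideal I R \<Longrightarrow> e \<in> carrier R \<Longrightarrow> e \<otimes> (\<one> \<ominus> e) \<in> I \<Longrightarrow>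
      P (add_multiples R I (carrier R) e) \<Longrightarrow> P (add_multiples R I (carrier R) (\<one> \<ominus> e)) \<Longrightarrow> P I"
    and improper: "P (carrier R)"
    and connected: "\<And>I. ideal I R \<Longrightarrow> connected_ideal R I \<Longrightarrow> P I"
    and I: "ideal I R"
  shows "P I"
proof (rule ccontr)
  assume nP: "\<not> P I"
  define A where "A = {J. ideal J R \<and> \<not> P J}"
  have "\<exists>M\<in>A. \<forall>X\<in>A. M \<subseteq> X \<longrightarrow> X = M"
  proof (rule subset_Zorn_nonempty)
    show "A \<noteq> {}"
      using nP I by (auto simp: A_def)
    fix C assume C: "C \<noteq> {}" "subset.chain A C"
    then have ch: "subset.chain {I. ideal I R} C"
      unfolding subset.chain_def A_def by blast
    have "ideal (\<Union>C) R"
      using ideal_chain_Union[OF ch C(1)] .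
    moreover have "\<not> P (\<Union>C)"
      using chain[OF C(1) ch] C(2) unfolding subset.chain_def A_def by blast
    ultimately show "\<Union>C \<in> A"
      by (simp add: A_def)
  qed
  then obtain M where M: "ideal M R" "\<not> P M"
    and max: "\<And>X. ideal X R \<Longrightarrow> M \<subseteq> X \<Longrightarrow> X \<noteq> M \<Longrightarrow> P X"
    unfolding A_def by blast
  have "\<one> \<notin> M"
    using M improper ideal.one_imp_carrier by blast
  moreover have "e \<in> M \<or> \<one> \<ominus> e \<in> M" if e: "e \<in> carrier R" "e \<otimes> (\<one> \<ominus> e) \<in> M" for e
  proof (rule ccontr)
    assume *: "\<not> (e \<in> M \<or> \<one> \<ominus> e \<in> M)"
    have "P (add_multiples R M (carrier R) f)" if "f \<in> carrier R" "f \<notin> M" for f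
      using that M(1) mem_add_multiples_self subset_add_multiples[OF M(1) oneideal]
        ideal_add_multiples[OF M(1) oneideal] by (intro max) auto
    then show False
      using split[OF M(1) e] M(2) * e by simp
  qed
  ultimately have "connected_ideal R M"
    unfolding connected_ideal_def by simp
  then show False
    using connected[OF M(1)] M(2) by simp
qed

lemma clean_ringI:
  assumes local: "\<And>I. ideal I R \<Longrightarrow> connected_ideal R I \<Longrightarrow> local_ideal R I"
  shows "clean_ring R"
  unfolding clean_ring_def
proof
  fix x assume x: "x \<in> carrier R"
  \<comment> \<open>The inverse \<open>v\<close> is part of the data, so \<open>P I\<close> consists
    of three memberships in \<open>I\<close>. That is why it passes from the union of a chain to a
    member.\<close>
  define P where "P I \<longleftrightarrow> (\<exists>u\<in>carrier R. \<exists>v\<in>carrier R. \<exists>e\<in>carrier R.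
    u \<otimes> v \<ominus> \<one> \<in> I \<and> e \<otimes> e \<ominus> e \<in> I \<and> x \<ominus> (u \<oplus> e) \<in> I)" for I
  have "P {\<zero>}"
  proof (rule ideal_property_connected_induct[where P = P])
    show "ideal {\<zero>} R" by (rule zeroideal)
    have "\<one> \<in> carrier R" by simp
    then show "P (carrier R)"
      unfolding P_def using x by blast
  next
    fix C assume C: "C \<noteq> {}" "subset.chain {I. ideal I R} C" "P (\<Union>C)"
    from C(3) obtain u v e where *: "u \<in> carrier R" "v \<in> carrier R" "e \<in> carrier R"
      "{u \<otimes> v \<ominus> \<one>, e \<otimes> e \<ominus> e, x \<ominus> (u \<oplus> e)} \<subseteq> \<Union>C"
      unfolding P_def by auto
    obtain I where "I \<in> C" "{u \<otimes> v \<ominus> \<one>, e \<otimes> e \<ominus> e, x \<ominus> (u \<oplus> e)} \<subseteq> I"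
      by (rule finite_subset_Union_chain[OF _ *(4) C(1,2)]) auto
    with * show "\<exists>I\<in>C. P I"
      unfolding P_def by blast
  next
    fix I e assume I: "ideal I R" and e: "e \<in> carrier R" "e \<otimes> (\<one> \<ominus> e) \<in> I"
      and "P (add_multiples R I (carrier R) e)" "P (add_multiples R I (carrier R) (\<one> \<ominus> e))"
    let ?f = "\<one> \<ominus> e"
    have f: "?f \<in> carrier R"
      using e by simp
    define J K where "J = add_multiples R I (carrier R) e" and "K = add_multiples R I (carrier R) ?f"
    have J: "ideal J R" and K: "ideal K R"
      unfolding J_def K_def using e by (simp_all add: ideal_add_multiples I oneideal)
    obtain u v g where u: "u \<in> carrier R" "v \<in> carrier R" "g \<in> carrier R"
      "u \<otimes> v \<ominus> \<one> \<in> J" "g \<otimes> g \<ominus> g \<in> J" "x \<ominus> (u \<oplus> g) \<in> J"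
      using \<open>P (add_multiples R I (carrier R) e)\<close> unfolding P_def J_def by blast
    obtain u' v' g' where u': "u' \<in> carrier R" "v' \<in> carrier R" "g' \<in> carrier R"
      "u' \<otimes> v' \<ominus> \<one> \<in> K" "g' \<otimes> g' \<ominus> g' \<in> K" "x \<ominus> (u' \<oplus> g') \<in> K"
      using \<open>P (add_multiples R I (carrier R) (\<one> \<ominus> e))\<close> unfolding P_def K_def by blast
    \<comment> \<open>Chinese remainder: as \<open>e\<close> lies in \<open>J\<close> and
      \<open>1 - e\<close> in \<open>K\<close>, the element \<open>(1 - e) a + e b\<close> is
      congruent to \<open>a\<close> modulo \<open>J\<close> and to \<open>b\<close> modulo
      \<open>K\<close>.\<close>
    have glue: "\<exists>w\<in>carrier R. w \<ominus> a \<in> J \<and> w \<ominus> b \<in> K"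
      if "a \<in> carrier R" "b \<in> carrier R" for a b
    proof
      have "(?f \<otimes> a \<oplus> e \<otimes> b) \<ominus> a = (b \<ominus> a) \<otimes> e" "(?f \<otimes> a \<oplus> e \<otimes> b) \<ominus> b = (a \<ominus> b) \<otimes> ?f"
        using that e by algebra+
      then show "(?f \<otimes> a \<oplus> e \<otimes> b) \<ominus> a \<in> J \<and> (?f \<otimes> a \<oplus> e \<otimes> b) \<ominus> b \<in> K"
        unfolding J_def K_def using multiple_in_add_multiples[OF I oneideal] that e by auto
    qed (use that e in auto)
    obtain U V G where UVG: "U \<in> carrier R" "V \<in> carrier R" "G \<in> carrier R"
      "U \<ominus> u \<in> J" "V \<ominus> v \<in> J" "G \<ominus> g \<in> J" "U \<ominus> u' \<in> K" "V \<ominus> v' \<in> K" "G \<ominus> g' \<in> K"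
      using glue u(1-3) u'(1-3) by metis
    \<comment> \<open>The three conditions depend only on the classes of the witnesses, so the glued
      witnesses satisfy them modulo \<open>J\<close> and modulo \<open>K\<close>, hence modulo the
      intersection.\<close>
    have *: "U \<otimes> V \<ominus> \<one> \<in> L \<and> G \<otimes> G \<ominus> G \<in> L \<and> x \<ominus> (U \<oplus> G) \<in> L"
      if L: "ideal L R" and c: "u \<in> carrier R" "v \<in> carrier R" "g \<in> carrier R"
        and "u \<otimes> v \<ominus> \<one> \<in> L" "g \<otimes> g \<ominus> g \<in> L" "x \<ominus> (u \<oplus> g) \<in> L"
          "U \<ominus> u \<in> L" "V \<ominus> v \<in> L" "G \<ominus> g \<in> L" for L u v g
    proof -
      have "U \<otimes> V \<ominus> \<one> = (U \<ominus> u) \<otimes> V \<oplus> u \<otimes> (V \<ominus> v) \<oplus> (u \<otimes> v \<ominus> \<one>)"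
        "G \<otimes> G \<ominus> G = (G \<ominus> g) \<otimes> G \<oplus> g \<otimes> (G \<ominus> g) \<oplus> ((g \<otimes> g \<ominus> g) \<ominus> (G \<ominus> g))"
        "x \<ominus> (U \<oplus> G) = (x \<ominus> (u \<oplus> g)) \<ominus> ((U \<ominus> u) \<oplus> (G \<ominus> g))"
        using x c UVG(1-3) by algebra+
      then show ?thesis
        using L that UVG(1-3) by (simp add: ideal_add ideal_diff ideal_mult_left ideal_mult_right)
    qed
    show "P I"
      using *[OF J u] *[OF K u'] UVG annihilated_pair_mem[OF I e] unfolding P_def J_def K_def
      by blast
  next
    fix I assume I: "ideal I R" and con: "connected_ideal R I"
    from local[OF this] x
    consider b where "b \<in> carrier R" "x \<otimes> b \<ominus> \<one> \<in> I"
      | b where "b \<in> carrier R" "(\<one> \<ominus> x) \<otimes> b \<ominus> \<one> \<in> I"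
      unfolding local_ideal_def by blast
    then show "P I"
    \<comment> \<open>In a local quotient the idempotents 0 and 1 suffice: \<open>x = x + 0\<close>
      if \<open>x\<close> is a unit, and \<open>x = (x - 1) + 1\<close> if \<open>1 - x\<close> is
      one.\<close>
    proof cases
      case 1
      have "\<zero> \<otimes> \<zero> \<ominus> \<zero> = \<zero>" "x \<ominus> (x \<oplus> \<zero>) = \<zero>"
        using x by algebra+
      with 1 x show ?thesis
        unfolding P_def using ideal_zero[OF I] zero_closed by metis
    next
      case 2
      have "\<one> \<otimes> \<one> \<ominus> \<one> = \<zero>" "x \<ominus> ((x \<ominus> \<one>) \<oplus> \<one>) = \<zero>"
        "(x \<ominus> \<one>) \<otimes> (\<ominus> b) \<ominus> \<one> = (\<one> \<ominus> x) \<otimes> b \<ominus> \<one>"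
        using x 2(1) by algebra+
      with 2 x show ?thesis
        unfolding P_def using ideal_zero[OF I] one_closed minus_closed a_inv_closed by metis
    qed
  qed
  then obtain u v e where *: "u \<in> carrier R" "v \<in> carrier R" "e \<in> carrier R"
    "u \<otimes> v \<ominus> \<one> = \<zero>" "e \<otimes> e \<ominus> e = \<zero>" "x \<ominus> (u \<oplus> e) = \<zero>"
    unfolding P_def by auto
  then have "u \<otimes> v = \<one>" "e \<otimes> e = e" "x = u \<oplus> e"
    using x minus_eq_zeroD by auto
  moreover from this have "u \<in> Units R"
    using * m_comm[of u v] unfolding Units_def by (auto intro!: bexI[of _ v])
  ultimately show "\<exists>u\<in>Units R. \<exists>e\<in>carrier R. e \<otimes> e = e \<and> x = u \<oplus> e"
    using *(3) by (intro bexI[of _ u] bexI[of _ e] conjI)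
qed

end

section \<open>Quotient modules and endomorphisms\<close>

text \<open>An infinite type absorbs its square, so lists of a fixed length over it can be encoded
  in it, and a polynomial is determined by a degree bound together with its list of coefficients up
  to that bound. This gives quotients of \<open>R[t]\<close> a place in the universe.\<close>

lemma finitely_supported_inj:
  includes cardinal_syntax
  assumes inf: "infinite (UNIV :: 'm set)" and h: "inj_on (h :: 'a \<Rightarrow> 'm) (carrier R)"
  shows "\<exists>H :: (nat \<Rightarrow> 'a) \<Rightarrow> 'm. inj_on H (up R)"
proof -
  from inf have "|UNIV \<times> UNIV :: ('m \<times> 'm) set| =o |UNIV :: 'm set|"
    by (rule card_of_Times_same_infinite)
  then have "\<exists>p. bij_betw p (UNIV \<times> UNIV :: ('m \<times> 'm) set) (UNIV :: 'm set)"
    by (simp only: card_of_ordIso)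
  then obtain p :: "'m \<times> 'm \<Rightarrow> 'm" where "inj p"
    by (auto simp: bij_betw_def)
  then have p: "p x = p y \<longleftrightarrow> x = y" for x y
    by (rule inj_eq)
  obtain g :: "nat \<Rightarrow> 'm" where g: "inj g"
    using infinite_countable_subset[OF inf] by blast
  \<comment> \<open>Nested pairs that end in the fixed value \<open>g 0\<close>. Lists of different
    lengths may collide, so injectivity is claimed only for equal lengths; \<open>H\<close> stores
    the bound \<open>N f\<close> beside the code.\<close>
  define enc where "enc xs = foldr (\<lambda>x y. p (x, y)) xs (g 0)" for xs
  have enc: "xs = ys" if "length xs = length ys" "enc xs = enc ys" for xs ys
    using that
  proof (induction xs ys rule: list_induct2)
    case (Cons x xs y ys)
    then have "p (x, enc xs) = p (y, enc ys)"
      by (simp add: enc_def)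
    then show ?case
      using Cons.IH unfolding p by simp
  qed simp
  define N where "N f = (LEAST n. bound \<zero>\<^bsub>R\<^esub> n f)" for f :: "nat \<Rightarrow> 'a"
  have N: "bound \<zero>\<^bsub>R\<^esub> (N f) f" if "f \<in> up R" for f
    unfolding N_def using that LeastI_ex[of "\<lambda>n. bound \<zero>\<^bsub>R\<^esub> n f"] by (simp add: up_def)
  \<comment> \<open>\<open>bound\<close> restricts only the indices above \<open>N f\<close>, hence
    the listed coefficients include the one at \<open>N f\<close>.\<close>
  define H where "H f = p (g (N f), enc (map (\<lambda>i. h (f i)) [0..<Suc (N f)]))" for f
  have "inj_on H (up R)"
  proof
    fix f f' assume f: "f \<in> up R" and f': "f' \<in> up R" and "H f = H f'"
    then have eq: "N f = N f'"
      and "enc (map (\<lambda>i. h (f i)) [0..<Suc (N f)]) = enc (map (\<lambda>i. h (f' i)) [0..<Suc (N f')])"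
      using g by (auto simp: H_def p inj_def)
    then have "map (\<lambda>i. h (f i)) [0..<Suc (N f)] = map (\<lambda>i. h (f' i)) [0..<Suc (N f)]"
      by (intro enc) auto
    then have low: "h (f i) = h (f' i)" if "i \<le> N f" for i
      using that by (simp del: upt_Suc)
    show "f = f'"
    proof
      fix i show "f i = f' i"
      proof (cases "i \<le> N f")
        case True
        then show ?thesis
          using low[OF True] f f' by (intro inj_onD[OF h]) (auto simp: up_def)
      next
        case False
        then show ?thesis
          using N[OF f] N[OF f'] eq by (simp add: bound_def)
      qed
    qed
  qed
  then show ?thesis by blast
qed

lemma (in abelian_group) diff_zero [simp]: "x \<in> carrier G \<Longrightarrow> x \<ominus> \<zero> = x"
  using add.inv_one by (simp add: minus_eq a_inv_def)

context module begin

text \<open>Sets up \<open>algebra\<close> for the additive group of \<open>M\<close>; \<^const>\<open>one\<close> and \<^const>\<open>mult\<close> only fill their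
  places in the signature.\<close>

lemmas abelian_group_simprules
  [algebra add: ring "zero M" "add M" "a_inv M" "a_minus M" "one M" "mult M"] =
  M.a_closed M.zero_closed M.a_inv_closed M.minus_closed M.a_assoc M.l_zero M.l_neg M.a_comm
  M.minus_eq M.r_zero M.r_neg M.r_neg2 M.r_neg1 M.minus_add M.minus_minus M.a_lcomm

section \<open>Submodules, and quotients inside a given type\<close>

lemma submoduleI':
  assumes "H \<subseteq> carrier M" "\<zero>\<^bsub>M\<^esub> \<in> H" "\<And>x y. x \<in> H \<Longrightarrow> y \<in> H \<Longrightarrow> x \<oplus>\<^bsub>M\<^esub> y \<in> H"
    "\<And>a x. a \<in> carrier R \<Longrightarrow> x \<in> H \<Longrightarrow> a \<odot>\<^bsub>M\<^esub> x \<in> H"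
  shows "submodule H R M"
proof (rule submoduleI)
  fix x assume "x \<in> H"
  then show "\<ominus>\<^bsub>M\<^esub> x \<in> H"
    using assms(4)[of "\<ominus> \<one>" x] assms(1) by (auto simp: smult_l_minus subset_iff)
qed (use assms in auto)

lemma submodule_diff: "submodule H R M \<Longrightarrow> x \<in> H \<Longrightarrow> y \<in> H \<Longrightarrow> x \<ominus>\<^bsub>M\<^esub> y \<in> H"
  by (simp add: a_minus_def submoduleE)

lemma submodule_zero: "submodule H R M \<Longrightarrow> \<zero>\<^bsub>M\<^esub> \<in> H"
  using subgroup.one_closed[OF submodule.axioms(1)] by fastforce

lemma submodule_cong:
  assumes "submodule H R M" "x \<in> carrier M" "y \<in> carrier M" "x \<ominus>\<^bsub>M\<^esub> y \<in> H" "y \<in> H"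
  shows "x \<in> H"
proof -
  have "(x \<ominus>\<^bsub>M\<^esub> y) \<oplus>\<^bsub>M\<^esub> y = x"
    using assms(2,3) by (simp add: M.minus_eq M.a_assoc M.l_neg)
  then show ?thesis
    using submoduleE(5)[OF assms(1,4,5)] by simp
qed

lemma smult_minus_left:
  "a \<in> carrier R \<Longrightarrow> b \<in> carrier R \<Longrightarrow> x \<in> carrier M \<Longrightarrow> (a \<ominus>\<^bsub>R\<^esub> b) \<odot>\<^bsub>M\<^esub> x = a \<odot>\<^bsub>M\<^esub> x \<ominus>\<^bsub>M\<^esub> b \<odot>\<^bsub>M\<^esub> x"
  by (simp add: R.minus_eq M.minus_eq smult_l_distr smult_l_minus)

lemma smult_minus_right:
  "a \<in> carrier R \<Longrightarrow> x \<in> carrier M \<Longrightarrow> y \<in> carrier M \<Longrightarrow> a \<odot>\<^bsub>M\<^esub> (x \<ominus>\<^bsub>M\<^esub> y) = a \<odot>\<^bsub>M\<^esub> x \<ominus>\<^bsub>M\<^esub> a \<odot>\<^bsub>M\<^esub> y"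
  by (simp add: M.minus_eq smult_r_distr smult_r_minus)

text \<open>Cosets would change the type of the carrier, whereas the hypothesis on indecomposable
  modules speaks of one type \<open>'m\<close>. So each coset is replaced by the
  \<open>h\<close>-image of a chosen representative.\<close>

lemma quotient_module_exists:
  assumes K: "submodule K R M" and h: "inj_on (h :: _ \<Rightarrow> 'm) (carrier M)"
  shows "\<exists>(Q :: ('a, 'm) module) \<pi>. module R Q \<and> \<pi> ` carrier M = carrier Q \<and>
    (\<forall>x\<in>carrier M. \<forall>y\<in>carrier M. \<pi> (x \<oplus>\<^bsub>M\<^esub> y) = \<pi> x \<oplus>\<^bsub>Q\<^esub> \<pi> y) \<and>
    (\<forall>a\<in>carrier R. \<forall>x\<in>carrier M. \<pi> (a \<odot>\<^bsub>M\<^esub> x) = a \<odot>\<^bsub>Q\<^esub> \<pi> x) \<and>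
    (\<forall>x\<in>carrier M. \<pi> x = \<zero>\<^bsub>Q\<^esub> \<longleftrightarrow> x \<in> K)"
proof -
  note KE = submoduleE[OF K]
  define rep where "rep x = (SOME y. y \<in> carrier M \<and> x \<ominus>\<^bsub>M\<^esub> y \<in> K)" for x
  have rep: "rep x \<in> carrier M \<and> x \<ominus>\<^bsub>M\<^esub> rep x \<in> K" if "x \<in> carrier M" for x
    unfolding rep_def using that submodule_zero[OF K]
    by (intro someI_ex[of "\<lambda>y. y \<in> carrier M \<and> x \<ominus>\<^bsub>M\<^esub> y \<in> K"] exI[of _ x])
      (auto simp: M.minus_eq M.r_neg)
  have diff_trans: "x \<ominus>\<^bsub>M\<^esub> z \<in> K"
    if "x \<in> carrier M" "y \<in> carrier M" "z \<in> carrier M" "x \<ominus>\<^bsub>M\<^esub> y \<in> K" "y \<ominus>\<^bsub>M\<^esub> z \<in> K" for x y z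
  proof -
    have "x \<ominus>\<^bsub>M\<^esub> z = (x \<ominus>\<^bsub>M\<^esub> y) \<oplus>\<^bsub>M\<^esub> (y \<ominus>\<^bsub>M\<^esub> z)"
      using that by (simp add: M.minus_eq M.a_assoc M.r_neg1)
    then show ?thesis using KE(5) that by simp
  qed
  have diff_sym: "y \<ominus>\<^bsub>M\<^esub> x \<in> K"
    if "x \<in> carrier M" "y \<in> carrier M" "x \<ominus>\<^bsub>M\<^esub> y \<in> K" for x y
    using KE(3)[OF that(3)] that by (simp add: M.minus_eq M.minus_add M.a_comm)
  have rep_eq: "rep x = rep y \<longleftrightarrow> x \<ominus>\<^bsub>M\<^esub> y \<in> K" if "x \<in> carrier M" "y \<in> carrier M" for x y
  proof
    assume "rep x = rep y"
    then show "x \<ominus>\<^bsub>M\<^esub> y \<in> K"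
      using rep[OF that(1)] rep[OF that(2)] diff_sym diff_trans that by metis
  next
    assume "x \<ominus>\<^bsub>M\<^esub> y \<in> K"
    \<comment> \<open>Congruent elements have the same candidates, so \<open>SOME\<close> makes the
      same choice for both.\<close>
    then have "z \<in> carrier M \<and> x \<ominus>\<^bsub>M\<^esub> z \<in> K \<longleftrightarrow> z \<in> carrier M \<and> y \<ominus>\<^bsub>M\<^esub> z \<in> K" for z
      using diff_sym diff_trans that by blast
    then show "rep x = rep y"
      unfolding rep_def by presburger
  qed
  define \<pi> where "\<pi> x = h (rep x)" for x
  have pi_eq: "\<pi> x = \<pi> y \<longleftrightarrow> x \<ominus>\<^bsub>M\<^esub> y \<in> K" if "x \<in> carrier M" "y \<in> carrier M" for x y
    using h rep that rep_eq unfolding \<pi>_def inj_on_def by metis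
  \<comment> \<open>A section of \<open>\<pi>\<close>: the operations of \<open>Q\<close> are
    computed on representatives in \<open>M\<close>, and by \<open>pi_eq\<close> the choice of
    representatives does not matter.\<close>
  define \<sigma> where "\<sigma> = inv_into (carrier M) \<pi>"
  have sigma: "\<sigma> (\<pi> x) \<in> carrier M" "\<sigma> (\<pi> x) \<ominus>\<^bsub>M\<^esub> x \<in> K" if "x \<in> carrier M" for x
  proof -
    show *: "\<sigma> (\<pi> x) \<in> carrier M"
      unfolding \<sigma>_def using that by (intro inv_into_into) auto
    have "\<pi> (\<sigma> (\<pi> x)) = \<pi> x"
      unfolding \<sigma>_def using that by (intro f_inv_into_f) auto
    then show "\<sigma> (\<pi> x) \<ominus>\<^bsub>M\<^esub> x \<in> K"
      using pi_eq * that by blast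
  qed
  define Q :: "('a, 'm) module" where
    "Q = \<lparr>carrier = \<pi> ` carrier M, mult = undefined, one = undefined, zero = \<pi> \<zero>\<^bsub>M\<^esub>,
      add = (\<lambda>u v. \<pi> (\<sigma> u \<oplus>\<^bsub>M\<^esub> \<sigma> v)), smult = (\<lambda>a u. \<pi> (a \<odot>\<^bsub>M\<^esub> \<sigma> u))\<rparr>"
  have add: "\<pi> (x \<oplus>\<^bsub>M\<^esub> y) = \<pi> x \<oplus>\<^bsub>Q\<^esub> \<pi> y" if "x \<in> carrier M" "y \<in> carrier M" for x y
  proof -
    have "(\<sigma> (\<pi> x) \<oplus>\<^bsub>M\<^esub> \<sigma> (\<pi> y)) \<ominus>\<^bsub>M\<^esub> (x \<oplus>\<^bsub>M\<^esub> y) = (\<sigma> (\<pi> x) \<ominus>\<^bsub>M\<^esub> x) \<oplus>\<^bsub>M\<^esub> (\<sigma> (\<pi> y) \<ominus>\<^bsub>M\<^esub> y)"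
      using sigma(1) that by (simp add: M.minus_eq M.minus_add M.a_ac)
    then show ?thesis
      using pi_eq[of "\<sigma> (\<pi> x) \<oplus>\<^bsub>M\<^esub> \<sigma> (\<pi> y)" "x \<oplus>\<^bsub>M\<^esub> y"] sigma that KE(5) by (simp add: Q_def)
  qed
  have smult: "\<pi> (a \<odot>\<^bsub>M\<^esub> x) = a \<odot>\<^bsub>Q\<^esub> \<pi> x" if "a \<in> carrier R" "x \<in> carrier M" for a x
  proof -
    have "(a \<odot>\<^bsub>M\<^esub> \<sigma> (\<pi> x)) \<ominus>\<^bsub>M\<^esub> (a \<odot>\<^bsub>M\<^esub> x) = a \<odot>\<^bsub>M\<^esub> (\<sigma> (\<pi> x) \<ominus>\<^bsub>M\<^esub> x)"
      using sigma(1) that by (simp add: smult_minus_right)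
    then show ?thesis
      using pi_eq[of "a \<odot>\<^bsub>M\<^esub> \<sigma> (\<pi> x)" "a \<odot>\<^bsub>M\<^esub> x"] sigma that KE(4) by (simp add: Q_def)
  qed
  have zero: "\<zero>\<^bsub>Q\<^esub> = \<pi> \<zero>\<^bsub>M\<^esub>" and carr: "carrier Q = \<pi> ` carrier M"
    by (simp_all add: Q_def)
  \<comment> \<open>Since \<open>\<pi>\<close> is onto and respects the operations, the module
    axioms for \<open>Q\<close> are images of those for \<open>M\<close>.\<close>
  have "module R Q"
  proof (intro moduleI abelian_groupI)
    fix u assume "u \<in> carrier Q"
    then obtain x where "x \<in> carrier M" "u = \<pi> x" by (auto simp: carr)
    then show "\<exists>v\<in>carrier Q. v \<oplus>\<^bsub>Q\<^esub> u = \<zero>\<^bsub>Q\<^esub>"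
      by (intro bexI[of _ "\<pi> (\<ominus>\<^bsub>M\<^esub> x)"]) (auto simp: carr zero M.l_neg simp flip: add)
  qed (auto simp: carr zero is_cring M.a_ac smult_l_distr smult_r_distr smult_assoc1
      simp flip: add smult)
  moreover have "\<forall>x\<in>carrier M. \<pi> x = \<zero>\<^bsub>Q\<^esub> \<longleftrightarrow> x \<in> K"
    using pi_eq[OF _ M.zero_closed] M.add.inv_one by (simp add: zero M.minus_eq a_inv_def)
  ultimately show ?thesis
    using add smult carr by (intro exI[of _ Q] exI[of _ \<pi>]) simp
qed

text \<open>\<open>f\<close> and \<open>1 - f\<close> have sum 1, so they cannot both lie in the
  ideal of non-units, and a unit of the endomorphism ring is surjective. Surjectivity is all that is
  kept, because it can be tested on single elements of \<open>M\<close>.\<close>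

lemma local_End_dichotomy:
  assumes "local_ring (End_ring R M)" and f: "f \<in> module_homs R M M"
  shows "f ` carrier M = carrier M \<or> (\<forall>y\<in>carrier M. \<exists>x\<in>carrier M. y = x \<ominus>\<^bsub>M\<^esub> f x)"
proof -
  let ?E = "End_ring R M"
  interpret E: ring ?E by (rule ring_End_ring)
  have id: "ideal (carrier ?E - Units ?E) ?E"
    using assms(1) by (simp add: local_ring_def)
  note f' = f[unfolded module_homs_def PiE_iff, simplified]
  define g where "g = (\<lambda>x\<in>carrier M. x \<ominus>\<^bsub>M\<^esub> f x)"
  have fE: "f \<in> carrier ?E"
    using f by (simp add: End_ring_def)
  have gE: "g \<in> carrier ?E"
    using f' by (auto simp: End_ring_def module_homs_def g_def M.minus_eq smult_r_distr smult_r_minus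
        M.minus_add M.a_ac)
  have "x \<oplus>\<^bsub>M\<^esub> (f x \<oplus>\<^bsub>M\<^esub> \<ominus>\<^bsub>M\<^esub> f x) = x" if "x \<in> carrier M" for x
    using f' that by (simp add: M.r_neg)
  then have "f \<oplus>\<^bsub>?E\<^esub> g = \<one>\<^bsub>?E\<^esub>"
    using f' by (auto simp: End_ring_def g_def M.minus_eq restrict_def fun_eq_iff M.a_lcomm)
  then have unit: "f \<in> Units ?E \<or> g \<in> Units ?E"
    using fE gE additive_subgroup.a_closed[OF ideal.axioms(1)[OF id], of f g] E.Units_one_closed
    by auto
  have surj: "\<exists>x\<in>carrier M. k x = y" if k: "k \<in> Units ?E" and y: "y \<in> carrier M" for k y
  proof -
    obtain l where l: "l \<in> carrier ?E" "k \<otimes>\<^bsub>?E\<^esub> l = \<one>\<^bsub>?E\<^esub>"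
      using k by (auto simp: Units_def)
    have "(k \<otimes>\<^bsub>?E\<^esub> l) y = k (l y)" "\<one>\<^bsub>?E\<^esub> y = y" "l y \<in> carrier M"
      using y l(1) by (auto simp: End_ring_def module_homs_def)
    then show ?thesis using l(2) by metis
  qed
  from unit show ?thesis
  proof
    assume 1: "f \<in> Units ?E"
    have "f ` carrier M = carrier M"
      using f' surj[OF 1] by (force simp: image_iff)
    then show ?thesis ..
  next
    assume 2: "g \<in> Units ?E"
    have "\<exists>x\<in>carrier M. y = x \<ominus>\<^bsub>M\<^esub> f x" if "y \<in> carrier M" for y
      using surj[OF 2 that] by (auto simp: g_def)
    then show ?thesis by simp
  qed
qed

text \<open>\<open>e x\<close> is the component of \<open>x\<close> in \<open>A\<close>. Two
  candidates for it differ by an element of \<open>A \<inter> B\<close>; this uniqueness yields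
  linearity and the values on \<open>A\<close> and \<open>B\<close>, each time by exhibiting a
  candidate.\<close>

lemma complement_projection:
  assumes A: "submodule A R M" and B: "submodule B R M"
    and int: "A \<inter> B = {\<zero>\<^bsub>M\<^esub>}" and sum: "A <+>\<^bsub>M\<^esub> B = carrier M"
  shows "\<exists>e\<in>module_homs R M M. (\<forall>x\<in>carrier M. e x \<in> A) \<and> (\<forall>x\<in>carrier M. x \<ominus>\<^bsub>M\<^esub> e x \<in> B) \<and>
    (\<forall>x\<in>A. e x = x) \<and> (\<forall>x\<in>B. e x = \<zero>\<^bsub>M\<^esub>)"
proof -
  note AE = submoduleE[OF A] and BE = submoduleE[OF B]
  have carr: "x \<in> carrier M" if "x \<in> A \<or> x \<in> B" for x
    using that AE(1) BE(1) by blast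
  have ex: "\<exists>a. a \<in> A \<and> x \<ominus>\<^bsub>M\<^esub> a \<in> B" if x: "x \<in> carrier M" for x
  proof -
    obtain a b where *: "a \<in> A" "b \<in> B" "x = a \<oplus>\<^bsub>M\<^esub> b"
      using x sum unfolding set_add_def' by blast
    then have "a \<in> carrier M" "b \<in> carrier M"
      using carr by auto
    then have "x \<ominus>\<^bsub>M\<^esub> a = b"
      unfolding *(3) by algebra
    with * show ?thesis
      by (intro exI[of _ a]) simp
  qed
  define e where "e = (\<lambda>x\<in>carrier M. SOME a. a \<in> A \<and> x \<ominus>\<^bsub>M\<^esub> a \<in> B)"
  have e: "e x \<in> A" "x \<ominus>\<^bsub>M\<^esub> e x \<in> B" if "x \<in> carrier M" for x
    using someI_ex[OF ex[OF that]] that by (auto simp: e_def)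
  have uniq: "e x = a" if x: "x \<in> carrier M" and "a \<in> A" "x \<ominus>\<^bsub>M\<^esub> a \<in> B" for x a
  proof -
    have c: "a \<in> carrier M" "e x \<in> carrier M"
      using that(2) e(1)[OF x] AE(1) by auto
    have "(x \<ominus>\<^bsub>M\<^esub> a) \<ominus>\<^bsub>M\<^esub> (x \<ominus>\<^bsub>M\<^esub> e x) = e x \<ominus>\<^bsub>M\<^esub> a"
      using x c by algebra
    moreover have "(x \<ominus>\<^bsub>M\<^esub> a) \<ominus>\<^bsub>M\<^esub> (x \<ominus>\<^bsub>M\<^esub> e x) \<in> B"
      using that(3) e(2)[OF x] by (rule submodule_diff[OF B])
    ultimately have "e x \<ominus>\<^bsub>M\<^esub> a \<in> A \<inter> B"
      using that(2) e(1)[OF x] submodule_diff[OF A] by simp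
    then show ?thesis
      using int c M.minus_eq_zeroD by simp
  qed
  have eM: "e x \<in> carrier M" if "x \<in> carrier M" for x
    using e(1)[OF that] AE(1) by blast
  have "e (x \<oplus>\<^bsub>M\<^esub> y) = e x \<oplus>\<^bsub>M\<^esub> e y" if "x \<in> carrier M" "y \<in> carrier M" for x y
  proof (rule uniq)
    have "(x \<oplus>\<^bsub>M\<^esub> y) \<ominus>\<^bsub>M\<^esub> (e x \<oplus>\<^bsub>M\<^esub> e y) = (x \<ominus>\<^bsub>M\<^esub> e x) \<oplus>\<^bsub>M\<^esub> (y \<ominus>\<^bsub>M\<^esub> e y)"
      using that eM[OF that(1)] eM[OF that(2)] by algebra
    then show "(x \<oplus>\<^bsub>M\<^esub> y) \<ominus>\<^bsub>M\<^esub> (e x \<oplus>\<^bsub>M\<^esub> e y) \<in> B"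
      using that e BE(5) by simp
  qed (use that e AE(5) in auto)
  moreover have "e (r \<odot>\<^bsub>M\<^esub> x) = r \<odot>\<^bsub>M\<^esub> e x" if "r \<in> carrier R" "x \<in> carrier M" for r x
  proof (rule uniq)
    have "(r \<odot>\<^bsub>M\<^esub> x) \<ominus>\<^bsub>M\<^esub> (r \<odot>\<^bsub>M\<^esub> e x) = r \<odot>\<^bsub>M\<^esub> (x \<ominus>\<^bsub>M\<^esub> e x)"
      using that eM by (simp add: smult_minus_right)
    then show "(r \<odot>\<^bsub>M\<^esub> x) \<ominus>\<^bsub>M\<^esub> (r \<odot>\<^bsub>M\<^esub> e x) \<in> B"
      using that e BE(4) by simp
  qed (use that e AE(4) in auto)
  moreover have "e \<in> carrier M \<rightarrow>\<^sub>E carrier M"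
    using eM by (auto simp: e_def)
  moreover have "e x = x" if "x \<in> A" for x
    using that AE(1) submodule_zero[OF B] by (intro uniq) (auto simp: M.minus_eq M.r_neg)
  moreover have "e x = \<zero>\<^bsub>M\<^esub>" if "x \<in> B" for x
    using that BE(1) submodule_zero[OF A] by (intro uniq) auto
  ultimately show ?thesis
    using e by (intro bexI[of _ e]) (simp_all add: module_homs_def)
qed

end

section \<open>Connected ideals are local\<close>

text \<open>Its elements have the type of ring elements, so \<open>h\<close> embeds the carrier in
  \<open>'m\<close>, and linear combinations in it are ordinary sums of products in
  \<open>R\<close>.\<close>

definition regular_module :: "('a, 'r) ring_scheme \<Rightarrow> ('a, 'a) module" where
  "regular_module R = \<lparr>carrier = carrier R, mult = undefined, one = undefined, zero = \<zero>\<^bsub>R\<^esub>,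
    add = add R, smult = mult R\<rparr>"

lemma (in cring) module_regular_module: "module R (regular_module R)"
proof (intro moduleI abelian_groupI)
  fix x assume "x \<in> carrier (regular_module R)"
  then show "\<exists>y\<in>carrier (regular_module R). y \<oplus>\<^bsub>regular_module R\<^esub> x = \<zero>\<^bsub>regular_module R\<^esub>"
    by (intro bexI[of _ "\<ominus> x"]) (auto simp: regular_module_def l_neg)
qed (auto simp: regular_module_def a_ac m_assoc l_distr r_distr is_cring)

locale local_indecomposables = cring R
  for R :: "('a, 'r) ring_scheme" (structure) +
  fixes h :: "'a \<Rightarrow> 'm"
  assumes infinite_universe: "infinite (UNIV :: 'm set)"
    and inj: "inj_on h (carrier R)"
    and local_End: "\<And>M :: ('a, 'm) module.
      module R M \<Longrightarrow> indecomposable_module R M \<Longrightarrow> local_ring (End_ring R M)"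
begin

text \<open>\<open>R / I\<close> is generated by the class of 1, so the components of this class in
  a direct decomposition are the classes of some \<open>e\<close> and \<open>1 - e\<close> with
  \<open>e (1 - e)\<close> in \<open>I\<close>. Hence \<open>R / I\<close> is indecomposable, and
  \<open>local_End_dichotomy\<close> can be applied to multiplication by an element.\<close>

lemma connected_imp_local:
  assumes I: "ideal I R" and conn: "connected_ideal R I"
  shows "local_ideal R I"
proof -
  let ?M = "regular_module R"
  interpret M: module R ?M by (rule module_regular_module)
  have sel: "carrier ?M = carrier R" "add ?M = add R" "smult ?M = mult R" "zero ?M = \<zero>"
    by (auto simp: regular_module_def)
  have "submodule I R ?M"
    using ideal_in_carrier[OF I]
    by (intro M.submoduleI') (auto simp: sel ideal_zero I ideal_add ideal_mult_left)
  from M.quotient_module_exists[OF this, of h] inj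
  obtain Q :: "('a, 'm) module" and \<pi> where Q: "module R Q" and img: "\<pi> ` carrier R = carrier Q"
    and padd: "\<And>x y. x \<in> carrier R \<Longrightarrow> y \<in> carrier R \<Longrightarrow> \<pi> (x \<oplus> y) = \<pi> x \<oplus>\<^bsub>Q\<^esub> \<pi> y"
    and psmult: "\<And>x y. x \<in> carrier R \<Longrightarrow> y \<in> carrier R \<Longrightarrow> \<pi> (x \<otimes> y) = x \<odot>\<^bsub>Q\<^esub> \<pi> y"
    and pzero: "\<And>x. x \<in> carrier R \<Longrightarrow> \<pi> x = \<zero>\<^bsub>Q\<^esub> \<longleftrightarrow> x \<in> I"
    unfolding sel by auto
  interpret Q: module R Q by (rule Q)
  have pi_closed: "\<pi> x \<in> carrier Q" if "x \<in> carrier R" for x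
    using that img by blast
  have pi_unit: "x \<odot>\<^bsub>Q\<^esub> \<pi> \<one> = \<pi> x" if "x \<in> carrier R" for x
    using psmult[of x \<one>] that by simp
  have pi_diff: "\<pi> (x \<ominus> y) = \<pi> x \<ominus>\<^bsub>Q\<^esub> \<pi> y" if "x \<in> carrier R" "y \<in> carrier R" for x y
    using Q.smult_minus_left[of x y "\<pi> \<one>"] that pi_unit pi_closed by simp
  have cong: "x \<ominus> y \<in> I" if "x \<in> carrier R" "y \<in> carrier R" "\<pi> x = \<pi> y" for x y
    using pzero[of "x \<ominus> y"] that pi_diff pi_closed by (simp add: Q.minus_eq Q.r_neg)
  have indec: "indecomposable_module R Q"
    unfolding indecomposable_module_def
  proof (intro conjI allI impI; (elim conjE)?)
    have "\<pi> \<one> \<noteq> \<zero>\<^bsub>Q\<^esub>"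
      using conn pzero[of \<one>] by (simp add: connected_ideal_def)
    then show "carrier Q \<noteq> {\<zero>\<^bsub>Q\<^esub>}"
      using pi_closed[of \<one>] by auto
    fix A B assume A: "submodule A R Q" and B: "submodule B R Q"
      and int: "A \<inter> B = {\<zero>\<^bsub>Q\<^esub>}" and sum: "A <+>\<^bsub>Q\<^esub> B = carrier Q"
    have trivial: "Y = {\<zero>\<^bsub>Q\<^esub>}" if "submodule X R Q" "submodule Y R Q" "X \<inter> Y = {\<zero>\<^bsub>Q\<^esub>}" "\<pi> \<one> \<in> X" for X Y
    proof -
      have "\<pi> x \<in> X" if "x \<in> carrier R" for x
        using pi_unit[OF that] Q.submoduleE(4)[OF \<open>submodule X R Q\<close> that \<open>\<pi> \<one> \<in> X\<close>] by simp
      then have "\<pi> ` carrier R \<subseteq> X"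
        by blast
      then have "carrier Q \<subseteq> X"
        by (simp add: img)
      then show ?thesis
        using that(3) Q.submoduleE(1)[OF that(2)] by blast
    qed
    have "\<pi> \<one> \<in> A <+>\<^bsub>Q\<^esub> B"
      using sum pi_closed by simp
    then obtain u v where uv: "u \<in> A" "v \<in> B" "\<pi> \<one> = u \<oplus>\<^bsub>Q\<^esub> v"
      unfolding set_add_def' by auto
    then have uvQ: "u \<in> carrier Q" "v \<in> carrier Q"
      using Q.submoduleE(1)[OF A] Q.submoduleE(1)[OF B] by auto
    then obtain e where e: "e \<in> carrier R" "u = \<pi> e"
      using img by auto
    have v: "v = \<pi> (\<one> \<ominus> e)"
    proof -
      have "v = (u \<oplus>\<^bsub>Q\<^esub> v) \<ominus>\<^bsub>Q\<^esub> u"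
        using uvQ by algebra
      then show ?thesis
        using e uv(3) pi_diff by simp
    qed
    \<comment> \<open>Both products are the class of \<open>e (1 - e)\<close>; the first lies in
      \<open>B\<close> and the second in \<open>A\<close>, so this class is zero.\<close>
    have "e \<odot>\<^bsub>Q\<^esub> v = \<pi> (e \<otimes> (\<one> \<ominus> e))" "(\<one> \<ominus> e) \<odot>\<^bsub>Q\<^esub> u = \<pi> (e \<otimes> (\<one> \<ominus> e))"
      using e v psmult[of e "\<one> \<ominus> e"] psmult[of "\<one> \<ominus> e" e] by (simp_all add: m_comm)
    moreover have "e \<odot>\<^bsub>Q\<^esub> v \<in> B" "(\<one> \<ominus> e) \<odot>\<^bsub>Q\<^esub> u \<in> A"
      using uv e(1) Q.submoduleE(4)[OF A] Q.submoduleE(4)[OF B] by auto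
    ultimately have "\<pi> (e \<otimes> (\<one> \<ominus> e)) = \<zero>\<^bsub>Q\<^esub>"
      using int by auto
    then have "e \<otimes> (\<one> \<ominus> e) \<in> I"
      using pzero e by simp
    then have "e \<in> I \<or> \<one> \<ominus> e \<in> I"
      using conn e by (simp add: connected_ideal_def)
    then have "u = \<zero>\<^bsub>Q\<^esub> \<or> v = \<zero>\<^bsub>Q\<^esub>"
      using pzero[of e] pzero[of "\<one> \<ominus> e"] e v by auto
    then have "\<pi> \<one> \<in> A \<or> \<pi> \<one> \<in> B"
      using uv uvQ by auto
    then show "A = {\<zero>\<^bsub>Q\<^esub>} \<or> B = {\<zero>\<^bsub>Q\<^esub>}"
      using trivial[OF A B int] trivial[OF B A] int by (auto simp: Int_commute)
  qed
  show ?thesis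
    unfolding local_ideal_def
  proof (intro conjI ballI)
    show "\<one> \<notin> I"
      using conn by (simp add: connected_ideal_def)
    fix a assume a: "a \<in> carrier R"
    \<comment> \<open>A preimage of the class of 1 under multiplication by \<open>a\<close>, or by
      \<open>1 - a\<close>, is the class of the required inverse.\<close>
    let ?f = "\<lambda>x\<in>carrier Q. a \<odot>\<^bsub>Q\<^esub> x"
    have "?f \<in> module_homs R Q Q"
      using a by (auto simp: module_homs_def Q.smult_r_distr m_comm simp flip: Q.smult_assoc1)
    from Q.local_End_dichotomy[OF local_End[OF Q indec] this]
    show "(\<exists>b\<in>carrier R. a \<otimes> b \<ominus> \<one> \<in> I) \<or> (\<exists>b\<in>carrier R. (\<one> \<ominus> a) \<otimes> b \<ominus> \<one> \<in> I)"
    proof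
      assume "?f ` carrier Q = carrier Q"
      then have "\<pi> \<one> \<in> ?f ` \<pi> ` carrier R"
        using pi_closed img by simp
      then obtain b where b: "b \<in> carrier R" "\<pi> \<one> = a \<odot>\<^bsub>Q\<^esub> \<pi> b"
        using pi_closed by auto
      then have "a \<otimes> b \<ominus> \<one> \<in> I"
        using a psmult[of a b] by (intro cong) auto
      then show ?thesis
        using b by blast
    next
      assume "\<forall>y\<in>carrier Q. \<exists>x\<in>carrier Q. y = x \<ominus>\<^bsub>Q\<^esub> ?f x"
      then have "\<exists>x\<in>\<pi> ` carrier R. \<pi> \<one> = x \<ominus>\<^bsub>Q\<^esub> ?f x"
        using pi_closed[of \<one>] img by simp
      then obtain b where b: "b \<in> carrier R" "\<pi> \<one> = \<pi> b \<ominus>\<^bsub>Q\<^esub> a \<odot>\<^bsub>Q\<^esub> \<pi> b"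
        using pi_closed by auto
      have "\<pi> ((\<one> \<ominus> a) \<otimes> b) = \<pi> \<one>"
        using a b psmult[of "\<one> \<ominus> a" b] pi_closed[of b] by (simp add: Q.smult_minus_left)
      then have "(\<one> \<ominus> a) \<otimes> b \<ominus> \<one> \<in> I"
        using a b by (intro cong) auto
      then show ?thesis
        using b by blast
    qed
  qed
qed

end

section \<open>Local ideals are chain ideals\<close>

text \<open>\<open>invertible\<close> makes \<open>m\<close> the maximal ideal of the local ring
  \<open>R / I\<close>; \<open>annihilates\<close> turns the span of \<open>a\<close> and
  \<open>b\<close> modulo \<open>I\<close> into a vector space over \<open>R / m\<close>, and
  \<open>independent\<close> gives it dimension two.\<close>

locale incomparable_pair = UP_cring R P
  for R :: "('a, 'r) ring_scheme" (structure) and P (structure) +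
  fixes I m :: "'a set" and a b :: 'a
  assumes ideal_I: "ideal I R" and ideal_m: "ideal m R" and I_subset: "I \<subseteq> m"
    and a: "a \<in> m" and b: "b \<in> m" and one_notin: "\<one> \<notin> m"
    and invertible: "x \<in> carrier R \<Longrightarrow> x \<notin> m \<Longrightarrow> \<exists>y\<in>carrier R. x \<otimes> y \<ominus> \<one> \<in> I"
    and annihilates: "x \<in> m \<Longrightarrow> x \<otimes> a \<in> I" "x \<in> m \<Longrightarrow> x \<otimes> b \<in> I"
    and independent: "r \<in> carrier R \<Longrightarrow> s \<in> carrier R \<Longrightarrow> r \<otimes> a \<oplus> s \<otimes> b \<in> I \<Longrightarrow> r \<in> m \<and> s \<in> m"
begin

section \<open>Polynomials over a pair of incomparable elements\<close>

lemma ab_closed [simp]: "a \<in> carrier R" "b \<in> carrier R"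
  using a b R.ideal_in_carrier[OF ideal_m] by auto

lemma annihilates_left:
  assumes "x \<in> m"
  shows "a \<otimes> x \<in> I" "b \<otimes> x \<in> I"
  using annihilates[OF assms] R.ideal_in_carrier[OF ideal_m assms] by (simp_all add: R.m_comm)

lemma m_prime:
  assumes "x \<in> carrier R" "y \<in> carrier R" "x \<otimes> y \<in> m" "x \<notin> m"
  shows "y \<in> m"
proof -
  obtain x' where x': "x' \<in> carrier R" "x \<otimes> x' \<ominus> \<one> \<in> m"
    using invertible assms I_subset by blast
  have "y = x' \<otimes> (x \<otimes> y) \<ominus> y \<otimes> (x \<otimes> x' \<ominus> \<one>)"
    using assms x' by algebra
  then show ?thesis
    using assms x' R.ideal_diff R.ideal_mult_left ideal_m by metis
qed

text \<open>Having its own name, multiplication by \<open>t\<close> obeys the two-case formula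
  \<open>coeff_times_X\<close> instead of the convolution formula for products.\<close>

definition times_X :: "(nat \<Rightarrow> 'a) \<Rightarrow> nat \<Rightarrow> 'a" where
  "times_X p = monom P \<one> 1 \<otimes>\<^bsub>P\<^esub> p"

lemma times_X_closed [simp]: "p \<in> carrier P \<Longrightarrow> times_X p \<in> carrier P"
  by (simp add: times_X_def)

lemma coeff_times_X:
  assumes "p \<in> carrier P"
  shows "coeff P (times_X p) i = (case i of 0 \<Rightarrow> \<zero> | Suc j \<Rightarrow> coeff P p j)"
proof (cases i)
  case 0
  then show ?thesis
    using assms by (simp add: times_X_def)
next
  case (Suc j)
  then show ?thesis
    using coeff_monom_mult[OF R.one_closed assms, of 1 j] assms by (simp add: times_X_def del: coeff_mult)
qed

lemma times_X_add:
  "p \<in> carrier P \<Longrightarrow> q \<in> carrier P \<Longrightarrow> times_X (p \<oplus>\<^bsub>P\<^esub> q) = times_X p \<oplus>\<^bsub>P\<^esub> times_X q"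
  by (simp add: times_X_def P.r_distr)

lemma times_X_zero [simp]: "times_X \<zero>\<^bsub>P\<^esub> = \<zero>\<^bsub>P\<^esub>"
  by (simp add: times_X_def)

lemma times_X_uminus: "p \<in> carrier P \<Longrightarrow> times_X (\<ominus>\<^bsub>P\<^esub> p) = \<ominus>\<^bsub>P\<^esub> times_X p"
  by (simp add: times_X_def P.r_minus)

lemma times_X_smult:
  "r \<in> carrier R \<Longrightarrow> p \<in> carrier P \<Longrightarrow> times_X (r \<odot>\<^bsub>P\<^esub> p) = r \<odot>\<^bsub>P\<^esub> times_X p"
  by (rule up_eqI) (simp_all add: coeff_times_X split: nat.split)

lemma times_X_monom: "r \<in> carrier R \<Longrightarrow> times_X (monom P r i) = monom P r (Suc i)"
  by (rule up_eqI) (simp_all add: coeff_times_X split: nat.split)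

lemma times_X_mult:
  "p \<in> carrier P \<Longrightarrow> q \<in> carrier P \<Longrightarrow> times_X (p \<otimes>\<^bsub>P\<^esub> q) = times_X p \<otimes>\<^bsub>P\<^esub> q"
  by (simp add: times_X_def P.m_assoc)

text \<open>Gauss's lemma: take the lowest coefficients of \<open>p\<close> and \<open>q\<close>
  outside \<open>m\<close>, at \<open>i\<close> and \<open>j\<close>. In the coefficient of the
  product at \<open>i + j\<close>, every other term has a factor of index below \<open>i\<close> or
  below \<open>j\<close>, so the product of these two coefficients would lie in
  \<open>m\<close>.\<close>

lemma coeff_prime:
  assumes p: "p \<in> carrier P" and q: "q \<in> carrier P" and pq: "\<And>i. coeff P (p \<otimes>\<^bsub>P\<^esub> q) i \<in> m"
  shows "(\<forall>i. coeff P p i \<in> m) \<or> (\<forall>i. coeff P q i \<in> m)"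
proof (rule ccontr)
  assume neg: "\<not> ?thesis"
  define i where "i = (LEAST i. coeff P p i \<notin> m)"
  define j where "j = (LEAST j. coeff P q j \<notin> m)"
  have i: "coeff P p i \<notin> m" and j: "coeff P q j \<notin> m"
    unfolding i_def j_def using neg LeastI_ex[of "\<lambda>k. coeff P p k \<notin> m"]
      LeastI_ex[of "\<lambda>k. coeff P q k \<notin> m"] by simp_all
  have lt: "coeff P p k \<in> m" if "k < i" for k
    using not_less_Least[OF that[unfolded i_def]] by simp
  have lt': "coeff P q k \<in> m" if "k < j" for k
    using not_less_Least[OF that[unfolded j_def]] by simp
  let ?f = "\<lambda>k. coeff P p k \<otimes> coeff P q (i + j - k)"
  have f: "?f \<in> A \<rightarrow> carrier R" for A
    using p q by simp
  have "{..i + j} = insert i ({..i + j} - {i})" by auto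
  then have "coeff P (p \<otimes>\<^bsub>P\<^esub> q) (i + j) = finsum R ?f (insert i ({..i + j} - {i}))"
    using p q by simp
  also have "\<dots> = ?f i \<oplus> finsum R ?f ({..i + j} - {i})"
    using f p q by (intro R.finsum_insert) auto
  finally have eq: "coeff P (p \<otimes>\<^bsub>P\<^esub> q) (i + j) = ?f i \<oplus> finsum R ?f ({..i + j} - {i})" .
  have rest: "finsum R ?f ({..i + j} - {i}) \<in> m"
  proof (intro R.ideal_finsum[OF ideal_m])
    fix k assume "k \<in> {..i + j} - {i}"
    then have "k < i \<or> i + j - k < j" by auto
    then show "?f k \<in> m"
      using lt lt' p q R.ideal_mult_left[OF ideal_m] R.ideal_mult_right[OF ideal_m] by auto
  qed simp
  have "?f i = coeff P (p \<otimes>\<^bsub>P\<^esub> q) (i + j) \<ominus> finsum R ?f ({..i + j} - {i})"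
    unfolding eq using p q f R.ideal_in_carrier[OF ideal_m rest] by (simp add: R.minus_eq R.a_assoc R.r_neg)
  then have "?f i \<in> m"
    using R.ideal_diff[OF ideal_m pq rest] by simp
  then show False
    using m_prime[of "coeff P p i" "coeff P q j"] i j p q by simp
qed

text \<open>The relations of the \<open>R\<close>-module \<open>R[t] / (b - a t, I)\<close>, a Kronecker module over the residue field
  in case \<open>m\<close> is generated by \<open>a\<close> and \<open>b\<close>.\<close>

definition relations :: "(nat \<Rightarrow> 'a) set" where
  "relations = {p \<in> carrier P. \<exists>g\<in>carrier P. \<forall>i.
    coeff P p i \<ominus> (b \<otimes> coeff P g i \<ominus> a \<otimes> coeff P (times_X g) i) \<in> I}"

lemma submodule_relations: "submodule relations R P"
proof (rule submoduleI')
  show "relations \<subseteq> carrier P"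
    by (auto simp: relations_def)
  have "\<zero> \<ominus> (b \<otimes> \<zero> \<ominus> a \<otimes> \<zero>) = \<zero>"
    using ab_closed by algebra
  then show "\<zero>\<^bsub>P\<^esub> \<in> relations"
    unfolding relations_def using R.ideal_zero[OF ideal_I]
    by (auto intro!: bexI[of _ "\<zero>\<^bsub>P\<^esub>"])
  fix p q assume "p \<in> relations" "q \<in> relations"
  then obtain g g' where *: "p \<in> carrier P" "q \<in> carrier P" "g \<in> carrier P" "g' \<in> carrier P"
    "\<And>i. coeff P p i \<ominus> (b \<otimes> coeff P g i \<ominus> a \<otimes> coeff P (times_X g) i) \<in> I"
    "\<And>i. coeff P q i \<ominus> (b \<otimes> coeff P g' i \<ominus> a \<otimes> coeff P (times_X g') i) \<in> I"
    unfolding relations_def by blast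
  have "coeff P (p \<oplus>\<^bsub>P\<^esub> q) i
      \<ominus> (b \<otimes> coeff P (g \<oplus>\<^bsub>P\<^esub> g') i \<ominus> a \<otimes> coeff P (times_X (g \<oplus>\<^bsub>P\<^esub> g')) i) \<in> I" for i
  proof -
    define u v w u' v' w' where d: "u = coeff P p i" "v = coeff P g i" "w = coeff P (times_X g) i"
      "u' = coeff P q i" "v' = coeff P g' i" "w' = coeff P (times_X g') i"
    have c: "u \<in> carrier R" "v \<in> carrier R" "w \<in> carrier R" "u' \<in> carrier R" "v' \<in> carrier R" "w' \<in> carrier R"
      unfolding d using * by simp_all
    have "coeff P (p \<oplus>\<^bsub>P\<^esub> q) i = u \<oplus> u'" "coeff P (g \<oplus>\<^bsub>P\<^esub> g') i = v \<oplus> v'"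
      "coeff P (times_X (g \<oplus>\<^bsub>P\<^esub> g')) i = w \<oplus> w'"
      using * by (simp_all add: d times_X_add)
    moreover have "(u \<oplus> u') \<ominus> (b \<otimes> (v \<oplus> v') \<ominus> a \<otimes> (w \<oplus> w'))
        = (u \<ominus> (b \<otimes> v \<ominus> a \<otimes> w)) \<oplus> (u' \<ominus> (b \<otimes> v' \<ominus> a \<otimes> w'))"
      using c ab_closed by algebra
    ultimately show ?thesis
      using R.ideal_add[OF ideal_I *(5)[of i] *(6)[of i]] by (simp add: d)
  qed
  then show "p \<oplus>\<^bsub>P\<^esub> q \<in> relations"
    unfolding relations_def using * by (auto intro!: bexI[of _ "g \<oplus>\<^bsub>P\<^esub> g'"])
next
  fix r p assume r: "r \<in> carrier R" and "p \<in> relations"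
  then obtain g where *: "p \<in> carrier P" "g \<in> carrier P"
    "\<And>i. coeff P p i \<ominus> (b \<otimes> coeff P g i \<ominus> a \<otimes> coeff P (times_X g) i) \<in> I"
    unfolding relations_def by blast
  have "coeff P (r \<odot>\<^bsub>P\<^esub> p) i
      \<ominus> (b \<otimes> coeff P (r \<odot>\<^bsub>P\<^esub> g) i \<ominus> a \<otimes> coeff P (times_X (r \<odot>\<^bsub>P\<^esub> g)) i) \<in> I" for i
  proof -
    define u v w where d: "u = coeff P p i" "v = coeff P g i" "w = coeff P (times_X g) i"
    have c: "u \<in> carrier R" "v \<in> carrier R" "w \<in> carrier R"
      unfolding d using * by simp_all
    have "coeff P (r \<odot>\<^bsub>P\<^esub> p) i = r \<otimes> u" "coeff P (r \<odot>\<^bsub>P\<^esub> g) i = r \<otimes> v"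
      using * r by (simp_all add: d)
    moreover have "coeff P (times_X (r \<odot>\<^bsub>P\<^esub> g)) i = r \<otimes> w"
      using * r by (simp add: d coeff_times_X split: nat.split)
    moreover have "r \<otimes> u \<ominus> (b \<otimes> (r \<otimes> v) \<ominus> a \<otimes> (r \<otimes> w)) = r \<otimes> (u \<ominus> (b \<otimes> v \<ominus> a \<otimes> w))"
      using c r ab_closed by algebra
    ultimately show ?thesis
      using R.ideal_mult_left[OF ideal_I *(3)[of i] r] by (simp add: d)
  qed
  then show "r \<odot>\<^bsub>P\<^esub> p \<in> relations"
    unfolding relations_def using * r by (auto intro!: bexI[of _ "r \<odot>\<^bsub>P\<^esub> g"])
qed

text \<open>This ideal works on both sides: all coefficients of relations lie in it, and in
  \<open>Q\<close> it kills everything that \<open>a\<close> kills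
  (\<open>smult_ab_ideal\<close>).\<close>

definition ab_ideal :: "'a set" where
  "ab_ideal = add_multiples R (add_multiples R I (carrier R) a) (carrier R) b"

lemma ideal_ab_ideal: "ideal ab_ideal R"
  unfolding ab_ideal_def by (intro R.ideal_add_multiples ideal_I R.oneideal ab_closed)

lemma ab_ideal_cases:
  assumes "r \<in> ab_ideal"
  obtains s x y where "s \<in> I" "x \<in> carrier R" "y \<in> carrier R" "r = s \<oplus> x \<otimes> a \<oplus> y \<otimes> b"
  using assms unfolding ab_ideal_def add_multiples_def by blast

lemma ab_idealI:
  assumes "s \<in> I" "x \<in> carrier R" "y \<in> carrier R"
  shows "s \<oplus> x \<otimes> a \<oplus> y \<otimes> b \<in> ab_ideal"
  using assms unfolding ab_ideal_def by (intro R.add_multiplesI)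

lemma I_subset_ab_ideal: "I \<subseteq> ab_ideal"
  unfolding ab_ideal_def using R.subset_add_multiples R.oneideal ideal_I R.ideal_add_multiples ab_closed
  by (meson subset_trans)

lemma ab_ideal_subset: "ab_ideal \<subseteq> m"
proof
  fix r assume "r \<in> ab_ideal"
  then show "r \<in> m"
    using I_subset a b
    by (elim ab_ideal_cases) (auto intro!: R.ideal_add[OF ideal_m] R.ideal_mult_left[OF ideal_m])
qed

lemma coeff_relation:
  assumes "p \<in> relations"
  shows "coeff P p i \<in> ab_ideal"
proof -
  obtain g where *: "p \<in> carrier P" "g \<in> carrier P"
    "coeff P p i \<ominus> (b \<otimes> coeff P g i \<ominus> a \<otimes> coeff P (times_X g) i) \<in> I"
    using assms unfolding relations_def by blast
  define u v w where d: "u = coeff P p i" "v = coeff P g i" "w = coeff P (times_X g) i"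
  have c: "u \<in> carrier R" "v \<in> carrier R" "w \<in> carrier R"
    unfolding d using * by simp_all
  have "u = (u \<ominus> (b \<otimes> v \<ominus> a \<otimes> w)) \<oplus> (\<ominus> w) \<otimes> a \<oplus> v \<otimes> b"
    using c ab_closed by algebra
  also have "\<dots> \<in> ab_ideal"
    using * c by (intro ab_idealI) (simp_all add: d)
  finally show ?thesis
    by (simp add: d)
qed

lemma relation_of_coeff_in_I:
  assumes "p \<in> carrier P" "\<And>i. coeff P p i \<in> I"
  shows "p \<in> relations"
proof -
  have "u \<ominus> (b \<otimes> \<zero> \<ominus> a \<otimes> \<zero>) = u" if "u \<in> carrier R" for u
    using that ab_closed by algebra
  then show ?thesis
    unfolding relations_def using assms by (auto intro!: bexI[of _ "\<zero>\<^bsub>P\<^esub>"])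
qed

text \<open>If \<open>a p\<close> is congruent to \<open>(b - a t) g\<close>, then each coefficient
  of \<open>(p + t g) a - g b\<close> lies in \<open>I\<close>. Independence puts the coefficients
  of \<open>p + t g\<close> and of \<open>g\<close> into \<open>m\<close>, hence also those of
  \<open>p\<close>. So the annihilator of \<open>a\<close> in \<open>Q\<close> is
  \<open>m Q\<close>.\<close>

lemma smult_a_relation_iff:
  assumes p: "p \<in> carrier P"
  shows "a \<odot>\<^bsub>P\<^esub> p \<in> relations \<longleftrightarrow> (\<forall>i. coeff P p i \<in> m)"
proof
  assume "\<forall>i. coeff P p i \<in> m"
  then show "a \<odot>\<^bsub>P\<^esub> p \<in> relations"
    using p annihilates_left(1) by (intro relation_of_coeff_in_I) simp_all
next
  assume "a \<odot>\<^bsub>P\<^esub> p \<in> relations"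
  then obtain g where g: "g \<in> carrier P"
    and "\<And>i. coeff P (a \<odot>\<^bsub>P\<^esub> p) i \<ominus> (b \<otimes> coeff P g i \<ominus> a \<otimes> coeff P (times_X g) i) \<in> I"
    unfolding relations_def by blast
  then have *: "a \<otimes> coeff P p i \<ominus> (b \<otimes> coeff P g i \<ominus> a \<otimes> coeff P (times_X g) i) \<in> I" for i
    using p by simp
  have ind: "coeff P p i \<oplus> coeff P (times_X g) i \<in> m \<and> \<ominus> coeff P g i \<in> m" for i
  proof (rule independent)
    define u v w where d: "u = coeff P p i" "v = coeff P g i" "w = coeff P (times_X g) i"
    have c: "u \<in> carrier R" "v \<in> carrier R" "w \<in> carrier R"
      unfolding d using p g by simp_all
    have "a \<otimes> u \<ominus> (b \<otimes> v \<ominus> a \<otimes> w) = (u \<oplus> w) \<otimes> a \<oplus> (\<ominus> v) \<otimes> b"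
      using c ab_closed by algebra
    then show "(coeff P p i \<oplus> coeff P (times_X g) i) \<otimes> a \<oplus> (\<ominus> coeff P g i) \<otimes> b \<in> I"
      using *[of i] by (simp add: d)
  qed (use p g in simp_all)
  show "\<forall>i. coeff P p i \<in> m"
  proof
    fix i
    have gm: "coeff P g j \<in> m" for j
      using ind[of j] R.ideal_uminus[OF ideal_m, of "\<ominus> coeff P g j"] g by simp
    have "coeff P (times_X g) i \<in> m"
      using g gm R.ideal_zero[OF ideal_m] by (simp add: coeff_times_X split: nat.split)
    moreover have "coeff P p i = (coeff P p i \<oplus> coeff P (times_X g) i) \<ominus> coeff P (times_X g) i"
      using p g by (simp add: R.minus_eq R.a_assoc R.r_neg)
    ultimately show "coeff P p i \<in> m"
      using ind[of i] R.ideal_diff[OF ideal_m] by metis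
  qed
qed

lemma times_X_relation:
  assumes "p \<in> relations"
  shows "times_X p \<in> relations"
proof -
  obtain g where *: "p \<in> carrier P" "g \<in> carrier P"
    "\<And>i. coeff P p i \<ominus> (b \<otimes> coeff P g i \<ominus> a \<otimes> coeff P (times_X g) i) \<in> I"
    using assms unfolding relations_def by blast
  let ?g = "times_X g"
  have z: "\<zero> \<ominus> (b \<otimes> \<zero> \<ominus> a \<otimes> \<zero>) = \<zero>"
    using ab_closed by algebra
  have "coeff P (times_X p) i
      \<ominus> (b \<otimes> coeff P ?g i \<ominus> a \<otimes> coeff P (times_X ?g) i) \<in> I" for i
  proof (cases i)
    case 0
    then show ?thesis
      using * z R.ideal_zero[OF ideal_I] by (simp add: coeff_times_X)
  next
    case (Suc j)
    then show ?thesis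
      using *(1,2) *(3)[of j] coeff_times_X[of p i] coeff_times_X[of g i] coeff_times_X[of ?g i]
      by simp
  qed
  then show ?thesis
    unfolding relations_def using * by (auto intro!: bexI[of _ ?g])
qed

text \<open>The identity \<open>a t = b\<close> in \<open>Q\<close>. The witness is
  \<open>-p\<close> because relations are multiples of \<open>b - a t\<close>.\<close>

lemma pencil_relation:
  assumes p: "p \<in> carrier P"
  shows "a \<odot>\<^bsub>P\<^esub> (times_X p) \<ominus>\<^bsub>P\<^esub> b \<odot>\<^bsub>P\<^esub> p \<in> relations"
proof -
  let ?g = "\<ominus>\<^bsub>P\<^esub> p"
  have "coeff P (a \<odot>\<^bsub>P\<^esub> (times_X p) \<ominus>\<^bsub>P\<^esub> b \<odot>\<^bsub>P\<^esub> p) i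
      \<ominus> (b \<otimes> coeff P ?g i \<ominus> a \<otimes> coeff P (times_X ?g) i) = \<zero>" for i
  proof -
    define v w where d: "v = coeff P p i" "w = coeff P (times_X p) i"
    have c: "v \<in> carrier R" "w \<in> carrier R"
      unfolding d using p by simp_all
    have "coeff P (a \<odot>\<^bsub>P\<^esub> (times_X p) \<ominus>\<^bsub>P\<^esub> b \<odot>\<^bsub>P\<^esub> p) i = a \<otimes> w \<ominus> b \<otimes> v"
      using p by (simp add: d P.minus_eq R.minus_eq)
    moreover have "coeff P ?g i = \<ominus> v"
      using p by (simp add: d)
    moreover have "coeff P (times_X ?g) i = \<ominus> w"
      using p by (simp add: d times_X_uminus)
    moreover have "(a \<otimes> w \<ominus> b \<otimes> v) \<ominus> (b \<otimes> (\<ominus> v) \<ominus> a \<otimes> (\<ominus> w)) = \<zero>"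
      using c ab_closed by algebra
    ultimately show ?thesis by simp
  qed
  then show ?thesis
    unfolding relations_def using p R.ideal_zero[OF ideal_I]
    by (auto intro!: bexI[of _ ?g])
qed

text \<open>Only the terms of \<open>p\<close> itself have to be checked, so the proof for a
  monomial may use special knowledge of the coefficients of \<open>p\<close>.\<close>

lemma poly_induct:
  assumes p: "p \<in> carrier P" and monom: "\<And>i. S (monom P (coeff P p i) i)"
    and add: "\<And>q r. q \<in> carrier P \<Longrightarrow> r \<in> carrier P \<Longrightarrow> S q \<Longrightarrow> S r \<Longrightarrow> S (q \<oplus>\<^bsub>P\<^esub> r)"
  shows "S p"
proof -
  let ?s = "\<lambda>i. monom P (coeff P p i) i"
  have s: "?s \<in> A \<rightarrow> carrier P" for A
    using p by simp
  have "S (finsum P ?s {..n})" for n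
  proof (induction n)
    case 0
    show ?case
      using monom[of 0] P.finsum_0[OF s] by simp
  next
    case (Suc n)
    have "finsum P ?s {..Suc n} = ?s (Suc n) \<oplus>\<^bsub>P\<^esub> finsum P ?s {..n}"
      by (rule P.finsum_Suc[OF s])
    then show ?case
      using add[OF _ _ monom Suc] p P.finsum_closed[OF s] by simp
  qed
  then show ?thesis
    using up_repr[OF p] by metis
qed

end

text \<open>\<open>Q\<close> is known only through a surjection from \<open>R[t]\<close> with kernel
  \<open>relations\<close>, because the copy of the quotient in \<open>'m\<close> comes from a bare
  existence statement.\<close>

locale pencil_module = incomparable_pair R P I m a b + Q: module R Q
  for R :: "('a, 'r) ring_scheme" (structure) and P (structure) and I m a b
    and Q :: "('a, 'm, 'k) module_scheme" +
  fixes \<pi> :: "(nat \<Rightarrow> 'a) \<Rightarrow> 'm"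
  assumes pi_image: "\<pi> ` carrier P = carrier Q"
    and pi_add: "p \<in> carrier P \<Longrightarrow> q \<in> carrier P \<Longrightarrow> \<pi> (p \<oplus>\<^bsub>P\<^esub> q) = \<pi> p \<oplus>\<^bsub>Q\<^esub> \<pi> q"
    and pi_smult: "r \<in> carrier R \<Longrightarrow> p \<in> carrier P \<Longrightarrow> \<pi> (r \<odot>\<^bsub>P\<^esub> p) = r \<odot>\<^bsub>Q\<^esub> \<pi> p"
    and pi_zero_iff: "p \<in> carrier P \<Longrightarrow> \<pi> p = \<zero>\<^bsub>Q\<^esub> \<longleftrightarrow> p \<in> relations"
begin

section \<open>Multiplication by \<open>t\<close> and the endomorphisms of \<open>Q\<close>\<close>

lemma pi_closed [simp]: "p \<in> carrier P \<Longrightarrow> \<pi> p \<in> carrier Q"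
  using pi_image by blast

lemma pi_cases:
  assumes "x \<in> carrier Q"
  obtains p where "p \<in> carrier P" "x = \<pi> p"
  using assms pi_image by blast

lemma pi_diff:
  assumes "p \<in> carrier P" "q \<in> carrier P"
  shows "\<pi> (p \<ominus>\<^bsub>P\<^esub> q) = \<pi> p \<ominus>\<^bsub>Q\<^esub> \<pi> q"
proof -
  have "\<ominus>\<^bsub>P\<^esub> q = (\<ominus> \<one>) \<odot>\<^bsub>P\<^esub> q" "\<ominus>\<^bsub>Q\<^esub> \<pi> q = (\<ominus> \<one>) \<odot>\<^bsub>Q\<^esub> \<pi> q"
    using assms by (simp_all add: smult_l_minus Q.smult_l_minus)
  then show ?thesis
    using assms by (simp add: P.minus_eq Q.minus_eq pi_add pi_smult)
qed

lemma pi_eq_iff: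
  assumes "p \<in> carrier P" "q \<in> carrier P"
  shows "\<pi> p = \<pi> q \<longleftrightarrow> p \<ominus>\<^bsub>P\<^esub> q \<in> relations"
  using pi_zero_iff[of "p \<ominus>\<^bsub>P\<^esub> q"] assms pi_diff[OF assms] Q.minus_eq_zeroD[of "\<pi> p" "\<pi> q"]
  by (auto simp: Q.minus_eq Q.r_neg)

lemma smult_I:
  assumes "s \<in> I" "x \<in> carrier Q"
  shows "s \<odot>\<^bsub>Q\<^esub> x = \<zero>\<^bsub>Q\<^esub>"
proof -
  obtain p where p: "p \<in> carrier P" "x = \<pi> p"
    using assms(2) by (rule pi_cases)
  have s: "s \<in> carrier R"
    using R.ideal_in_carrier[OF ideal_I assms(1)] .
  then have "s \<odot>\<^bsub>P\<^esub> p \<in> relations"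
    using p R.ideal_mult_right[OF ideal_I assms(1)] by (intro relation_of_coeff_in_I) simp_all
  then show ?thesis
    using pi_zero_iff[of "s \<odot>\<^bsub>P\<^esub> p"] s p by (simp add: pi_smult)
qed

lemma smult_a_pi_iff:
  "p \<in> carrier P \<Longrightarrow> a \<odot>\<^bsub>Q\<^esub> \<pi> p = \<zero>\<^bsub>Q\<^esub> \<longleftrightarrow> (\<forall>i. coeff P p i \<in> m)"
  using smult_a_relation_iff[of p] pi_zero_iff[of "a \<odot>\<^bsub>P\<^esub> p"] pi_smult[of a p] by simp

definition shift :: "'m \<Rightarrow> 'm" where
  "shift = (\<lambda>x\<in>carrier Q. \<pi> (times_X (inv_into (carrier P) \<pi> x)))"

text \<open>\<open>shift\<close> is defined through an arbitrary preimage; the choice does not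
  matter because \<open>relations\<close> is closed under multiplication by
  \<open>t\<close>.\<close>

lemma shift_pi:
  assumes p: "p \<in> carrier P"
  shows "shift (\<pi> p) = \<pi> (times_X p)"
proof -
  define q where "q = inv_into (carrier P) \<pi> (\<pi> p)"
  have q: "q \<in> carrier P" "\<pi> q = \<pi> p"
    unfolding q_def using p inv_into_into[of "\<pi> p" \<pi> "carrier P"] f_inv_into_f[of "\<pi> p" \<pi> "carrier P"]
    by simp_all
  then have "times_X (q \<ominus>\<^bsub>P\<^esub> p) \<in> relations"
    using p pi_eq_iff times_X_relation by simp
  then have "\<pi> (times_X q) = \<pi> (times_X p)"
    using p q pi_eq_iff[of "times_X q" "times_X p"]
    by (simp add: P.minus_eq times_X_add times_X_uminus)
  then show ?thesis
    using p by (simp add: shift_def q_def)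
qed

lemma shift_hom: "shift \<in> module_homs R Q Q"
proof -
  have "shift x \<in> carrier Q" if "x \<in> carrier Q" for x
    using that by (elim pi_cases) (simp add: shift_pi)
  moreover have "shift (x \<oplus>\<^bsub>Q\<^esub> y) = shift x \<oplus>\<^bsub>Q\<^esub> shift y" if "x \<in> carrier Q" "y \<in> carrier Q" for x y
    using that by (elim pi_cases) (simp add: shift_pi times_X_add flip: pi_add)
  moreover have "shift (r \<odot>\<^bsub>Q\<^esub> x) = r \<odot>\<^bsub>Q\<^esub> shift x" if "r \<in> carrier R" "x \<in> carrier Q" for r x
    using that by (elim pi_cases) (simp add: shift_pi times_X_smult flip: pi_smult)
  ultimately show ?thesis
    by (auto simp: module_homs_def shift_def)
qed

lemma smult_a_shift:
  assumes "x \<in> carrier Q"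
  shows "a \<odot>\<^bsub>Q\<^esub> shift x = b \<odot>\<^bsub>Q\<^esub> x"
proof -
  obtain p where p: "p \<in> carrier P" "x = \<pi> p"
    using assms by (rule pi_cases)
  then show ?thesis
    using pencil_relation[of p] pi_eq_iff[of "a \<odot>\<^bsub>P\<^esub> times_X p" "b \<odot>\<^bsub>P\<^esub> p"] by (simp add: shift_pi pi_smult)
qed

lemma hom_closed: "e \<in> module_homs R Q Q \<Longrightarrow> x \<in> carrier Q \<Longrightarrow> e x \<in> carrier Q"
  and hom_add: "e \<in> module_homs R Q Q \<Longrightarrow> x \<in> carrier Q \<Longrightarrow> y \<in> carrier Q \<Longrightarrow>
    e (x \<oplus>\<^bsub>Q\<^esub> y) = e x \<oplus>\<^bsub>Q\<^esub> e y"
  and hom_smult: "e \<in> module_homs R Q Q \<Longrightarrow> r \<in> carrier R \<Longrightarrow> x \<in> carrier Q \<Longrightarrow>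
    e (r \<odot>\<^bsub>Q\<^esub> x) = r \<odot>\<^bsub>Q\<^esub> e x"
  by (auto simp: module_homs_def)

lemma hom_zero:
  assumes "e \<in> module_homs R Q Q"
  shows "e \<zero>\<^bsub>Q\<^esub> = \<zero>\<^bsub>Q\<^esub>"
  using hom_smult[OF assms R.zero_closed Q.zero_closed] hom_closed[OF assms Q.zero_closed] by simp

text \<open>Since \<open>a \<odot> shift x = b \<odot> x\<close>, every endomorphism commutes with \<^const>\<open>shift\<close> up to the
  annihilator of \<open>a\<close>.\<close>

lemma smult_a_hom_shift:
  assumes e: "e \<in> module_homs R Q Q" and x: "x \<in> carrier Q"
  shows "a \<odot>\<^bsub>Q\<^esub> e (shift x) = b \<odot>\<^bsub>Q\<^esub> e x"
proof -
  have "a \<odot>\<^bsub>Q\<^esub> e (shift x) = e (a \<odot>\<^bsub>Q\<^esub> shift x)"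
    using hom_smult[OF e] hom_closed[OF shift_hom x] by simp
  also have "\<dots> = b \<odot>\<^bsub>Q\<^esub> e x"
    using smult_a_shift[OF x] hom_smult[OF e _ x] by simp
  finally show ?thesis .
qed

text \<open>If \<open>a x = 0\<close>, then \<open>b x = a (t x) = t (a x) = 0\<close>, and
  \<open>I\<close> kills all of \<open>Q\<close>.\<close>

lemma smult_ab_ideal:
  assumes r: "r \<in> ab_ideal" and x: "x \<in> carrier Q" "a \<odot>\<^bsub>Q\<^esub> x = \<zero>\<^bsub>Q\<^esub>"
  shows "r \<odot>\<^bsub>Q\<^esub> x = \<zero>\<^bsub>Q\<^esub>"
proof -
  obtain s y z where *: "s \<in> I" "y \<in> carrier R" "z \<in> carrier R" "r = s \<oplus> y \<otimes> a \<oplus> z \<otimes> b"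
    using r by (rule ab_ideal_cases)
  have s: "s \<in> carrier R"
    using R.ideal_in_carrier[OF ideal_I *(1)] .
  have "b \<odot>\<^bsub>Q\<^esub> x = shift (a \<odot>\<^bsub>Q\<^esub> x)"
    using x(1) smult_a_shift hom_smult[OF shift_hom] by simp
  then have "b \<odot>\<^bsub>Q\<^esub> x = \<zero>\<^bsub>Q\<^esub>"
    using x(2) hom_zero[OF shift_hom] by simp
  then show ?thesis
    unfolding *(4) using * s x smult_I[OF *(1) x(1)]
    by (simp add: Q.smult_l_distr Q.smult_assoc1)
qed

lemma b_in_ab_ideal: "b \<in> ab_ideal"
  unfolding ab_ideal_def using R.mem_add_multiples_self[OF R.ideal_add_multiples[OF ideal_I R.oneideal]]
  by simp

lemma monom_smult_monom_one: "c \<in> carrier R \<Longrightarrow> monom P c i = c \<odot>\<^bsub>P\<^esub> monom P \<one> i"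
  by (simp add: monom_mult_smult[symmetric])

text \<open>Since \<open>a\<close> times \<open>e (t^(i+1))\<close> is \<open>b\<close> times
  \<open>e (t^i)\<close>, all values \<open>e (t^i)\<close> are killed by \<open>a\<close>, that is,
  they have representatives with coefficients in \<open>m\<close>. For \<open>e x = \<pi> p\<close>,
  idempotence gives \<open>\<pi> p = e (\<pi> p)\<close>, so the coefficients of \<open>p\<close>
  lie in \<open>ab_ideal\<close> plus \<open>m\<close> times these same coefficients. Nakayama's
  lemma puts them into \<open>ab_ideal\<close>, which kills every \<open>e (t^i)\<close>; hence
  \<open>e (\<pi> p) = 0\<close>.\<close>

lemma idempotent_hom_zero:
  assumes e: "e \<in> module_homs R Q Q" and idem: "\<And>x. x \<in> carrier Q \<Longrightarrow> e (e x) = e x"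
    and e1: "a \<odot>\<^bsub>Q\<^esub> e (\<pi> \<one>\<^bsub>P\<^esub>) = \<zero>\<^bsub>Q\<^esub>" and x: "x \<in> carrier Q"
  shows "e x = \<zero>\<^bsub>Q\<^esub>"
proof -
  have powers: "a \<odot>\<^bsub>Q\<^esub> e (\<pi> (monom P \<one> i)) = \<zero>\<^bsub>Q\<^esub>" for i
  proof (induction i)
    case 0
    then show ?case using e1 by simp
  next
    case (Suc i)
    have "e (\<pi> (monom P \<one> (Suc i))) = e (shift (\<pi> (monom P \<one> i)))"
      by (simp add: shift_pi times_X_monom)
    then show ?case
      using smult_a_hom_shift[OF e, of "\<pi> (monom P \<one> i)"]
        smult_ab_ideal[OF b_in_ab_ideal _ Suc] hom_closed[OF e] by simp
  qed
  obtain p where p: "p \<in> carrier P" "e x = \<pi> p"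
    using hom_closed[OF e x] by (rule pi_cases)
  (* Nakayama: V k is ab_ideal + m p_0 + ... + m p_(k-1), and the coefficients of p descend from V n
     to V 0. *)
  define V where "V = rec_nat ab_ideal (\<lambda>k W. add_multiples R W m (coeff P p k))"
  have V_0: "V 0 = ab_ideal" and V_Suc: "V (Suc k) = add_multiples R (V k) m (coeff P p k)" for k
    by (simp_all add: V_def)
  have V_ideal: "ideal (V k) R" for k
    by (induction k) (simp_all add: V_0 V_Suc ideal_ab_ideal R.ideal_add_multiples ideal_m p)
  have V_mono: "V k \<subseteq> V l" if "k \<le> l" for k l
    using that
  proof (induction rule: dec_induct)
    case (step n)
    then show ?case
      using R.subset_add_multiples[OF V_ideal[of n] ideal_m coeff_closed[OF p(1), of n]] V_Suc[of n] by auto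
  qed simp
  \<comment> \<open>From index \<open>n\<close> on all coefficients of \<open>p\<close> vanish, so
    \<open>V n\<close> contains \<open>m\<close> times every coefficient.\<close>
  define n where "n = Suc (deg R p)"
  have V_n: "r \<otimes> coeff P p i \<in> V n" if r: "r \<in> m" for r i
  proof (cases "i < n")
    case True
    have "r \<otimes> coeff P p i \<in> V (Suc i)"
      unfolding V_Suc by (intro R.multiple_in_add_multiples V_ideal ideal_m coeff_closed p(1) r)
    then show ?thesis
      using V_mono[of "Suc i" n] True by auto
  next
    case False
    then have "coeff P p i = \<zero>"
      using p(1) by (intro deg_aboveD) (auto simp: n_def)
    then show ?thesis
      using R.ideal_zero[OF V_ideal] R.ideal_in_carrier[OF ideal_m r] by simp
  qed
  \<comment> \<open>Expanding \<open>p\<close> into monomials, \<open>e (\<pi> p)\<close> is the sum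
    of the \<open>e (t^i)\<close> with the coefficients of \<open>p\<close> as factors, and each
    \<open>e (t^i)\<close> has a representative over \<open>m\<close>.\<close>
  have "\<exists>q\<in>carrier P. e (\<pi> p) = \<pi> q \<and> (\<forall>j. coeff P q j \<in> V n)"
  proof (rule poly_induct[OF p(1)])
    fix i
    have c: "coeff P p i \<in> carrier R"
      using p(1) by simp
    obtain q where q: "q \<in> carrier P" "e (\<pi> (monom P \<one> i)) = \<pi> q"
      using hom_closed[OF e, of "\<pi> (monom P \<one> i)"] by (auto elim: pi_cases)
    then have "coeff P q j \<in> m" for j
      using powers[of i] smult_a_pi_iff[of q] by simp
    then have "coeff P (coeff P p i \<odot>\<^bsub>P\<^esub> q) j \<in> V n" for j
      using c q V_n[of "coeff P q j" i] by (simp add: R.m_comm)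
    moreover have "e (\<pi> (monom P (coeff P p i) i)) = \<pi> (coeff P p i \<odot>\<^bsub>P\<^esub> q)"
      using c q monom_smult_monom_one[OF c, of i] hom_smult[OF e c] by (simp add: pi_smult)
    ultimately show "\<exists>q\<in>carrier P. e (\<pi> (monom P (coeff P p i) i)) = \<pi> q \<and> (\<forall>j. coeff P q j \<in> V n)"
      using c q by (intro bexI[of _ "coeff P p i \<odot>\<^bsub>P\<^esub> q"]) simp_all
  next
    fix f g assume fg: "f \<in> carrier P" "g \<in> carrier P"
      and "\<exists>q\<in>carrier P. e (\<pi> f) = \<pi> q \<and> (\<forall>j. coeff P q j \<in> V n)"
      and "\<exists>q\<in>carrier P. e (\<pi> g) = \<pi> q \<and> (\<forall>j. coeff P q j \<in> V n)"
    then obtain q q' where q: "q \<in> carrier P" "e (\<pi> f) = \<pi> q" "\<And>j. coeff P q j \<in> V n"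
      "q' \<in> carrier P" "e (\<pi> g) = \<pi> q'" "\<And>j. coeff P q' j \<in> V n"
      by blast
    then show "\<exists>q\<in>carrier P. e (\<pi> (f \<oplus>\<^bsub>P\<^esub> g)) = \<pi> q \<and> (\<forall>j. coeff P q j \<in> V n)"
      using fg R.ideal_add[OF V_ideal]
      by (intro bexI[of _ "q \<oplus>\<^bsub>P\<^esub> q'"]) (simp_all add: pi_add hom_add[OF e])
  qed
  then obtain q where q: "q \<in> carrier P" "e (\<pi> p) = \<pi> q" "\<And>j. coeff P q j \<in> V n"
    by blast
  have "p \<ominus>\<^bsub>P\<^esub> q \<in> relations"
    using pi_eq_iff[OF p(1) q(1)] idem[OF x] p(2) q(2) by simp
  then have top: "coeff P p j \<in> V n" for j
  proof -
    have "coeff P p j \<ominus> coeff P q j \<in> ab_ideal"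
      using coeff_relation[OF \<open>p \<ominus>\<^bsub>P\<^esub> q \<in> relations\<close>, of j] p q by (simp add: P.minus_eq R.minus_eq)
    then have "coeff P p j \<ominus> coeff P q j \<in> V n"
      using V_mono[of 0 n] V_0 by auto
    then show ?thesis
      using R.ideal_cong[OF V_ideal _ _ _ q(3)] p q by simp
  qed
  \<comment> \<open>The coefficient at \<open>k\<close> has the form \<open>c = s + r c\<close> with
    \<open>s\<close> in \<open>V k\<close> and \<open>r\<close> in \<open>m\<close>. As
    \<open>1 - r\<close> is a unit modulo \<open>I\<close>, \<open>c\<close> lies in
    \<open>V k\<close>, so adding its multiples by \<open>m\<close> has added nothing.\<close>
  have descend: "\<forall>j. coeff P p j \<in> V k" if Suc: "\<forall>j. coeff P p j \<in> V (Suc k)" for k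
  proof -
    define c where "c = coeff P p k"
    have c: "c \<in> carrier R" using p by (simp add: c_def)
    have "c \<in> V (Suc k)" using that by (simp add: c_def)
    then obtain s r where sr: "s \<in> V k" "r \<in> m" "c = s \<oplus> r \<otimes> c"
      unfolding V_Suc add_multiples_def c_def by blast
    have r: "r \<in> carrier R" and s: "s \<in> carrier R"
      using sr R.ideal_in_carrier[OF ideal_m] R.ideal_in_carrier[OF V_ideal] by auto
    have "\<one> \<ominus> r \<notin> m"
      using R.ideal_cong[OF ideal_m R.one_closed r _ sr(2)] one_notin by blast
    then obtain y where y: "y \<in> carrier R" "(\<one> \<ominus> r) \<otimes> y \<ominus> \<one> \<in> I"
      using invertible[of "\<one> \<ominus> r"] r by auto
    have "(\<one> \<ominus> r) \<otimes> c = c \<ominus> r \<otimes> c"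
      using c r by algebra
    also have "\<dots> = (s \<oplus> r \<otimes> c) \<ominus> r \<otimes> c"
      using sr(3) by simp
    also have "\<dots> = s"
      using s r c by algebra
    finally have "(\<one> \<ominus> r) \<otimes> c = s" .
    moreover have "c = y \<otimes> ((\<one> \<ominus> r) \<otimes> c) \<ominus> ((\<one> \<ominus> r) \<otimes> y \<ominus> \<one>) \<otimes> c"
      using c r y(1) by algebra
    moreover have "y \<otimes> s \<in> V k"
      using R.ideal_mult_left[OF V_ideal sr(1) y(1)] .
    moreover have "((\<one> \<ominus> r) \<otimes> y \<ominus> \<one>) \<otimes> c \<in> V k"
      using R.ideal_mult_right[OF V_ideal _ c] y(2) I_subset_ab_ideal V_mono[of 0 k] V_0 by blast
    ultimately have ck: "c \<in> V k"
      using R.ideal_diff[OF V_ideal] by metis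
    show ?thesis
    proof
      fix j
      obtain s r where sr: "s \<in> V k" "r \<in> m" "coeff P p j = s \<oplus> r \<otimes> c"
        using spec[OF Suc, of j] unfolding V_Suc add_multiples_def c_def by blast
      then show "coeff P p j \<in> V k"
        using ck R.ideal_add[OF V_ideal] R.ideal_mult_left[OF V_ideal]
          R.ideal_in_carrier[OF ideal_m sr(2)] by simp
    qed
  qed
  \<comment> \<open>Truncated subtraction stops the descent at \<open>V 0\<close>.\<close>
  have "\<forall>j. coeff P p j \<in> V (n - k)" for k
  proof (induction k)
    case (Suc k)
    then show ?case
      using descend[of "n - Suc k"] by (cases "k < n") (simp_all add: Suc_diff_Suc)
  qed (simp add: top)
  from this[of n] have bottom: "coeff P p j \<in> ab_ideal" for j
    using V_0 by simp
  have "e (\<pi> p) = \<zero>\<^bsub>Q\<^esub>"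
  proof (rule poly_induct[OF p(1)])
    fix i
    have c: "coeff P p i \<in> carrier R"
      using p(1) by simp
    then show "e (\<pi> (monom P (coeff P p i) i)) = \<zero>\<^bsub>Q\<^esub>"
      using monom_smult_monom_one[OF c, of i] hom_smult[OF e c] hom_closed[OF e]
        smult_ab_ideal[OF bottom _ powers, of i] by (simp add: pi_smult)
  qed (simp add: pi_add hom_add[OF e])
  then show ?thesis
    using idem[OF x] p(2) by simp
qed

text \<open>With \<open>e 1 = \<pi> p\<close>, the map \<open>e\<close> is multiplication by
  \<open>p\<close> up to the annihilator of \<open>a\<close>. So idempotence makes the coefficients
  of \<open>p (1 - p)\<close> lie in \<open>m\<close>, and \<open>coeff_prime\<close> decides
  between \<open>p\<close> and \<open>1 - p\<close>.\<close>

lemma idempotent_hom_dichotomy: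
  assumes e: "e \<in> module_homs R Q Q" and idem: "\<And>x. x \<in> carrier Q \<Longrightarrow> e (e x) = e x"
  shows "a \<odot>\<^bsub>Q\<^esub> e (\<pi> \<one>\<^bsub>P\<^esub>) = \<zero>\<^bsub>Q\<^esub> \<or> a \<odot>\<^bsub>Q\<^esub> (\<pi> \<one>\<^bsub>P\<^esub> \<ominus>\<^bsub>Q\<^esub> e (\<pi> \<one>\<^bsub>P\<^esub>)) = \<zero>\<^bsub>Q\<^esub>"
proof -
  obtain p where p: "p \<in> carrier P" "e (\<pi> \<one>\<^bsub>P\<^esub>) = \<pi> p"
    using hom_closed[OF e, of "\<pi> \<one>\<^bsub>P\<^esub>"] by (auto elim: pi_cases)
  have powers: "a \<odot>\<^bsub>Q\<^esub> e (\<pi> (monom P \<one> i)) = a \<odot>\<^bsub>Q\<^esub> \<pi> (monom P \<one> i \<otimes>\<^bsub>P\<^esub> p)" for i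
  proof (induction i)
    case 0
    then show ?case using p by simp
  next
    case (Suc i)
    \<comment> \<open>By induction \<open>u - v\<close> is killed by \<open>a\<close>, hence also by
      \<open>b\<close>. This suffices, because at the next power the two sides of the claim are
      \<open>b u\<close> and \<open>b v\<close>.\<close>
    define u v where "u = e (\<pi> (monom P \<one> i))" and "v = \<pi> (monom P \<one> i \<otimes>\<^bsub>P\<^esub> p)"
    have uv: "u \<in> carrier Q" "v \<in> carrier Q"
      unfolding u_def v_def using p hom_closed[OF e] by simp_all
    have "a \<odot>\<^bsub>Q\<^esub> (u \<ominus>\<^bsub>Q\<^esub> v) = a \<odot>\<^bsub>Q\<^esub> u \<ominus>\<^bsub>Q\<^esub> a \<odot>\<^bsub>Q\<^esub> v"
      using uv by (simp add: Q.smult_minus_right)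
    then have "a \<odot>\<^bsub>Q\<^esub> (u \<ominus>\<^bsub>Q\<^esub> v) = \<zero>\<^bsub>Q\<^esub>"
      using Suc uv by (simp add: u_def v_def Q.minus_eq Q.r_neg)
    then have "b \<odot>\<^bsub>Q\<^esub> (u \<ominus>\<^bsub>Q\<^esub> v) = \<zero>\<^bsub>Q\<^esub>"
      using smult_ab_ideal[OF b_in_ab_ideal] uv by simp
    then have "b \<odot>\<^bsub>Q\<^esub> u = b \<odot>\<^bsub>Q\<^esub> v"
      using uv Q.minus_eq_zeroD[of "b \<odot>\<^bsub>Q\<^esub> u" "b \<odot>\<^bsub>Q\<^esub> v"] by (simp add: Q.smult_minus_right)
    moreover have "a \<odot>\<^bsub>Q\<^esub> e (\<pi> (monom P \<one> (Suc i))) = b \<odot>\<^bsub>Q\<^esub> u"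
      using smult_a_hom_shift[OF e, of "\<pi> (monom P \<one> i)"] by (simp add: shift_pi times_X_monom u_def)
    moreover have "a \<odot>\<^bsub>Q\<^esub> \<pi> (monom P \<one> (Suc i) \<otimes>\<^bsub>P\<^esub> p) = b \<odot>\<^bsub>Q\<^esub> v"
      using smult_a_shift[OF uv(2)] p by (simp add: v_def shift_pi times_X_mult times_X_monom)
    ultimately show ?case by simp
  qed
  have "a \<odot>\<^bsub>Q\<^esub> e (\<pi> p) = a \<odot>\<^bsub>Q\<^esub> \<pi> (p \<otimes>\<^bsub>P\<^esub> p)"
  proof (rule poly_induct[OF p(1), where S = "\<lambda>q. a \<odot>\<^bsub>Q\<^esub> e (\<pi> q) = a \<odot>\<^bsub>Q\<^esub> \<pi> (q \<otimes>\<^bsub>P\<^esub> p)"])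
    fix i
    define c where "c = coeff P p i"
    have c: "c \<in> carrier R"
      using p(1) by (simp add: c_def)
    have swap: "a \<odot>\<^bsub>Q\<^esub> (c \<odot>\<^bsub>Q\<^esub> y) = c \<odot>\<^bsub>Q\<^esub> (a \<odot>\<^bsub>Q\<^esub> y)" if "y \<in> carrier Q" for y
      using c that by (simp add: R.m_comm flip: Q.smult_assoc1)
    have "a \<odot>\<^bsub>Q\<^esub> e (\<pi> (monom P c i)) = c \<odot>\<^bsub>Q\<^esub> (a \<odot>\<^bsub>Q\<^esub> e (\<pi> (monom P \<one> i)))"
      using c swap hom_closed[OF e] monom_smult_monom_one[OF c, of i] hom_smult[OF e c] by (simp add: pi_smult)
    also have "\<dots> = a \<odot>\<^bsub>Q\<^esub> \<pi> (monom P c i \<otimes>\<^bsub>P\<^esub> p)"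
      unfolding powers using c swap monom_smult_monom_one[OF c, of i] p by (simp add: pi_smult UP_smult_assoc2)
    finally show "a \<odot>\<^bsub>Q\<^esub> e (\<pi> (monom P (coeff P p i) i)) = a \<odot>\<^bsub>Q\<^esub> \<pi> (monom P (coeff P p i) i \<otimes>\<^bsub>P\<^esub> p)"
      by (simp add: c_def)
  next
    fix f g assume "f \<in> carrier P" "g \<in> carrier P"
      and "a \<odot>\<^bsub>Q\<^esub> e (\<pi> f) = a \<odot>\<^bsub>Q\<^esub> \<pi> (f \<otimes>\<^bsub>P\<^esub> p)" "a \<odot>\<^bsub>Q\<^esub> e (\<pi> g) = a \<odot>\<^bsub>Q\<^esub> \<pi> (g \<otimes>\<^bsub>P\<^esub> p)"
    then show "a \<odot>\<^bsub>Q\<^esub> e (\<pi> (f \<oplus>\<^bsub>P\<^esub> g)) = a \<odot>\<^bsub>Q\<^esub> \<pi> ((f \<oplus>\<^bsub>P\<^esub> g) \<otimes>\<^bsub>P\<^esub> p)"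
      using p hom_closed[OF e] by (simp add: pi_add hom_add[OF e] Q.smult_r_distr P.l_distr)
  qed
  moreover have "e (\<pi> p) = \<pi> p"
    using idem[of "\<pi> \<one>\<^bsub>P\<^esub>"] p by simp
  moreover have "a \<odot>\<^bsub>Q\<^esub> \<pi> (p \<ominus>\<^bsub>P\<^esub> p \<otimes>\<^bsub>P\<^esub> p) = a \<odot>\<^bsub>Q\<^esub> \<pi> p \<ominus>\<^bsub>Q\<^esub> a \<odot>\<^bsub>Q\<^esub> \<pi> (p \<otimes>\<^bsub>P\<^esub> p)"
    using p by (simp add: pi_diff Q.smult_minus_right)
  ultimately have "a \<odot>\<^bsub>Q\<^esub> \<pi> (p \<ominus>\<^bsub>P\<^esub> p \<otimes>\<^bsub>P\<^esub> p) = \<zero>\<^bsub>Q\<^esub>"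
    using p by (simp add: Q.minus_eq Q.r_neg)
  moreover have "p \<ominus>\<^bsub>P\<^esub> p \<otimes>\<^bsub>P\<^esub> p = p \<otimes>\<^bsub>P\<^esub> (\<one>\<^bsub>P\<^esub> \<ominus>\<^bsub>P\<^esub> p)"
    using p by (simp add: P.minus_eq P.r_distr P.r_minus)
  ultimately have "\<forall>i. coeff P (p \<otimes>\<^bsub>P\<^esub> (\<one>\<^bsub>P\<^esub> \<ominus>\<^bsub>P\<^esub> p)) i \<in> m"
    using p smult_a_pi_iff[of "p \<otimes>\<^bsub>P\<^esub> (\<one>\<^bsub>P\<^esub> \<ominus>\<^bsub>P\<^esub> p)"] by (simp del: coeff_mult)
  then have "(\<forall>i. coeff P p i \<in> m) \<or> (\<forall>i. coeff P (\<one>\<^bsub>P\<^esub> \<ominus>\<^bsub>P\<^esub> p) i \<in> m)"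
    using p by (intro coeff_prime) (simp_all del: coeff_mult)
  then show ?thesis
    using p smult_a_pi_iff[of p] smult_a_pi_iff[of "\<one>\<^bsub>P\<^esub> \<ominus>\<^bsub>P\<^esub> p"] by (simp add: pi_diff)
qed

lemma indecomposable: "indecomposable_module R Q"
  unfolding indecomposable_module_def
proof (intro conjI allI impI; (elim conjE)?)
  have "\<one>\<^bsub>P\<^esub> \<notin> relations"
  proof
    assume "\<one>\<^bsub>P\<^esub> \<in> relations"
    from coeff_relation[OF this, of 0] show False
      using ab_ideal_subset one_notin by auto
  qed
  then have "\<pi> \<one>\<^bsub>P\<^esub> \<noteq> \<zero>\<^bsub>Q\<^esub>"
    using pi_zero_iff[of "\<one>\<^bsub>P\<^esub>"] by simp
  moreover have "\<pi> \<one>\<^bsub>P\<^esub> \<in> carrier Q"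
    by simp
  ultimately show "carrier Q \<noteq> {\<zero>\<^bsub>Q\<^esub>}"
    by (metis singletonD)
  fix A B assume AB: "submodule A R Q" "submodule B R Q" "A \<inter> B = {\<zero>\<^bsub>Q\<^esub>}" "A <+>\<^bsub>Q\<^esub> B = carrier Q"
  obtain e where e: "e \<in> module_homs R Q Q" and eA: "\<And>x. x \<in> carrier Q \<Longrightarrow> e x \<in> A"
    and eB: "\<And>x. x \<in> carrier Q \<Longrightarrow> x \<ominus>\<^bsub>Q\<^esub> e x \<in> B"
    and onA: "\<And>x. x \<in> A \<Longrightarrow> e x = x" and onB: "\<And>x. x \<in> B \<Longrightarrow> e x = \<zero>\<^bsub>Q\<^esub>"
    using Q.complement_projection[OF AB] by (auto simp: Bex_def)
  note AQ = Q.submoduleE(1)[OF AB(1)] and BQ = Q.submoduleE(1)[OF AB(2)]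
  have idem: "e (e x) = e x" if "x \<in> carrier Q" for x
    using onA eA that by simp
  \<comment> \<open>The complementary projection, onto \<open>B\<close>. By the dichotomy
    \<open>e\<close> or \<open>f\<close> sends the class of 1 into the annihilator of
    \<open>a\<close>; that map vanishes, and so does the submodule that it fixes pointwise.\<close>
  define f where "f = (\<lambda>x\<in>carrier Q. x \<ominus>\<^bsub>Q\<^esub> e x)"
  have f_hom: "f \<in> module_homs R Q Q"
  proof -
    have "(x \<oplus>\<^bsub>Q\<^esub> y) \<ominus>\<^bsub>Q\<^esub> (e x \<oplus>\<^bsub>Q\<^esub> e y) = (x \<ominus>\<^bsub>Q\<^esub> e x) \<oplus>\<^bsub>Q\<^esub> (y \<ominus>\<^bsub>Q\<^esub> e y)"
      if "x \<in> carrier Q" "y \<in> carrier Q" for x y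
      using that hom_closed[OF e that(1)] hom_closed[OF e that(2)]
      by (simp add: Q.minus_eq Q.minus_add Q.a_ac)
    then show ?thesis
      using hom_closed[OF e]
      by (auto simp: module_homs_def f_def hom_add[OF e] hom_smult[OF e] Q.smult_minus_right)
  qed
  have f_idem: "f (f x) = f x" if "x \<in> carrier Q" for x
    using that onB[OF eB[OF that]] hom_closed[OF e that] by (simp add: f_def)
  from idempotent_hom_dichotomy[OF e idem]
  show "A = {\<zero>\<^bsub>Q\<^esub>} \<or> B = {\<zero>\<^bsub>Q\<^esub>}"
  proof
    assume e1: "a \<odot>\<^bsub>Q\<^esub> e (\<pi> \<one>\<^bsub>P\<^esub>) = \<zero>\<^bsub>Q\<^esub>"
    have "x = \<zero>\<^bsub>Q\<^esub>" if xA: "x \<in> A" for x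
    proof -
      have "x \<in> carrier Q"
        using AQ xA by blast
      with e e1 have "e x = \<zero>\<^bsub>Q\<^esub>"
        by (intro idempotent_hom_zero[of e x]) (simp_all add: idem)
      then show ?thesis
        by (simp add: onA[OF xA])
    qed
    then have "A \<subseteq> {\<zero>\<^bsub>Q\<^esub>}"
      by blast
    then show ?thesis
      using Q.submodule_zero[OF AB(1)] by blast
  next
    assume "a \<odot>\<^bsub>Q\<^esub> (\<pi> \<one>\<^bsub>P\<^esub> \<ominus>\<^bsub>Q\<^esub> e (\<pi> \<one>\<^bsub>P\<^esub>)) = \<zero>\<^bsub>Q\<^esub>"
    then have f1: "a \<odot>\<^bsub>Q\<^esub> f (\<pi> \<one>\<^bsub>P\<^esub>) = \<zero>\<^bsub>Q\<^esub>"
      by (simp add: f_def)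
    have "x = \<zero>\<^bsub>Q\<^esub>" if xB: "x \<in> B" for x
    proof -
      have xQ: "x \<in> carrier Q"
        using BQ xB by blast
      with f_hom f1 have "f x = \<zero>\<^bsub>Q\<^esub>"
        by (intro idempotent_hom_zero[of f x]) (simp_all add: f_idem)
      then show ?thesis
        using xQ by (simp add: f_def onB[OF xB])
    qed
    then have "B \<subseteq> {\<zero>\<^bsub>Q\<^esub>}"
      by blast
    then show ?thesis
      using Q.submodule_zero[OF AB(2)] by blast
  qed
qed

text \<open>Relations have all coefficients in \<open>m\<close>, while \<open>1 - t p\<close> has
  constant coefficient 1.\<close>

lemma shift_not_surj: "shift ` carrier Q \<noteq> carrier Q"
proof
  assume "shift ` carrier Q = carrier Q"
  then have "\<pi> \<one>\<^bsub>P\<^esub> \<in> shift ` \<pi> ` carrier P"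
    unfolding pi_image by simp
  then obtain p where p: "p \<in> carrier P" "\<pi> \<one>\<^bsub>P\<^esub> = \<pi> (times_X p)"
    by (auto simp: shift_pi)
  then have "\<one>\<^bsub>P\<^esub> \<ominus>\<^bsub>P\<^esub> times_X p \<in> relations"
    using pi_eq_iff[of "\<one>\<^bsub>P\<^esub>" "times_X p"] by simp
  from coeff_relation[OF this, of 0] have "coeff P (\<one>\<^bsub>P\<^esub> \<ominus>\<^bsub>P\<^esub> times_X p) 0 \<in> m"
    using ab_ideal_subset by blast
  then show False
    using p one_notin by (simp add: P.minus_eq coeff_times_X)
qed

text \<open>Modulo \<open>m\<close>, the equation \<open>1 = (1 - t) p\<close> forces every
  coefficient of \<open>p\<close> to be 1, as in the geometric series; but the coefficients above
  the degree are 0.\<close>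

lemma one_minus_shift_not_surj: "\<not> (\<forall>y\<in>carrier Q. \<exists>x\<in>carrier Q. y = x \<ominus>\<^bsub>Q\<^esub> shift x)"
proof
  assume "\<forall>y\<in>carrier Q. \<exists>x\<in>carrier Q. y = x \<ominus>\<^bsub>Q\<^esub> shift x"
  then have "\<exists>x\<in>\<pi> ` carrier P. \<pi> \<one>\<^bsub>P\<^esub> = x \<ominus>\<^bsub>Q\<^esub> shift x"
    unfolding pi_image by simp
  then obtain p where p: "p \<in> carrier P" "\<pi> \<one>\<^bsub>P\<^esub> = \<pi> (p \<ominus>\<^bsub>P\<^esub> times_X p)"
    by (auto simp: shift_pi pi_diff)
  then have "\<one>\<^bsub>P\<^esub> \<ominus>\<^bsub>P\<^esub> (p \<ominus>\<^bsub>P\<^esub> times_X p) \<in> relations"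
    using pi_eq_iff[of "\<one>\<^bsub>P\<^esub>" "p \<ominus>\<^bsub>P\<^esub> times_X p"] by simp
  from coeff_relation[OF this] have "coeff P (\<one>\<^bsub>P\<^esub> \<ominus>\<^bsub>P\<^esub> (p \<ominus>\<^bsub>P\<^esub> times_X p)) i \<in> m" for i
    using ab_ideal_subset by blast
  then have rel: "coeff P \<one>\<^bsub>P\<^esub> i \<ominus> (coeff P p i \<ominus> coeff P (times_X p) i) \<in> m" for i
    using p by (simp add: P.minus_eq R.minus_eq del: coeff_one)
  have "\<one> \<ominus> coeff P p i \<in> m" for i
  proof (induction i)
    case 0
    then show ?case
      using rel[of 0] p by (simp add: coeff_times_X)
  next
    case (Suc i)
    have "(\<zero> \<ominus> (v \<ominus> u)) \<oplus> (\<one> \<ominus> u) = \<one> \<ominus> v" if "u \<in> carrier R" "v \<in> carrier R" for u v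
      using that by algebra
    moreover have "\<zero> \<ominus> (coeff P p (Suc i) \<ominus> coeff P p i) \<in> m"
      using rel[of "Suc i"] p by (simp add: coeff_times_X)
    ultimately show ?case
      using R.ideal_add[OF ideal_m _ Suc] coeff_closed[OF p(1)] by metis
  qed
  from this[of "Suc (deg R p)"] show False
    using deg_aboveD[of p "Suc (deg R p)"] p one_notin by simp
qed

end

section \<open>Comparability of elements modulo a local ideal\<close>

context local_indecomposables begin

text \<open>Here the encoding of \<open>R[t]\<close> is used: \<open>Q\<close> gets a copy in
  \<open>'m\<close>, so that the hypothesis on indecomposable modules applies to it.\<close>

lemma no_incomparable_pair: "\<not> incomparable_pair R I m a b"
proof
  define P where "P = UP R"
  assume "incomparable_pair R I m a b"
  then interpret incomparable_pair R P I m a b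
  proof -
    show "P \<equiv> UP R" by (simp add: P_def)
  qed
  obtain H :: "(nat \<Rightarrow> 'a) \<Rightarrow> 'm" where "inj_on H (up R)"
    using finitely_supported_inj[OF infinite_universe inj] by blast
  then have "inj_on H (carrier P)"
    by (simp add: P_def UP_def)
  from quotient_module_exists[OF submodule_relations this]
  obtain Q :: "('a, 'm) module" and \<pi> where Q: "module R Q"
    and "\<pi> ` carrier P = carrier Q"
      "\<forall>x\<in>carrier P. \<forall>y\<in>carrier P. \<pi> (x \<oplus>\<^bsub>P\<^esub> y) = \<pi> x \<oplus>\<^bsub>Q\<^esub> \<pi> y"
      "\<forall>a\<in>carrier R. \<forall>x\<in>carrier P. \<pi> (a \<odot>\<^bsub>P\<^esub> x) = a \<odot>\<^bsub>Q\<^esub> \<pi> x"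
      "\<forall>x\<in>carrier P. \<pi> x = \<zero>\<^bsub>Q\<^esub> \<longleftrightarrow> x \<in> relations"
    by blast
  then interpret pencil_module R P I m a b Q \<pi>
    by (intro pencil_module.intro incomparable_pair_axioms pencil_module_axioms.intro)
      (simp_all add: P_def)
  show False
    using Q.local_End_dichotomy[OF local_End[OF Q indecomposable] shift_hom]
      shift_not_surj one_minus_shift_not_surj by blast
qed

text \<open>Let \<open>m\<close> consist of the non-units modulo \<open>I\<close>. If
  \<open>r a + s b\<close> lies in \<open>J = I + m a + m b\<close>, then
  \<open>(r - x) a + (s - y) b\<close> lies in \<open>I\<close> for some \<open>x\<close> and
  \<open>y\<close> in \<open>m\<close>. A unit among these two coefficients would make
  \<open>a\<close> or \<open>b\<close> a multiple of the other modulo \<open>I\<close>. So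
  incomparable elements become independent over the residue field.\<close>

lemma local_imp_chain:
  assumes I: "ideal I R" and loc: "local_ideal R I"
  shows "chain_ideal R I"
  unfolding chain_ideal_def
proof (intro ballI, rule ccontr)
  fix a b assume ab: "a \<in> carrier R" "b \<in> carrier R"
    and incomparable: "\<not> (\<exists>c\<in>carrier R. a \<ominus> c \<otimes> b \<in> I \<or> b \<ominus> c \<otimes> a \<in> I)"
  define m where "m = {x \<in> carrier R. \<forall>y\<in>carrier R. x \<otimes> y \<ominus> \<one> \<notin> I}"
  have m: "ideal m R"
  proof (rule idealI')
    show "m \<subseteq> carrier R" by (auto simp: m_def)
    have "\<one> \<in> I" if "y \<in> carrier R" "\<zero> \<otimes> y \<ominus> \<one> \<in> I" for y
    proof -
      have "\<ominus> (\<zero> \<otimes> y \<ominus> \<one>) = \<one>"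
        using that(1) by algebra
      then show ?thesis
        using ideal_uminus[OF I that(2)] by simp
    qed
    then show "\<zero> \<in> m"
      using loc by (auto simp: m_def local_ideal_def)
    fix x y assume x: "x \<in> m" and y: "y \<in> m"
    then have xy: "x \<in> carrier R" "y \<in> carrier R"
      by (auto simp: m_def)
    show "x \<oplus> y \<in> m"
    proof (rule ccontr)
      assume "x \<oplus> y \<notin> m"
      then obtain z where z: "z \<in> carrier R" "(x \<oplus> y) \<otimes> z \<ominus> \<one> \<in> I"
        using xy by (auto simp: m_def)
      \<comment> \<open>With \<open>(x + y) z\<close> congruent to 1, \<open>1 - x z\<close> is
        congruent to \<open>y z\<close>. Locality makes \<open>x z\<close> or \<open>1 - x z\<close>
        a unit, and then \<open>x\<close> or \<open>y\<close> is one.\<close>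
      have "x \<otimes> z \<in> carrier R"
        using xy z by simp
      then consider w where "w \<in> carrier R" "(x \<otimes> z) \<otimes> w \<ominus> \<one> \<in> I"
        | w where "w \<in> carrier R" "(\<one> \<ominus> x \<otimes> z) \<otimes> w \<ominus> \<one> \<in> I"
        using loc unfolding local_ideal_def by blast
      then show False
      proof cases
        case 1
        then show False
          using x z xy by (auto simp: m_def m_assoc)
      next
        case 2
        have "y \<otimes> (z \<otimes> w) \<ominus> \<one> = ((x \<oplus> y) \<otimes> z \<ominus> \<one>) \<otimes> w \<oplus> ((\<one> \<ominus> x \<otimes> z) \<otimes> w \<ominus> \<one>)"
          using xy z(1) 2(1) by algebra
        then have "y \<otimes> (z \<otimes> w) \<ominus> \<one> \<in> I"
          using ideal_add[OF I ideal_mult_right[OF I z(2) 2(1)] 2(2)] by simp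
        then show False
          using y z 2 by (auto simp: m_def)
      qed
    qed
  next
    fix r x assume "r \<in> carrier R" "x \<in> m"
    then show "r \<otimes> x \<in> m"
      by (auto simp: m_def m_assoc m_comm[of r x])
  qed
  have invertible: "\<exists>y\<in>carrier R. x \<otimes> y \<ominus> \<one> \<in> I" if "x \<in> carrier R" "x \<notin> m" for x
    using that by (auto simp: m_def)
  have inv: "u \<in> carrier R \<Longrightarrow> v \<in> carrier R \<Longrightarrow> r \<in> carrier R \<Longrightarrow> s \<in> carrier R \<Longrightarrow>
      r \<otimes> u \<oplus> s \<otimes> v \<in> I \<Longrightarrow> r \<notin> m \<Longrightarrow> \<exists>c\<in>carrier R. u \<ominus> c \<otimes> v \<in> I" for u v r s
  proof -
    assume c: "u \<in> carrier R" "v \<in> carrier R" "r \<in> carrier R" "s \<in> carrier R"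
      and rs: "r \<otimes> u \<oplus> s \<otimes> v \<in> I" and "r \<notin> m"
    then obtain y where y: "y \<in> carrier R" "r \<otimes> y \<ominus> \<one> \<in> I"
      using invertible by blast
    have "u \<ominus> (\<ominus> (s \<otimes> y)) \<otimes> v = (r \<otimes> u \<oplus> s \<otimes> v) \<otimes> y \<ominus> (r \<otimes> y \<ominus> \<one>) \<otimes> u"
      using c y(1) by algebra
    then have "u \<ominus> (\<ominus> (s \<otimes> y)) \<otimes> v \<in> I"
      using ideal_diff[OF I ideal_mult_right[OF I rs y(1)] ideal_mult_right[OF I y(2) c(1)]] by simp
    then show ?thesis
      using c y by blast
  qed
  define J where "J = add_multiples R (add_multiples R I m a) m b"
  have J: "ideal J R"
    unfolding J_def by (intro ideal_add_multiples I m ab)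
  have "\<one> \<notin> m"
  proof
    assume "\<one> \<in> m"
    then have "\<one> \<otimes> \<one> \<ominus> \<one> \<notin> I" by (auto simp: m_def)
    then show False using ideal_zero[OF I] by (simp add: minus_eq r_neg)
  qed
  have I_J: "I \<subseteq> J"
    unfolding J_def using subset_add_multiples[OF I m ab(1)]
      subset_add_multiples[OF ideal_add_multiples[OF I m ab(1)] m ab(2)] by blast
  \<comment> \<open>A unit modulo \<open>I\<close> divides everything, so incomparable elements are
    non-units.\<close>
  have mem: "u \<in> m" if c: "u \<in> carrier R" "v \<in> carrier R"
    and inc: "\<And>c. c \<in> carrier R \<Longrightarrow> u \<ominus> c \<otimes> v \<notin> I" "\<And>c. c \<in> carrier R \<Longrightarrow> v \<ominus> c \<otimes> u \<notin> I" for u v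
  proof (rule ccontr)
    assume "u \<notin> m"
    then obtain y where y: "y \<in> carrier R" "u \<otimes> y \<ominus> \<one> \<in> I"
      using invertible c by blast
    have "v \<ominus> (v \<otimes> y) \<otimes> u = \<ominus> ((u \<otimes> y \<ominus> \<one>) \<otimes> v)"
      using c y(1) by algebra
    then have "v \<ominus> (v \<otimes> y) \<otimes> u \<in> I"
      using ideal_uminus[OF I ideal_mult_right[OF I y(2) c(2)]] by simp
    then show False
      using inc(2)[of "v \<otimes> y"] c y by simp
  qed
  have am: "a \<in> m" and bm: "b \<in> m"
    using mem[of a b] mem[of b a] ab incomparable by blast+
  have I_m: "I \<subseteq> m"
  proof
    fix x assume x: "x \<in> I"
    then have xR: "x \<in> carrier R"
      using ideal_in_carrier[OF I] by simp
    have "x \<otimes> y \<ominus> \<one> \<notin> I" if "y \<in> carrier R" for y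
    proof
      assume *: "x \<otimes> y \<ominus> \<one> \<in> I"
      have "\<one> = x \<otimes> y \<ominus> (x \<otimes> y \<ominus> \<one>)"
        using xR that by algebra
      then have "\<one> \<in> I"
        using ideal_diff[OF I ideal_mult_right[OF I x that] *] by simp
      then show False
        using loc by (simp add: local_ideal_def)
    qed
    then show "x \<in> m"
      using xR by (simp add: m_def)
  qed
  have J_m: "J \<subseteq> m"
    unfolding J_def add_multiples_def using I_m ab
    by (auto intro!: ideal_add[OF m] ideal_mult_right[OF m])
  have "incomparable_pair R J m a b"
  proof (intro incomparable_pair.intro incomparable_pair_axioms.intro)
    show "UP_cring R" by (simp add: UP_cring_def is_cring)
    show "ideal J R" "ideal m R" "J \<subseteq> m" "a \<in> m" "b \<in> m" "\<one> \<notin> m"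
      by fact+
    show "\<exists>y\<in>carrier R. x \<otimes> y \<ominus> \<one> \<in> J" if "x \<in> carrier R" "x \<notin> m" for x
      using invertible[OF that] I_J by blast
    show "x \<otimes> a \<in> J" if "x \<in> m" for x
      unfolding J_def using multiple_in_add_multiples[OF I m ab(1) that]
        subset_add_multiples[OF ideal_add_multiples[OF I m ab(1)] m ab(2)] by blast
    show "x \<otimes> b \<in> J" if "x \<in> m" for x
      unfolding J_def by (intro multiple_in_add_multiples ideal_add_multiples I m ab that)
    show "r \<in> m \<and> s \<in> m" if rs: "r \<in> carrier R" "s \<in> carrier R" "r \<otimes> a \<oplus> s \<otimes> b \<in> J" for r s
    proof -
      obtain i x y where *: "i \<in> I" "x \<in> m" "y \<in> m" "r \<otimes> a \<oplus> s \<otimes> b = i \<oplus> x \<otimes> a \<oplus> y \<otimes> b"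
        using rs(3) unfolding J_def add_multiples_def by blast
      have c: "i \<in> carrier R" "x \<in> carrier R" "y \<in> carrier R"
        using * ideal_in_carrier I m by blast+
      have "(r \<ominus> x) \<otimes> a \<oplus> (s \<ominus> y) \<otimes> b = (r \<otimes> a \<oplus> s \<otimes> b) \<ominus> (x \<otimes> a \<oplus> y \<otimes> b)"
        using rs c ab by algebra
      also have "\<dots> = (i \<oplus> x \<otimes> a \<oplus> y \<otimes> b) \<ominus> (x \<otimes> a \<oplus> y \<otimes> b)"
        using *(4) by simp
      also have "\<dots> = i"
        using c ab by algebra
      finally have 1: "(r \<ominus> x) \<otimes> a \<oplus> (s \<ominus> y) \<otimes> b \<in> I"
        using *(1) by simp
      then have 2: "(s \<ominus> y) \<otimes> b \<oplus> (r \<ominus> x) \<otimes> a \<in> I"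
        using rs c ab by (simp add: a_comm)
      have "r \<ominus> x \<in> m"
        using inv[OF ab _ _ 1] rs c incomparable by auto
      moreover have "s \<ominus> y \<in> m"
        using inv[OF ab(2,1) _ _ 2] rs c incomparable by auto
      ultimately show ?thesis
        using ideal_cong[OF m rs(1) c(2) _ *(2)] ideal_cong[OF m rs(2) c(3) _ *(3)] by simp
    qed
  qed
  then show False
    using no_incomparable_pair by blast
qed

end

section \<open>Linear combinations and diagonalization over chain rings\<close>

text \<open>The index set is arbitrary so that elimination can drop a pivot index without
  renumbering the generators.\<close>

definition lin_comb :: "('a, 'm, 'k) module_scheme \<Rightarrow> 'i set \<Rightarrow> ('i \<Rightarrow> 'a) \<Rightarrow> ('i \<Rightarrow> 'm) \<Rightarrow> 'm" where
  "lin_comb M S c y = (\<Oplus>\<^bsub>M\<^esub>l \<in> S. c l \<odot>\<^bsub>M\<^esub> y l)"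

context module begin

lemma lin_comb_term_funcset:
  "c \<in> S \<rightarrow> carrier R \<Longrightarrow> y \<in> S \<rightarrow> carrier M \<Longrightarrow> (\<lambda>l. c l \<odot>\<^bsub>M\<^esub> y l) \<in> S \<rightarrow> carrier M"
  by (simp add: Pi_iff)

lemma lin_comb_closed:
  "c \<in> S \<rightarrow> carrier R \<Longrightarrow> y \<in> S \<rightarrow> carrier M \<Longrightarrow> lin_comb M S c y \<in> carrier M"
  unfolding lin_comb_def by (rule M.finsum_closed[OF lin_comb_term_funcset])

lemma lin_comb_empty [simp]: "lin_comb M {} c y = \<zero>\<^bsub>M\<^esub>"
  by (simp add: lin_comb_def)

lemma lin_comb_insert:
  assumes "finite S" "i \<notin> S" "c \<in> insert i S \<rightarrow> carrier R" "y \<in> insert i S \<rightarrow> carrier M"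
  shows "lin_comb M (insert i S) c y = c i \<odot>\<^bsub>M\<^esub> y i \<oplus>\<^bsub>M\<^esub> lin_comb M S c y"
  unfolding lin_comb_def using assms by (intro M.finsum_insert) (auto simp: Pi_iff)

lemma lin_comb_remove:
  assumes "finite S" "i \<in> S" "c \<in> S \<rightarrow> carrier R" "y \<in> S \<rightarrow> carrier M"
  shows "lin_comb M S c y = c i \<odot>\<^bsub>M\<^esub> y i \<oplus>\<^bsub>M\<^esub> lin_comb M (S - {i}) c y"
  using lin_comb_insert[of "S - {i}" i c y] assms by (simp add: insert_absorb)

lemma lin_comb_cong:
  assumes "\<And>l. l \<in> S \<Longrightarrow> c l = d l" "\<And>l. l \<in> S \<Longrightarrow> y l = z l" "d \<in> S \<rightarrow> carrier R" "z \<in> S \<rightarrow> carrier M"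
  shows "lin_comb M S c y = lin_comb M S d z"
  unfolding lin_comb_def using assms
  by (intro M.finsum_cong') (auto simp: Pi_iff)

lemma lin_comb_add:
  assumes "c \<in> S \<rightarrow> carrier R" "d \<in> S \<rightarrow> carrier R" "y \<in> S \<rightarrow> carrier M"
  shows "lin_comb M S (\<lambda>l. c l \<oplus> d l) y = lin_comb M S c y \<oplus>\<^bsub>M\<^esub> lin_comb M S d y"
proof -
  have "lin_comb M S (\<lambda>l. c l \<oplus> d l) y = (\<Oplus>\<^bsub>M\<^esub>l\<in>S. c l \<odot>\<^bsub>M\<^esub> y l \<oplus>\<^bsub>M\<^esub> d l \<odot>\<^bsub>M\<^esub> y l)"
    unfolding lin_comb_def using assms
    by (intro M.finsum_cong') (auto simp: Pi_iff smult_l_distr)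
  also have "\<dots> = lin_comb M S c y \<oplus>\<^bsub>M\<^esub> lin_comb M S d y"
    unfolding lin_comb_def using assms by (intro M.finsum_addf) (auto simp: Pi_iff)
  finally show ?thesis .
qed

lemma lin_comb_add_right:
  assumes "c \<in> S \<rightarrow> carrier R" "y \<in> S \<rightarrow> carrier M" "z \<in> S \<rightarrow> carrier M"
  shows "lin_comb M S c (\<lambda>l. y l \<oplus>\<^bsub>M\<^esub> z l) = lin_comb M S c y \<oplus>\<^bsub>M\<^esub> lin_comb M S c z"
proof -
  have "lin_comb M S c (\<lambda>l. y l \<oplus>\<^bsub>M\<^esub> z l) = (\<Oplus>\<^bsub>M\<^esub>l\<in>S. c l \<odot>\<^bsub>M\<^esub> y l \<oplus>\<^bsub>M\<^esub> c l \<odot>\<^bsub>M\<^esub> z l)"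
    unfolding lin_comb_def using assms
    by (intro M.finsum_cong') (auto simp: Pi_iff smult_r_distr)
  also have "\<dots> = lin_comb M S c y \<oplus>\<^bsub>M\<^esub> lin_comb M S c z"
    unfolding lin_comb_def using assms by (intro M.finsum_addf) (auto simp: Pi_iff)
  finally show ?thesis .
qed

lemma lin_comb_smult:
  assumes "finite S" "a \<in> carrier R" "c \<in> S \<rightarrow> carrier R" "y \<in> S \<rightarrow> carrier M"
  shows "lin_comb M S (\<lambda>l. a \<otimes> c l) y = a \<odot>\<^bsub>M\<^esub> lin_comb M S c y"
proof -
  have "lin_comb M S (\<lambda>l. a \<otimes> c l) y = (\<Oplus>\<^bsub>M\<^esub>l\<in>S. a \<odot>\<^bsub>M\<^esub> (c l \<odot>\<^bsub>M\<^esub> y l))"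
    unfolding lin_comb_def using assms
    by (intro M.finsum_cong') (auto simp: Pi_iff smult_assoc1)
  then show ?thesis
    unfolding lin_comb_def using assms by (simp add: finsum_smult_ldistr Pi_iff)
qed

lemma lin_comb_diff:
  assumes "finite S" "c \<in> S \<rightarrow> carrier R" "d \<in> S \<rightarrow> carrier R" "y \<in> S \<rightarrow> carrier M"
  shows "lin_comb M S (\<lambda>l. c l \<ominus>\<^bsub>R\<^esub> d l) y = lin_comb M S c y \<ominus>\<^bsub>M\<^esub> lin_comb M S d y"
proof -
  have cong: "lin_comb M S (\<lambda>l. c l \<ominus>\<^bsub>R\<^esub> d l) y = lin_comb M S (\<lambda>l. c l \<oplus> (\<ominus> \<one>) \<otimes> d l) y"
    using assms by (intro lin_comb_cong) (auto simp: Pi_iff R.minus_eq R.l_minus)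
  have d: "(\<lambda>l. (\<ominus> \<one>) \<otimes> d l) \<in> S \<rightarrow> carrier R"
    using assms by (auto simp: Pi_iff)
  show ?thesis
    unfolding cong lin_comb_add[OF assms(2) d assms(4)]
    using assms lin_comb_smult[OF assms(1) _ assms(3,4), of "\<ominus> \<one>"] lin_comb_closed[OF assms(3,4)]
    by (simp add: smult_l_minus M.minus_eq)
qed

lemma lin_comb_diff_right:
  assumes "c \<in> S \<rightarrow> carrier R" "y \<in> S \<rightarrow> carrier M" "z \<in> S \<rightarrow> carrier M"
  shows "lin_comb M S c (\<lambda>l. y l \<ominus>\<^bsub>M\<^esub> z l) = lin_comb M S c y \<ominus>\<^bsub>M\<^esub> lin_comb M S c z"
proof -
  have "lin_comb M S c y = lin_comb M S c (\<lambda>l. (y l \<ominus>\<^bsub>M\<^esub> z l) \<oplus>\<^bsub>M\<^esub> z l)"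
    using assms by (intro lin_comb_cong) (auto simp: Pi_iff M.minus_eq M.a_assoc M.l_neg)
  also have "\<dots> = lin_comb M S c (\<lambda>l. y l \<ominus>\<^bsub>M\<^esub> z l) \<oplus>\<^bsub>M\<^esub> lin_comb M S c z"
    using assms by (intro lin_comb_add_right) (auto simp: Pi_iff)
  finally have eq: "lin_comb M S c y = lin_comb M S c (\<lambda>l. y l \<ominus>\<^bsub>M\<^esub> z l) \<oplus>\<^bsub>M\<^esub> lin_comb M S c z" .
  have "lin_comb M S c (\<lambda>l. y l \<ominus>\<^bsub>M\<^esub> z l) \<in> carrier M" "lin_comb M S c z \<in> carrier M"
    using assms by (auto intro!: lin_comb_closed simp: Pi_iff)
  then show ?thesis
    unfolding eq by (simp add: M.minus_eq M.a_assoc M.r_neg)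
qed

lemma lin_comb_in_submodule:
  assumes N: "submodule N R M" and "finite S" "\<And>l. l \<in> S \<Longrightarrow> c l \<odot>\<^bsub>M\<^esub> y l \<in> N"
  shows "lin_comb M S c y \<in> N"
  using assms(2,3)
proof (induction S)
  case empty
  then show ?case by (simp add: submodule_zero[OF N])
next
  case (insert i S)
  have "\<And>l. l \<in> insert i S \<Longrightarrow> c l \<odot>\<^bsub>M\<^esub> y l \<in> carrier M"
    using insert.prems submoduleE(1)[OF N] by blast
  then have "lin_comb M (insert i S) c y = c i \<odot>\<^bsub>M\<^esub> y i \<oplus>\<^bsub>M\<^esub> lin_comb M S c y"
    unfolding lin_comb_def using insert.hyps by (intro M.finsum_insert) auto
  then show ?case
    using insert submoduleE(5)[OF N] by simp
qed

lemma lin_comb_zero_left: "finite S \<Longrightarrow> y \<in> S \<rightarrow> carrier M \<Longrightarrow> lin_comb M S (\<lambda>_. \<zero>) y = \<zero>\<^bsub>M\<^esub>"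
  unfolding lin_comb_def by (intro M.add.finprod_one_eqI) (auto simp: Pi_iff)

lemma lin_comb_delta:
  assumes "finite S" "i \<in> S" "a \<in> carrier R" "y \<in> S \<rightarrow> carrier M"
  shows "lin_comb M S (\<lambda>l. if l = i then a else \<zero>) y = a \<odot>\<^bsub>M\<^esub> y i"
proof -
  have "lin_comb M (S - {i}) (\<lambda>l. if l = i then a else \<zero>) y = lin_comb M (S - {i}) (\<lambda>_. \<zero>) y"
    using assms by (intro lin_comb_cong) auto
  also have "\<dots> = \<zero>\<^bsub>M\<^esub>"
    using assms by (intro lin_comb_zero_left) auto
  finally show ?thesis
    using assms by (subst lin_comb_remove[of S i]) (auto simp: Pi_iff)
qed

lemma smult_finsum_left:
  assumes "finite T" "c \<in> T \<rightarrow> carrier R" "d \<in> T \<rightarrow> carrier R" "y \<in> carrier M"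
  shows "(\<Oplus>l\<in>T. c l \<otimes> d l) \<odot>\<^bsub>M\<^esub> y = lin_comb M T c (\<lambda>l. d l \<odot>\<^bsub>M\<^esub> y)"
  using assms(1-3)
proof (induction T)
  case empty
  then show ?case using assms(4) by simp
next
  case (insert i T)
  have "(\<Oplus>l\<in>insert i T. c l \<otimes> d l) = c i \<otimes> d i \<oplus> (\<Oplus>l\<in>T. c l \<otimes> d l)"
    using insert by (intro R.finsum_insert) (auto simp: Pi_iff)
  moreover have "(\<Oplus>l\<in>T. c l \<otimes> d l) \<in> carrier R"
    using insert.prems by (intro R.finsum_closed) (auto simp: Pi_iff)
  moreover have "lin_comb M (insert i T) c (\<lambda>l. d l \<odot>\<^bsub>M\<^esub> y)
      = c i \<odot>\<^bsub>M\<^esub> (d i \<odot>\<^bsub>M\<^esub> y) \<oplus>\<^bsub>M\<^esub> lin_comb M T c (\<lambda>l. d l \<odot>\<^bsub>M\<^esub> y)"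
    using insert assms(4) by (intro lin_comb_insert) (auto simp: Pi_iff)
  ultimately show ?case
    using insert assms(4) by (simp add: smult_l_distr smult_assoc1 Pi_iff)
qed

text \<open>Substituting one family of generators into another multiplies the coefficient row by a
  matrix.\<close>

lemma lin_comb_lin_comb:
  assumes "finite T" "finite S" "c \<in> T \<rightarrow> carrier R" "\<And>k. k \<in> T \<Longrightarrow> B k \<in> S \<rightarrow> carrier R"
    "y \<in> S \<rightarrow> carrier M"
  shows "lin_comb M T c (\<lambda>k. lin_comb M S (B k) y) = lin_comb M S (\<lambda>i. \<Oplus>k\<in>T. c k \<otimes> B k i) y"
  using assms(1,3,4)
proof (induction T)
  case empty
  then show ?case
    using lin_comb_zero_left[OF assms(2,5)] by simp
next
  case (insert t T)
  have B: "\<And>k i. k \<in> insert t T \<Longrightarrow> i \<in> S \<Longrightarrow> B k i \<in> carrier R"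
    and c: "\<And>k. k \<in> insert t T \<Longrightarrow> c k \<in> carrier R"
    using insert.prems by (auto simp: Pi_iff)
  have "lin_comb M (insert t T) c (\<lambda>k. lin_comb M S (B k) y)
      = c t \<odot>\<^bsub>M\<^esub> lin_comb M S (B t) y \<oplus>\<^bsub>M\<^esub> lin_comb M T c (\<lambda>k. lin_comb M S (B k) y)"
    using insert assms(5) by (intro lin_comb_insert) (auto intro!: lin_comb_closed)
  also have "lin_comb M T c (\<lambda>k. lin_comb M S (B k) y) = lin_comb M S (\<lambda>i. \<Oplus>k\<in>T. c k \<otimes> B k i) y"
    using insert by simp
  also have "c t \<odot>\<^bsub>M\<^esub> lin_comb M S (B t) y = lin_comb M S (\<lambda>i. c t \<otimes> B t i) y"
    using insert.prems assms(2,5) by (intro lin_comb_smult[symmetric]) (auto simp: Pi_iff)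
  also have "lin_comb M S (\<lambda>i. c t \<otimes> B t i) y \<oplus>\<^bsub>M\<^esub> lin_comb M S (\<lambda>i. \<Oplus>k\<in>T. c k \<otimes> B k i) y
      = lin_comb M S (\<lambda>i. c t \<otimes> B t i \<oplus> (\<Oplus>k\<in>T. c k \<otimes> B k i)) y"
    using B c assms(5) by (intro lin_comb_add[symmetric]) (auto intro!: R.finsum_closed)
  also have "\<dots> = lin_comb M S (\<lambda>i. \<Oplus>k\<in>insert t T. c k \<otimes> B k i) y"
  proof (intro lin_comb_cong)
    fix i assume "i \<in> S"
    then show "c t \<otimes> B t i \<oplus> (\<Oplus>k\<in>T. c k \<otimes> B k i) = (\<Oplus>k\<in>insert t T. c k \<otimes> B k i)"
      using insert.hyps B c by (intro R.finsum_insert[symmetric]) auto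
  qed (use B c assms(5) in \<open>auto intro!: R.finsum_closed\<close>)
  finally show ?case .
qed

end

context cring begin

text \<open>Transfers facts about \<open>lin_comb\<close> to sums of products in \<open>R\<close>;
  the next but one lemma, associativity of matrix multiplication, is obtained in this way.\<close>

lemma lin_comb_regular_module:
  assumes "finite S" "c \<in> S \<rightarrow> carrier R" "d \<in> S \<rightarrow> carrier R"
  shows "lin_comb (regular_module R) S c d = (\<Oplus>l\<in>S. c l \<otimes> d l)"
  using assms
proof (induction S)
  case empty
  interpret M: module R "regular_module R" by (rule module_regular_module)
  have "\<zero>\<^bsub>regular_module R\<^esub> = \<zero>"
    by (simp add: regular_module_def)
  then show ?case by simp
next
  case (insert i S)
  interpret M: module R "regular_module R" by (rule module_regular_module)
  have "lin_comb (regular_module R) (insert i S) c d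
      = c i \<otimes> d i \<oplus> lin_comb (regular_module R) S c d"
    using M.lin_comb_insert[OF insert.hyps insert.prems(1), of d] insert.prems(2)
    by (simp add: regular_module_def)
  also have "\<dots> = (\<Oplus>l\<in>insert i S. c l \<otimes> d l)"
    using insert by (subst finsum_insert) (auto simp: Pi_iff)
  finally show ?case .
qed

lemma finsum_mult_closed:
  "c \<in> S \<rightarrow> carrier R \<Longrightarrow> d \<in> S \<rightarrow> carrier R \<Longrightarrow> (\<Oplus>l\<in>S. c l \<otimes> d l) \<in> carrier R"
  by (intro finsum_closed) (auto simp: Pi_iff)

lemma finsum_finsum_mult:
  assumes T: "finite T" and S: "finite S" and c: "c \<in> T \<rightarrow> carrier R"
    and B: "\<And>k. k \<in> T \<Longrightarrow> B k \<in> S \<rightarrow> carrier R" and d: "d \<in> S \<rightarrow> carrier R"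
  shows "(\<Oplus>k\<in>T. c k \<otimes> (\<Oplus>i\<in>S. B k i \<otimes> d i)) = (\<Oplus>i\<in>S. (\<Oplus>k\<in>T. c k \<otimes> B k i) \<otimes> d i)"
proof -
  let ?M = "regular_module R"
  interpret M: module R ?M by (rule module_regular_module)
  have carr: "carrier ?M = carrier R" by (simp add: regular_module_def)
  have col: "(\<lambda>k. B k i) \<in> T \<rightarrow> carrier R" if "i \<in> S" for i
    using B that by (auto simp: Pi_iff)
  have inner: "(\<lambda>k. \<Oplus>i\<in>S. B k i \<otimes> d i) \<in> T \<rightarrow> carrier R"
    using B d by (auto intro!: finsum_mult_closed)
  have "(\<Oplus>k\<in>T. c k \<otimes> (\<Oplus>i\<in>S. B k i \<otimes> d i)) = lin_comb ?M T c (\<lambda>k. \<Oplus>i\<in>S. B k i \<otimes> d i)"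
    by (rule lin_comb_regular_module[OF T c inner, symmetric])
  also have "\<dots> = lin_comb ?M T c (\<lambda>k. lin_comb ?M S (B k) d)"
    using c B d S inner
    by (intro M.lin_comb_cong) (auto simp: lin_comb_regular_module carr intro!: finsum_mult_closed)
  also have "\<dots> = lin_comb ?M S (\<lambda>i. \<Oplus>k\<in>T. c k \<otimes> B k i) d"
    using d by (intro M.lin_comb_lin_comb T S c B) (simp_all add: carr)
  also have "\<dots> = (\<Oplus>i\<in>S. (\<Oplus>k\<in>T. c k \<otimes> B k i) \<otimes> d i)"
    using c col d S by (intro lin_comb_regular_module) (auto intro!: finsum_mult_closed)
  finally show ?thesis .
qed

lemma finsum_mult_diff_right:
  assumes c: "c \<in> S \<rightarrow> carrier R" and y: "y \<in> S \<rightarrow> carrier R" and z: "z \<in> S \<rightarrow> carrier R"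
  shows "(\<Oplus>l\<in>S. c l \<otimes> (y l \<ominus> z l)) = (\<Oplus>l\<in>S. c l \<otimes> y l) \<ominus> (\<Oplus>l\<in>S. c l \<otimes> z l)"
proof -
  have yz: "(\<lambda>l. y l \<ominus> z l) \<in> S \<rightarrow> carrier R"
    using y z by auto
  have split: "c l \<otimes> y l = c l \<otimes> (y l \<ominus> z l) \<oplus> c l \<otimes> z l" if "l \<in> S" for l
  proof -
    have "c l \<in> carrier R" "y l \<in> carrier R" "z l \<in> carrier R"
      using that c y z by auto
    then show ?thesis by algebra
  qed
  have "(\<Oplus>l\<in>S. c l \<otimes> y l) = (\<Oplus>l\<in>S. c l \<otimes> (y l \<ominus> z l) \<oplus> c l \<otimes> z l)"
    using c y z yz split by (intro finsum_cong') (auto simp: Pi_iff)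
  also have "\<dots> = (\<Oplus>l\<in>S. c l \<otimes> (y l \<ominus> z l)) \<oplus> (\<Oplus>l\<in>S. c l \<otimes> z l)"
    using c yz z by (intro finsum_addf) (auto simp: Pi_iff)
  finally show ?thesis
    using finsum_mult_closed[OF c yz] finsum_mult_closed[OF c z]
    by (simp add: minus_eq a_assoc r_neg)
qed

text \<open>\<open>chain_ideal\<close> makes divisibility modulo \<open>I\<close> total, so a finite
  set has an element that divides all others: the later pivot. In the induction the new element is
  compared with the old divisor only.\<close>

lemma chain_ideal_finite_gcd:
  assumes I: "ideal I R" and chain: "chain_ideal R I" and "finite X" "X \<noteq> {}" "X \<subseteq> carrier R"
  shows "\<exists>d\<in>X. \<forall>x\<in>X. \<exists>q\<in>carrier R. x \<ominus> q \<otimes> d \<in> I"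
  using assms(3-5)
proof (induction X rule: finite_ne_induct)
  case (singleton x)
  then have "x \<ominus> \<one> \<otimes> x = \<zero>"
    by (simp add: minus_eq r_neg)
  then show ?case
    using ideal_zero[OF I] by (metis one_closed singleton_iff)
next
  case (insert x X)
  then obtain d where d: "d \<in> X" "\<And>y. y \<in> X \<Longrightarrow> \<exists>q\<in>carrier R. y \<ominus> q \<otimes> d \<in> I"
    by auto
  have dR: "d \<in> carrier R" and xR: "x \<in> carrier R"
    using d insert.prems by auto
  have self: "\<exists>q\<in>carrier R. u \<ominus> q \<otimes> u \<in> I" if "u \<in> carrier R" for u
    using that ideal_zero[OF I] by (intro bexI[of _ \<one>]) (simp_all add: minus_eq r_neg)
  obtain c where c: "c \<in> carrier R" "x \<ominus> c \<otimes> d \<in> I \<or> d \<ominus> c \<otimes> x \<in> I"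
    using chain xR dR unfolding chain_ideal_def by blast
  from c(2) show ?case
  proof
    assume "x \<ominus> c \<otimes> d \<in> I"
    then show ?thesis
      using d c(1) by (intro bexI[of _ d]) auto
  next
    assume dx: "d \<ominus> c \<otimes> x \<in> I"
    have "\<exists>q\<in>carrier R. y \<ominus> q \<otimes> x \<in> I" if "y \<in> X" for y
    proof -
      obtain q where q: "q \<in> carrier R" "y \<ominus> q \<otimes> d \<in> I"
        using d(2)[OF \<open>y \<in> X\<close>] by blast
      have yR: "y \<in> carrier R"
        using \<open>y \<in> X\<close> insert.prems by auto
      have "y \<ominus> (q \<otimes> c) \<otimes> x = (y \<ominus> q \<otimes> d) \<oplus> q \<otimes> (d \<ominus> c \<otimes> x)"
        using yR q(1) c(1) dR xR by algebra
      then have "y \<ominus> (q \<otimes> c) \<otimes> x \<in> I"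
        using ideal_add[OF I q(2) ideal_mult_left[OF I dx q(1)]] by simp
      then show ?thesis
        using q(1) c(1) by blast
    qed
    then show ?thesis
      using self[OF xR] by (intro bexI[of _ x]) auto
  qed
qed

end

section \<open>Diagonalization of relations modulo a chain ideal\<close>

context module begin

text \<open>Gaussian elimination over a chain ring, with the relation vectors \<open>r j\<close> read modulo \<open>I\<close>: the
  pivot divides all coefficients of all relations, so it can be cleared by changing one generator.\<close>

lemma diagonalize:
  assumes I: "ideal I R" and chain: "chain_ideal R I" and N: "submodule N R M"
    and IN: "\<And>i z. i \<in> I \<Longrightarrow> z \<in> carrier M \<Longrightarrow> i \<odot>\<^bsub>M\<^esub> z \<in> N"
    and "finite S" "y \<in> S \<rightarrow> carrier M"
    and "\<And>j. j < k \<Longrightarrow> r j \<in> S \<rightarrow> carrier R" "\<And>j. j < k \<Longrightarrow> lin_comb M S (r j) y \<in> N"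
    and "\<And>c. c \<in> S \<rightarrow> carrier R \<Longrightarrow> lin_comb M S c y \<in> N \<Longrightarrow>
      \<exists>s\<in>{..<k} \<rightarrow> carrier R. \<forall>l\<in>S. c l \<ominus>\<^bsub>R\<^esub> (\<Oplus>j\<in>{..<k::nat}. s j \<otimes> r j l) \<in> I"
  shows "\<exists>z\<in>S \<rightarrow> carrier M.
    (\<forall>c\<in>S \<rightarrow> carrier R. \<exists>d\<in>S \<rightarrow> carrier R. lin_comb M S c y = lin_comb M S d z) \<and>
    (\<forall>c\<in>S \<rightarrow> carrier R. \<exists>d\<in>S \<rightarrow> carrier R. lin_comb M S c z = lin_comb M S d y) \<and>
    (\<forall>c\<in>S \<rightarrow> carrier R. lin_comb M S c z \<in> N \<longrightarrow> (\<forall>l\<in>S. c l \<odot>\<^bsub>M\<^esub> z l \<in> N))"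
  using assms(5-)
proof (induction S arbitrary: r rule: finite_psubset_induct)
  case (psubset S)
  note S = \<open>finite S\<close> and y = psubset.prems(1) and r = psubset.prems(2) and rN = psubset.prems(3)
    and gen = psubset.prems(4)
  have rR: "r j l \<in> carrier R" if "j < k" "l \<in> S" for j l
    using r that by auto
  \<comment> \<open>The \<open>r j\<close> generate all relations modulo \<open>I\<close>, so an
    ideal above \<open>I\<close> that contains their coefficients contains those of every
    relation.\<close>
  have in_ideal: "c l \<in> J" if "ideal J R" "I \<subseteq> J" "\<And>j. j < k \<Longrightarrow> r j l \<in> J" "l \<in> S"
      "c \<in> S \<rightarrow> carrier R" "lin_comb M S c y \<in> N" for c l J
  proof -
    obtain s where s: "s \<in> {..<k} \<rightarrow> carrier R" "\<forall>l\<in>S. c l \<ominus>\<^bsub>R\<^esub> (\<Oplus>j\<in>{..<k}. s j \<otimes> r j l) \<in> I"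
      using gen[OF \<open>c \<in> S \<rightarrow> carrier R\<close> \<open>lin_comb M S c y \<in> N\<close>] by blast
    have "(\<Oplus>j\<in>{..<k}. s j \<otimes> r j l) \<in> J"
      using that(3) s(1) by (intro R.ideal_finsum that(1) R.ideal_mult_left) auto
    then show ?thesis
      using R.ideal_cong[OF that(1), of "c l" "\<Oplus>j\<in>{..<k}. s j \<otimes> r j l"] s(2) that
        R.ideal_in_carrier[OF that(1)] by auto
  qed
  show ?case
  proof (cases "\<forall>j<k. \<forall>l\<in>S. r j l \<in> I")
    case True
    have "\<forall>l\<in>S. c l \<odot>\<^bsub>M\<^esub> y l \<in> N" if "c \<in> S \<rightarrow> carrier R" "lin_comb M S c y \<in> N" for c
      using in_ideal[OF I subset_refl _ _ that] True y by (auto intro!: IN simp: Pi_iff)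
    then show ?thesis
      using y by (intro bexI[of _ y]) auto
  next
    case False
    define X where "X = (\<lambda>(j, l). r j l) ` ({..<k} \<times> S)"
    have "finite X" "X \<noteq> {}" "X \<subseteq> carrier R"
      using S False rR by (auto simp: X_def)
    from R.chain_ideal_finite_gcd[OF I chain this]
    obtain j0 p where j0: "j0 < k" and p: "p \<in> S"
      and div: "\<And>j l. j < k \<Longrightarrow> l \<in> S \<Longrightarrow> \<exists>q\<in>carrier R. r j l \<ominus>\<^bsub>R\<^esub> q \<otimes> r j0 p \<in> I"
      unfolding X_def by auto
    define d where "d = r j0 p"
    have d: "d \<in> carrier R"
      using rR j0 p by (simp add: d_def)
    have "\<exists>q. \<forall>l\<in>S. q l \<in> carrier R \<and> r j0 l \<ominus>\<^bsub>R\<^esub> q l \<otimes> d \<in> I"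
      using div[OF j0] unfolding d_def by metis
    then obtain q0 where q0: "\<And>l. l \<in> S \<Longrightarrow> q0 l \<in> carrier R \<and> r j0 l \<ominus>\<^bsub>R\<^esub> q0 l \<otimes> d \<in> I"
      by blast
    \<comment> \<open>Divisibility determines the quotient at the pivot only up to what
      \<open>d\<close> multiplies into \<open>I\<close>. Setting it to exactly 1 makes the passage
      from \<open>y p\<close> to \<open>yp\<close> an invertible change of generators.\<close>
    define q where "q = q0(p := \<one>)"
    have qR: "q \<in> S \<rightarrow> carrier R" and qp: "q p = \<one>"
      using q0 by (auto simp: q_def)
    have q: "r j0 l \<ominus>\<^bsub>R\<^esub> q l \<otimes> d \<in> I" if "l \<in> S" for l
      using q0[OF that] R.ideal_zero[OF I] d by (auto simp: q_def d_def R.minus_eq R.r_neg)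
    \<comment> \<open>\<open>D\<close> controls the new generator from both sides: every relation
      has its coefficients in \<open>D\<close>, and \<open>D\<close> multiplies \<open>yp\<close>
      into \<open>N\<close>. So \<open>yp\<close> spans a copy of \<open>R / D\<close> modulo
      \<open>N\<close>.\<close>
    define D where "D = add_multiples R I (carrier R) d"
    have D: "ideal D R" and ID: "I \<subseteq> D"
      unfolding D_def using R.ideal_add_multiples[OF I R.oneideal d]
        R.subset_add_multiples[OF I R.oneideal d] by auto
    have rD: "r j l \<in> D" if j: "j < k" and l: "l \<in> S" for j l
    proof -
      obtain t where t: "t \<in> carrier R" "r j l \<ominus>\<^bsub>R\<^esub> t \<otimes> d \<in> I"
        using div[OF j l] unfolding d_def by blast
      have "t \<otimes> d \<in> D"
        unfolding D_def using R.multiple_in_add_multiples[OF I R.oneideal d t(1)] .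
      then show ?thesis
        using R.ideal_cong[OF D rR[OF j l] _ _ \<open>t \<otimes> d \<in> D\<close>] t d ID by auto
    qed
    define S' where "S' = S - {p}"
    have S': "finite S'" "S' \<subset> S" "S' \<subseteq> S" "p \<notin> S'" "insert p S' = S"
      using S p by (auto simp: S'_def)
    have yS': "y \<in> S' \<rightarrow> carrier M" and qS': "q \<in> S' \<rightarrow> carrier R"
      using y qR S' by auto
    have split_y: "lin_comb M S c v = c p \<odot>\<^bsub>M\<^esub> v p \<oplus>\<^bsub>M\<^esub> lin_comb M S' c v"
      if "c \<in> S \<rightarrow> carrier R" "v \<in> S \<rightarrow> carrier M" for c v
      unfolding S'_def using lin_comb_remove[OF S p that] .
    \<comment> \<open>Up to coefficients in \<open>I\<close>, the pivot relation is \<open>d\<close>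
      times this combination, so \<open>d\<close> multiplies it into \<open>N\<close>.\<close>
    define yp where "yp = lin_comb M S q y"
    have yp: "yp \<in> carrier M"
      unfolding yp_def using lin_comb_closed[OF qR y] .
    have change: "lin_comb M S c y = c p \<odot>\<^bsub>M\<^esub> yp \<oplus>\<^bsub>M\<^esub> lin_comb M S' (\<lambda>l. c l \<ominus>\<^bsub>R\<^esub> c p \<otimes> q l) y"
      if c: "c \<in> S \<rightarrow> carrier R" for c
    proof -
      have cp: "c p \<in> carrier R" and cS': "c \<in> S' \<rightarrow> carrier R"
        using c p S' by auto
      have "lin_comb M S' (\<lambda>l. c l \<ominus>\<^bsub>R\<^esub> c p \<otimes> q l) y
          = lin_comb M S' c y \<ominus>\<^bsub>M\<^esub> lin_comb M S' (\<lambda>l. c p \<otimes> q l) y"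
        using cS' cp qS' yS' S' by (intro lin_comb_diff) auto
      also have "lin_comb M S' (\<lambda>l. c p \<otimes> q l) y = c p \<odot>\<^bsub>M\<^esub> lin_comb M S' q y"
        by (intro lin_comb_smult S' cp qS' yS')
      finally have 1: "lin_comb M S' (\<lambda>l. c l \<ominus>\<^bsub>R\<^esub> c p \<otimes> q l) y
          = lin_comb M S' c y \<ominus>\<^bsub>M\<^esub> c p \<odot>\<^bsub>M\<^esub> lin_comb M S' q y" .
      have ypeq: "yp = y p \<oplus>\<^bsub>M\<^esub> lin_comb M S' q y"
        unfolding yp_def using split_y[OF qR y] qp funcset_mem[OF y p] by simp
      define u v w where uvw: "u = lin_comb M S' c y" "v = c p \<odot>\<^bsub>M\<^esub> lin_comb M S' q y" "w = c p \<odot>\<^bsub>M\<^esub> y p"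
      have qc: "lin_comb M S' q y \<in> carrier M" and ypM: "y p \<in> carrier M"
        using lin_comb_closed[OF qS' yS'] y p by auto
      have c': "u \<in> carrier M" "v \<in> carrier M" "w \<in> carrier M"
        using lin_comb_closed[OF cS' yS'] qc ypM cp by (auto simp: uvw)
      have "c p \<odot>\<^bsub>M\<^esub> yp = w \<oplus>\<^bsub>M\<^esub> v"
        unfolding ypeq uvw using cp qc ypM by (intro smult_r_distr)
      moreover have "lin_comb M S c y = w \<oplus>\<^bsub>M\<^esub> u"
        unfolding uvw by (rule split_y[OF c y])
      moreover have "w \<oplus>\<^bsub>M\<^esub> u = (w \<oplus>\<^bsub>M\<^esub> v) \<oplus>\<^bsub>M\<^esub> (u \<ominus>\<^bsub>M\<^esub> v)"
        using c' by algebra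
      ultimately show ?thesis
        using 1 by (simp add: uvw)
    qed
    have d_yp: "d \<odot>\<^bsub>M\<^esub> yp \<in> N"
    proof -
      have rj0: "r j0 \<in> S \<rightarrow> carrier R"
        using r j0 by auto
      have "lin_comb M S (\<lambda>l. r j0 l \<ominus>\<^bsub>R\<^esub> d \<otimes> q l) y = lin_comb M S (r j0) y \<ominus>\<^bsub>M\<^esub> lin_comb M S (\<lambda>l. d \<otimes> q l) y"
        using rj0 d qR y S by (intro lin_comb_diff) auto
      also have "lin_comb M S (\<lambda>l. d \<otimes> q l) y = d \<odot>\<^bsub>M\<^esub> yp"
        unfolding yp_def by (intro lin_comb_smult S d qR y)
      finally have eq: "lin_comb M S (\<lambda>l. r j0 l \<ominus>\<^bsub>R\<^esub> d \<otimes> q l) y = lin_comb M S (r j0) y \<ominus>\<^bsub>M\<^esub> d \<odot>\<^bsub>M\<^esub> yp" .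
      have "lin_comb M S (\<lambda>l. r j0 l \<ominus>\<^bsub>R\<^esub> d \<otimes> q l) y \<in> N"
      proof (intro lin_comb_in_submodule[OF N S] IN)
        fix l assume l: "l \<in> S"
        then have "d \<otimes> q l = q l \<otimes> d"
          using d qR by (auto intro: R.m_comm)
        then show "r j0 l \<ominus>\<^bsub>R\<^esub> d \<otimes> q l \<in> I"
          using q[OF l] by simp
        show "y l \<in> carrier M" using y l by auto
      qed
      then have *: "lin_comb M S (r j0) y \<ominus>\<^bsub>M\<^esub> d \<odot>\<^bsub>M\<^esub> yp \<in> N"
        by (simp add: eq)
      define u v where uv: "u = lin_comb M S (r j0) y" "v = d \<odot>\<^bsub>M\<^esub> yp"
      have "u \<in> carrier M" "v \<in> carrier M"
        unfolding uv using lin_comb_closed[OF rj0 y] d yp by auto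
      then have "v = u \<ominus>\<^bsub>M\<^esub> (u \<ominus>\<^bsub>M\<^esub> v)"
        by algebra
      then show ?thesis
        using submodule_diff[OF N rN[OF j0] *] by (simp add: uv)
    qed
    have D_yp: "t \<odot>\<^bsub>M\<^esub> yp \<in> N" if t: "t \<in> D" for t
    proof -
      obtain i x where ix: "i \<in> I" "x \<in> carrier R" "t = i \<oplus> x \<otimes> d"
        using t unfolding D_def add_multiples_def by blast
      have "t \<odot>\<^bsub>M\<^esub> yp = i \<odot>\<^bsub>M\<^esub> yp \<oplus>\<^bsub>M\<^esub> x \<odot>\<^bsub>M\<^esub> (d \<odot>\<^bsub>M\<^esub> yp)"
        unfolding ix(3) using ix d yp R.ideal_in_carrier[OF I ix(1)]
        by (simp add: smult_l_distr smult_assoc1)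
      then show ?thesis
        using submoduleE(5)[OF N IN[OF ix(1) yp] submoduleE(4)[OF N ix(2) d_yp]] by simp
    qed
    \<comment> \<open>The relations in terms of \<open>yp\<close> and the remaining
      \<open>y l\<close>. The coefficient of \<open>yp\<close> is \<open>r j p\<close>, and its term
      is dropped because it lies in \<open>N\<close>.\<close>
    define r' where "r' j l = r j l \<ominus>\<^bsub>R\<^esub> r j p \<otimes> q l" for j l
    have r'R: "r' j \<in> S' \<rightarrow> carrier R" if "j < k" for j
      unfolding r'_def using rR[OF that] p S'(3) funcset_mem[OF qS']
      by (intro Pi_I R.minus_closed R.m_closed) (simp_all add: subset_iff)
    have r'N: "lin_comb M S' (r' j) y \<in> N" if j: "j < k" for j
    proof -
      define u v where uv: "u = r j p \<odot>\<^bsub>M\<^esub> yp" "v = lin_comb M S' (r' j) y"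
      have "u \<in> carrier M" "v \<in> carrier M"
        unfolding uv using lin_comb_closed[OF r'R[OF j] yS'] rR[OF j p] yp by auto
      then have "v = (u \<oplus>\<^bsub>M\<^esub> v) \<ominus>\<^bsub>M\<^esub> u"
        by algebra
      moreover have "u \<oplus>\<^bsub>M\<^esub> v \<in> N"
        using change[OF r[OF j]] rN[OF j] unfolding uv r'_def[abs_def] by simp
      moreover have "u \<in> N"
        unfolding uv by (rule D_yp[OF rD[OF j p]])
      ultimately show ?thesis
        using submodule_diff[OF N] uv by metis
    qed
    have gen': "\<exists>s\<in>{..<k} \<rightarrow> carrier R. \<forall>l\<in>S'. v l \<ominus>\<^bsub>R\<^esub> (\<Oplus>j\<in>{..<k}. s j \<otimes> r' j l) \<in> I"
      if v: "v \<in> S' \<rightarrow> carrier R" and vN: "lin_comb M S' v y \<in> N" for v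
    proof -
      \<comment> \<open>A relation among the remaining generators is one on \<open>S\<close> with
        coefficient 0 at \<open>p\<close>. Reading the generation hypothesis at \<open>p\<close>
        shows that the combination \<open>B\<close> of the pivot column lies in \<open>I\<close>, so
        the correction \<open>B q l\<close> is harmless.\<close>
      define c where "c = v(p := \<zero>)"
      have c: "c \<in> S \<rightarrow> carrier R"
        using v by (auto simp: c_def S'_def)
      have "lin_comb M S' c y = lin_comb M S' v y"
        using S' v yS' by (intro lin_comb_cong) (auto simp: c_def)
      then have "lin_comb M S c y = lin_comb M S' v y"
        using split_y[OF c y] funcset_mem[OF y p] lin_comb_closed[OF v yS'] by (simp add: c_def)
      then obtain s where s: "s \<in> {..<k} \<rightarrow> carrier R"
        "\<And>l. l \<in> S \<Longrightarrow> c l \<ominus>\<^bsub>R\<^esub> (\<Oplus>j\<in>{..<k}. s j \<otimes> r j l) \<in> I"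
        using gen[OF c] vN by auto
      have "v l \<ominus>\<^bsub>R\<^esub> (\<Oplus>j\<in>{..<k}. s j \<otimes> r' j l) \<in> I" if l: "l \<in> S'" for l
      proof -
        have lS: "l \<in> S" and lp: "l \<noteq> p"
          using l S' by auto
        define A B where AB: "A = (\<Oplus>j\<in>{..<k}. s j \<otimes> r j l)" "B = (\<Oplus>j\<in>{..<k}. s j \<otimes> r j p)"
        have ABR: "A \<in> carrier R" "B \<in> carrier R"
          unfolding AB using s(1) rR lS p by (auto intro!: R.finsum_closed)
        have sR: "s j \<in> carrier R" if "j < k" for j
          using s(1) that by auto
        have ql: "q l \<in> carrier R" and vl: "v l \<in> carrier R"
          using qS' v l by auto
        have "(\<Oplus>j\<in>{..<k}. s j \<otimes> r' j l)
            = (\<Oplus>j\<in>{..<k}. s j \<otimes> r j l) \<ominus>\<^bsub>R\<^esub> (\<Oplus>j\<in>{..<k}. s j \<otimes> (r j p \<otimes> q l))"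
          unfolding r'_def using sR rR lS p ql by (intro R.finsum_mult_diff_right Pi_I) simp_all
        also have "(\<Oplus>j\<in>{..<k}. s j \<otimes> (r j p \<otimes> q l)) = (\<Oplus>j\<in>{..<k}. (s j \<otimes> r j p) \<otimes> q l)"
          using sR rR p ql by (intro R.finsum_cong') (auto simp: R.m_assoc)
        also have "\<dots> = B \<otimes> q l"
          unfolding AB using sR rR p ql by (intro R.finsum_ldistr[symmetric]) auto
        finally have sum: "(\<Oplus>j\<in>{..<k}. s j \<otimes> r' j l) = A \<ominus>\<^bsub>R\<^esub> B \<otimes> q l"
          by (simp add: AB)
        have "v l \<ominus>\<^bsub>R\<^esub> (A \<ominus>\<^bsub>R\<^esub> B \<otimes> q l) = (v l \<ominus>\<^bsub>R\<^esub> A) \<ominus>\<^bsub>R\<^esub> (\<zero> \<ominus>\<^bsub>R\<^esub> B) \<otimes> q l"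
          using vl ABR ql by algebra
        moreover have "v l \<ominus>\<^bsub>R\<^esub> A \<in> I" "\<zero> \<ominus>\<^bsub>R\<^esub> B \<in> I"
          using s(2)[OF lS] s(2)[OF p] lp by (simp_all add: AB c_def)
        ultimately show ?thesis
          unfolding sum using R.ideal_diff[OF I] R.ideal_mult_right[OF I _ ql] by metis
      qed
      then show ?thesis
        using s(1) by blast
    qed
    have "\<exists>z\<in>S' \<rightarrow> carrier M.
      (\<forall>c\<in>S' \<rightarrow> carrier R. \<exists>d\<in>S' \<rightarrow> carrier R. lin_comb M S' c y = lin_comb M S' d z) \<and>
      (\<forall>c\<in>S' \<rightarrow> carrier R. \<exists>d\<in>S' \<rightarrow> carrier R. lin_comb M S' c z = lin_comb M S' d y) \<and>
      (\<forall>c\<in>S' \<rightarrow> carrier R. lin_comb M S' c z \<in> N \<longrightarrow> (\<forall>l\<in>S'. c l \<odot>\<^bsub>M\<^esub> z l \<in> N))"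
      by (rule psubset.IH[OF S'(2) yS' r'R r'N gen'])
    then obtain z where z: "z \<in> S' \<rightarrow> carrier M"
      and zy: "\<And>c. c \<in> S' \<rightarrow> carrier R \<Longrightarrow> \<exists>d\<in>S' \<rightarrow> carrier R. lin_comb M S' c y = lin_comb M S' d z"
      and yz: "\<And>c. c \<in> S' \<rightarrow> carrier R \<Longrightarrow> \<exists>d\<in>S' \<rightarrow> carrier R. lin_comb M S' c z = lin_comb M S' d y"
      and zN: "\<And>c. c \<in> S' \<rightarrow> carrier R \<Longrightarrow> lin_comb M S' c z \<in> N \<Longrightarrow> \<forall>l\<in>S'. c l \<odot>\<^bsub>M\<^esub> z l \<in> N"
      by blast
    define z' where "z' = z(p := yp)"
    have z': "z' \<in> S \<rightarrow> carrier M"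
      using z yp by (auto simp: z'_def S'_def)
    have split_z: "lin_comb M S c z' = c p \<odot>\<^bsub>M\<^esub> yp \<oplus>\<^bsub>M\<^esub> lin_comb M S' c z" if c: "c \<in> S \<rightarrow> carrier R" for c
    proof -
      have "lin_comb M S' c z' = lin_comb M S' c z"
        using S' c z by (intro lin_comb_cong) (auto simp: z'_def)
      then show ?thesis
        using split_y[OF c z'] by (simp add: z'_def)
    qed
    \<comment> \<open>\<open>b p = c p\<close> is recorded because \<open>in_ideal\<close> speaks of
      relations among the old generators; through it the coefficient of \<open>yp\<close> in a
      relation is seen to lie in \<open>D\<close>.\<close>
    have to_y: "\<exists>b\<in>S \<rightarrow> carrier R. b p = c p \<and> lin_comb M S c z' = lin_comb M S b y"
      if c: "c \<in> S \<rightarrow> carrier R" for c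
    proof -
      have cS': "c \<in> S' \<rightarrow> carrier R" and cp: "c p \<in> carrier R"
        using c S' p by auto
      obtain e where e: "e \<in> S' \<rightarrow> carrier R" "lin_comb M S' c z = lin_comb M S' e y"
        using yz[OF cS'] by blast
      define b where "b l = (if l = p then c p else e l \<oplus> c p \<otimes> q l)" for l
      have b: "b \<in> S \<rightarrow> carrier R" "b p = c p"
        using e cp qS' by (auto simp: b_def S'_def Pi_iff)
      have "(e l \<oplus> c p \<otimes> q l) \<ominus>\<^bsub>R\<^esub> c p \<otimes> q l = e l" if "l \<in> S'" for l
      proof -
        have "e l \<in> carrier R" "q l \<in> carrier R"
          using e qS' that by auto
        then show ?thesis
          using cp by algebra
      qed
      then have "lin_comb M S' (\<lambda>l. b l \<ominus>\<^bsub>R\<^esub> b p \<otimes> q l) y = lin_comb M S' e y"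
        using e yS' S'(4) by (intro lin_comb_cong) (auto simp: b_def)
      then have "lin_comb M S c z' = lin_comb M S b y"
        using change[OF b(1)] split_z[OF c] e(2) b(2) by simp
      then show ?thesis
        using b by blast
    qed
    show ?thesis
    proof (intro bexI[of _ z'] conjI ballI impI)
      fix c assume c: "c \<in> S \<rightarrow> carrier R"
      have "(\<lambda>l. c l \<ominus>\<^bsub>R\<^esub> c p \<otimes> q l) \<in> S' \<rightarrow> carrier R"
        using funcset_mem[OF c] p S'(3) funcset_mem[OF qS']
        by (intro Pi_I R.minus_closed R.m_closed) (simp_all add: subset_iff)
      then obtain e where e: "e \<in> S' \<rightarrow> carrier R"
        "lin_comb M S' (\<lambda>l. c l \<ominus>\<^bsub>R\<^esub> c p \<otimes> q l) y = lin_comb M S' e z"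
        using zy by blast
      define e' where "e' = e(p := c p)"
      have e': "e' \<in> S \<rightarrow> carrier R"
        using e c p by (auto simp: e'_def S'_def)
      have "lin_comb M S' e' z = lin_comb M S' e z"
        using S' e z by (intro lin_comb_cong) (auto simp: e'_def)
      then have "lin_comb M S c y = lin_comb M S e' z'"
        using change[OF c] split_z[OF e'] e(2) by (simp add: e'_def)
      then show "\<exists>d\<in>S \<rightarrow> carrier R. lin_comb M S c y = lin_comb M S d z'"
        using e' by blast
      show "\<exists>d\<in>S \<rightarrow> carrier R. lin_comb M S c z' = lin_comb M S d y"
        using to_y[OF c] by blast
    next
      fix c l assume c: "c \<in> S \<rightarrow> carrier R" and cN: "lin_comb M S c z' \<in> N" and l: "l \<in> S"
      have cS': "c \<in> S' \<rightarrow> carrier R" and cp: "c p \<in> carrier R"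
        using c S' p by auto
      obtain b where b: "b \<in> S \<rightarrow> carrier R" "b p = c p" "lin_comb M S c z' = lin_comb M S b y"
        using to_y[OF c] by blast
      have "b p \<in> D"
        using in_ideal[OF D ID rD[OF _ p] p b(1)] cN b(3) by simp
      then have cpN: "c p \<odot>\<^bsub>M\<^esub> yp \<in> N"
        using D_yp b(2) by simp
      have "lin_comb M S' c z \<in> N"
      proof -
        define u v where uv: "u = c p \<odot>\<^bsub>M\<^esub> yp" "v = lin_comb M S' c z"
        have "u \<in> carrier M" "v \<in> carrier M"
          unfolding uv using lin_comb_closed[OF cS' z] cp yp by auto
        then have "v = (u \<oplus>\<^bsub>M\<^esub> v) \<ominus>\<^bsub>M\<^esub> u"
          by algebra
        moreover have "u \<oplus>\<^bsub>M\<^esub> v \<in> N"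
          using split_z[OF c] cN by (simp add: uv)
        moreover have "u \<in> N"
          unfolding uv by (rule cpN)
        ultimately show ?thesis
          using submodule_diff[OF N] uv by metis
      qed
      then have "\<forall>l\<in>S'. c l \<odot>\<^bsub>M\<^esub> z l \<in> N"
        by (rule zN[OF cS'])
      then show "c l \<odot>\<^bsub>M\<^esub> z' l \<in> N"
        using cpN l by (auto simp: z'_def S'_def)
    qed (rule z')
  qed
qed

end

section \<open>Finitely presented modules\<close>

text \<open>A finite presentation in coordinates: generators \<open>x\<close> and a matrix
  \<open>r\<close> whose \<open>k\<close> rows generate all relations. Changes of generators then
  become matrix computations.\<close>

locale presented_module = module R M
  for R :: "('a, 'r) ring_scheme" (structure) and M :: "('a, 'm, 'k) module_scheme" (structure) +
  fixes n :: nat and x :: "nat \<Rightarrow> 'm" and k :: nat and r :: "nat \<Rightarrow> nat \<Rightarrow> 'a"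
  assumes x_closed: "x \<in> {..<n} \<rightarrow> carrier M"
    and r_closed: "j < k \<Longrightarrow> r j \<in> {..<n} \<rightarrow> carrier R"
    and generated: "z \<in> carrier M \<Longrightarrow> \<exists>c\<in>{..<n} \<rightarrow> carrier R. z = lin_comb M {..<n} c x"
    and relation: "j < k \<Longrightarrow> lin_comb M {..<n} (r j) x = \<zero>\<^bsub>M\<^esub>"
    and relations_generated: "c \<in> {..<n} \<rightarrow> carrier R \<Longrightarrow> lin_comb M {..<n} c x = \<zero>\<^bsub>M\<^esub> \<Longrightarrow>
      \<exists>s\<in>{..<k} \<rightarrow> carrier R. \<forall>i<n. c i = (\<Oplus>j\<in>{..<k}. s j \<otimes> r j i)"
begin

text \<open>The submodule \<open>I M\<close>: since \<open>x\<close> generates \<open>M\<close>, it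
  is enough to let \<open>I\<close> act on the generators. Membership thus involves only
  \<open>n\<close> elements of \<open>I\<close>, which makes it compatible with unions of
  chains.\<close>

definition IM :: "'a set \<Rightarrow> 'm set" where
  "IM I = {lin_comb M {..<n} c x | c. c \<in> {..<n} \<rightarrow> I}"

lemma ideal_funcset: "ideal I R \<Longrightarrow> c \<in> A \<rightarrow> I \<Longrightarrow> c \<in> A \<rightarrow> carrier R"
  using R.ideal_in_carrier by blast

lemma submodule_IM:
  assumes I: "ideal I R"
  shows "submodule (IM I) R M"
proof (rule submoduleI')
  show "IM I \<subseteq> carrier M"
    using lin_comb_closed[OF ideal_funcset[OF I] x_closed] by (auto simp: IM_def)
  have "lin_comb M {..<n} (\<lambda>_. \<zero>) x = \<zero>\<^bsub>M\<^esub>"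
    by (intro lin_comb_zero_left x_closed) simp
  moreover have "(\<lambda>_. \<zero>) \<in> {..<n} \<rightarrow> I"
    using R.ideal_zero[OF I] by simp
  ultimately show "\<zero>\<^bsub>M\<^esub> \<in> IM I"
    unfolding IM_def by (metis (mono_tags, lifting) mem_Collect_eq)
  fix u v assume "u \<in> IM I" "v \<in> IM I"
  then obtain c d where c: "c \<in> {..<n} \<rightarrow> I" "u = lin_comb M {..<n} c x"
    and d: "d \<in> {..<n} \<rightarrow> I" "v = lin_comb M {..<n} d x"
    unfolding IM_def by blast
  have "u \<oplus>\<^bsub>M\<^esub> v = lin_comb M {..<n} (\<lambda>i. c i \<oplus> d i) x"
    unfolding c d by (intro lin_comb_add[symmetric] ideal_funcset[OF I] c d x_closed)
  moreover have "(\<lambda>i. c i \<oplus> d i) \<in> {..<n} \<rightarrow> I"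
    using c d R.ideal_add[OF I] by auto
  ultimately show "u \<oplus>\<^bsub>M\<^esub> v \<in> IM I"
    unfolding IM_def by blast
next
  fix a u assume a: "a \<in> carrier R" and "u \<in> IM I"
  then obtain c where c: "c \<in> {..<n} \<rightarrow> I" "u = lin_comb M {..<n} c x"
    unfolding IM_def by blast
  have "a \<odot>\<^bsub>M\<^esub> u = lin_comb M {..<n} (\<lambda>i. a \<otimes> c i) x"
    unfolding c by (intro lin_comb_smult[symmetric] ideal_funcset[OF I] c a x_closed) simp
  moreover have "(\<lambda>i. a \<otimes> c i) \<in> {..<n} \<rightarrow> I"
    using c a R.ideal_mult_left[OF I] by auto
  ultimately show "a \<odot>\<^bsub>M\<^esub> u \<in> IM I"
    unfolding IM_def by blast
qed

lemma smult_in_IM: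
  assumes I: "ideal I R" and i: "i \<in> I" and z: "z \<in> carrier M"
  shows "i \<odot>\<^bsub>M\<^esub> z \<in> IM I"
proof -
  obtain c where c: "c \<in> {..<n} \<rightarrow> carrier R" "z = lin_comb M {..<n} c x"
    using generated[OF z] by blast
  have "i \<odot>\<^bsub>M\<^esub> z = lin_comb M {..<n} (\<lambda>l. i \<otimes> c l) x"
    unfolding c using R.ideal_in_carrier[OF I i]
    by (intro lin_comb_smult[symmetric] c x_closed) simp_all
  moreover have "(\<lambda>l. i \<otimes> c l) \<in> {..<n} \<rightarrow> I"
    using c R.ideal_mult_right[OF I i] by auto
  ultimately show ?thesis
    unfolding IM_def by blast
qed

lemma IM_mono: "I \<subseteq> J \<Longrightarrow> IM I \<subseteq> IM J"
  unfolding IM_def by blast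

lemma IM_carrier: "IM (carrier R) = carrier M"
proof
  show "IM (carrier R) \<subseteq> carrier M"
    by (rule submoduleE(1)[OF submodule_IM[OF R.oneideal]])
  show "carrier M \<subseteq> IM (carrier R)"
    using generated by (auto simp: IM_def)
qed

lemma IM_zero: "IM {\<zero>} = {\<zero>\<^bsub>M\<^esub>}"
proof
  show "IM {\<zero>} \<subseteq> {\<zero>\<^bsub>M\<^esub>}"
  proof
    fix z assume "z \<in> IM {\<zero>}"
    then obtain c where c: "c \<in> {..<n} \<rightarrow> {\<zero>}" "z = lin_comb M {..<n} c x"
      unfolding IM_def by blast
    have "lin_comb M {..<n} c x = lin_comb M {..<n} (\<lambda>_. \<zero>) x"
      using c x_closed by (intro lin_comb_cong) auto
    then show "z \<in> {\<zero>\<^bsub>M\<^esub>}"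
      using c(2) lin_comb_zero_left[OF _ x_closed] by simp
  qed
  show "{\<zero>\<^bsub>M\<^esub>} \<subseteq> IM {\<zero>}"
    using submodule_zero[OF submodule_IM[OF R.zeroideal]] by simp
qed

lemma IM_chain_mem:
  assumes C: "C \<noteq> {}" "subset.chain {I. ideal I R} C" and z: "z \<in> IM (\<Union>C)"
  shows "\<exists>J\<in>C. z \<in> IM J"
proof -
  obtain c where c: "c \<in> {..<n} \<rightarrow> \<Union>C" "z = lin_comb M {..<n} c x"
    using z unfolding IM_def by blast
  have "c ` {..<n} \<subseteq> \<Union>C"
    using c(1) by auto
  have "\<exists>J\<in>C. c ` {..<n} \<subseteq> J"
    by (rule finite_subset_Union_chain[OF _ \<open>c ` {..<n} \<subseteq> \<Union>C\<close> C]) auto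
  then obtain J where "J \<in> C" "c \<in> {..<n} \<rightarrow> J"
    by auto
  then show ?thesis
    unfolding IM_def c(2) by blast
qed

lemma IM_chain_finite:
  assumes C: "C \<noteq> {}" "subset.chain {I. ideal I R} C" and F: "finite F" "F \<subseteq> IM (\<Union>C)"
  shows "\<exists>J\<in>C. F \<subseteq> IM J"
proof -
  have sub: "F \<subseteq> \<Union>(IM ` C)"
    using IM_chain_mem[OF C] F(2) by blast
  have "subset.chain UNIV (IM ` C)"
    unfolding subset_chain_def
  proof (intro conjI ballI subset_UNIV)
    fix X Y assume "X \<in> IM ` C" "Y \<in> IM ` C"
    then obtain J K where JK: "J \<in> C" "K \<in> C" "X = IM J" "Y = IM K" by blast
    then have "J \<subseteq> K \<or> K \<subseteq> J"
      using C(2) unfolding subset_chain_def by blast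
    then show "X \<subseteq> Y \<or> Y \<subseteq> X"
      unfolding JK(3,4) using IM_mono[of J K] IM_mono[of K J] by argo
  qed
  moreover have "IM ` C \<noteq> {}"
    using C(1) by simp
  ultimately have "\<exists>B\<in>IM ` C. F \<subseteq> B"
    using finite_subset_Union_chain[OF F(1) sub] by metis
  then show ?thesis by blast
qed

lemma annihilated_IM:
  assumes I: "ideal I R" and e: "e \<in> carrier R" and f: "f \<in> carrier R" and ef: "e \<otimes> f \<in> I"
    and z: "z \<in> IM (add_multiples R I (carrier R) e)"
  shows "f \<odot>\<^bsub>M\<^esub> z \<in> IM I"
proof -
  obtain c where c: "c \<in> {..<n} \<rightarrow> add_multiples R I (carrier R) e" "z = lin_comb M {..<n} c x"
    using z unfolding IM_def by blast
  have "f \<odot>\<^bsub>M\<^esub> z = lin_comb M {..<n} (\<lambda>l. f \<otimes> c l) x"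
    unfolding c using ideal_funcset[OF R.ideal_add_multiples[OF I R.oneideal e] c(1)] f
    by (intro lin_comb_smult[symmetric] x_closed) simp_all
  moreover have "(\<lambda>l. f \<otimes> c l) \<in> {..<n} \<rightarrow> I"
    using R.add_multiples_annihilated[OF I e f ef] c(1) by auto
  ultimately show ?thesis
    unfolding IM_def by blast
qed

text \<open>\<open>decomposes I y\<close> expresses that \<open>M / I M\<close> is the direct sum of the cyclic submodules generated
  by the classes of the \<open>y l\<close>.\<close>

definition decomposes :: "'a set \<Rightarrow> (nat \<Rightarrow> 'm) \<Rightarrow> bool" where
  "decomposes I y \<longleftrightarrow> y \<in> {..<n} \<rightarrow> carrier M \<and>
    (\<forall>z\<in>carrier M. \<exists>c\<in>{..<n} \<rightarrow> carrier R. z \<ominus>\<^bsub>M\<^esub> lin_comb M {..<n} c y \<in> IM I) \<and>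
    (\<forall>c\<in>{..<n} \<rightarrow> carrier R. lin_comb M {..<n} c y \<in> IM I \<longrightarrow> (\<forall>l<n. c l \<odot>\<^bsub>M\<^esub> y l \<in> IM I))"

lemma decomposes_improper: "decomposes (carrier R) x"
proof -
  have "c l \<odot>\<^bsub>M\<^esub> x l \<in> carrier M" if "c \<in> {..<n} \<rightarrow> carrier R" "l < n" for c l
    using that x_closed by auto
  moreover have "\<exists>c\<in>{..<n} \<rightarrow> carrier R. z \<ominus>\<^bsub>M\<^esub> lin_comb M {..<n} c x \<in> carrier M" if z: "z \<in> carrier M" for z
  proof -
    have "(\<lambda>_. \<zero>) \<in> {..<n} \<rightarrow> carrier R" by simp
    then show ?thesis
      using z lin_comb_closed[OF _ x_closed, of "\<lambda>_. \<zero>"] by (intro bexI[of _ "\<lambda>_. \<zero>"]) simp_all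
  qed
  ultimately show ?thesis
    unfolding decomposes_def IM_carrier using x_closed by blast
qed

text \<open>Replacing the \<open>y l\<close> by congruent elements changes every linear combination
  by an element of \<open>I M\<close> only. This lets a glued family inherit a
  decomposition.\<close>

lemma decomposes_cong:
  assumes I: "ideal I R" and y: "decomposes I y" and z: "z \<in> {..<n} \<rightarrow> carrier M"
    and yz: "\<And>l. l < n \<Longrightarrow> z l \<ominus>\<^bsub>M\<^esub> y l \<in> IM I"
  shows "decomposes I z"
  unfolding decomposes_def
proof -
  note N = submodule_IM[OF I]
  have yM: "y \<in> {..<n} \<rightarrow> carrier M"
    using y by (simp add: decomposes_def)
  have diff: "lin_comb M {..<n} c z \<ominus>\<^bsub>M\<^esub> lin_comb M {..<n} c y \<in> IM I" if c: "c \<in> {..<n} \<rightarrow> carrier R" for c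
  proof -
    have "lin_comb M {..<n} c (\<lambda>l. z l \<ominus>\<^bsub>M\<^esub> y l) \<in> IM I"
      using c yz submoduleE(4)[OF N] by (intro lin_comb_in_submodule[OF N]) auto
    then show ?thesis
      by (simp add: lin_comb_diff_right[OF c z yM])
  qed
  show "z \<in> {..<n} \<rightarrow> carrier M \<and>
    (\<forall>w\<in>carrier M. \<exists>c\<in>{..<n} \<rightarrow> carrier R. w \<ominus>\<^bsub>M\<^esub> lin_comb M {..<n} c z \<in> IM I) \<and>
    (\<forall>c\<in>{..<n} \<rightarrow> carrier R. lin_comb M {..<n} c z \<in> IM I \<longrightarrow> (\<forall>l<n. c l \<odot>\<^bsub>M\<^esub> z l \<in> IM I))"
  proof (intro conjI ballI impI allI)
    fix w assume w: "w \<in> carrier M"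
    then obtain c where c: "c \<in> {..<n} \<rightarrow> carrier R" "w \<ominus>\<^bsub>M\<^esub> lin_comb M {..<n} c y \<in> IM I"
      using y unfolding decomposes_def by blast
    define u v where uv: "u = lin_comb M {..<n} c z" "v = lin_comb M {..<n} c y"
    have "u \<in> carrier M" "v \<in> carrier M"
      unfolding uv by (intro lin_comb_closed c z yM)+
    then have "w \<ominus>\<^bsub>M\<^esub> u = (w \<ominus>\<^bsub>M\<^esub> v) \<ominus>\<^bsub>M\<^esub> (u \<ominus>\<^bsub>M\<^esub> v)"
      using w by algebra
    then have "w \<ominus>\<^bsub>M\<^esub> u \<in> IM I"
      using submodule_diff[OF N] c(2) diff[OF c(1)] by (simp add: uv)
    then show "\<exists>c\<in>{..<n} \<rightarrow> carrier R. w \<ominus>\<^bsub>M\<^esub> lin_comb M {..<n} c z \<in> IM I"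
      using c(1) uv by blast
  next
    fix c l assume c: "c \<in> {..<n} \<rightarrow> carrier R" and cz: "lin_comb M {..<n} c z \<in> IM I" and l: "l < n"
    define u v where uv: "u = lin_comb M {..<n} c z" "v = lin_comb M {..<n} c y"
    have "u \<in> carrier M" "v \<in> carrier M"
      unfolding uv by (intro lin_comb_closed c z yM)+
    then have "v = u \<ominus>\<^bsub>M\<^esub> (u \<ominus>\<^bsub>M\<^esub> v)"
      by algebra
    then have "v \<in> IM I"
      using submodule_diff[OF N, of u "u \<ominus>\<^bsub>M\<^esub> v"] cz diff[OF c] by (simp add: uv)
    then have cy: "c l \<odot>\<^bsub>M\<^esub> y l \<in> IM I"
      using y c l unfolding decomposes_def uv by blast
    have cl: "c l \<in> carrier R" "z l \<in> carrier M" "y l \<in> carrier M"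
      using c z yM l by auto
    then have "c l \<odot>\<^bsub>M\<^esub> z l \<ominus>\<^bsub>M\<^esub> c l \<odot>\<^bsub>M\<^esub> y l \<in> IM I"
      using submoduleE(4)[OF N cl(1) yz[OF l]] by (simp add: smult_minus_right)
    then show "c l \<odot>\<^bsub>M\<^esub> z l \<in> IM I"
      using submodule_cong[OF N _ _ _ cy] cl by simp
  qed (rule z)
qed

lemma IM_split:
  assumes I: "ideal I R" and e: "e \<in> carrier R" "e \<otimes> (\<one> \<ominus>\<^bsub>R\<^esub> e) \<in> I"
    and z: "z \<in> IM (add_multiples R I (carrier R) e)" "z \<in> IM (add_multiples R I (carrier R) (\<one> \<ominus>\<^bsub>R\<^esub> e))"
  shows "z \<in> IM I"
proof -
  have f: "\<one> \<ominus>\<^bsub>R\<^esub> e \<in> carrier R" "(\<one> \<ominus>\<^bsub>R\<^esub> e) \<otimes> e \<in> I"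
    using e by (simp_all add: R.m_comm)
  have zM: "z \<in> carrier M"
    using submoduleE(1)[OF submodule_IM[OF R.ideal_add_multiples[OF I R.oneideal e(1)]]] z(1) by blast
  have "z = ((\<one> \<ominus>\<^bsub>R\<^esub> e) \<oplus> e) \<odot>\<^bsub>M\<^esub> z"
    using e zM by (simp add: R.minus_eq R.a_assoc R.l_neg)
  also have "\<dots> = (\<one> \<ominus>\<^bsub>R\<^esub> e) \<odot>\<^bsub>M\<^esub> z \<oplus>\<^bsub>M\<^esub> e \<odot>\<^bsub>M\<^esub> z"
    using e zM f by (intro smult_l_distr)
  also have "\<dots> \<in> IM I"
    using annihilated_IM[OF I e(1) f(1) e(2) z(1)] annihilated_IM[OF I f(1) e(1) f(2) z(2)]
    by (intro submoduleE(5)[OF submodule_IM[OF I]])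
  finally show ?thesis .
qed

text \<open>The family \<open>(1 - e) y + e z\<close> is congruent to \<open>y\<close> modulo
  \<open>J M\<close> and to \<open>z\<close> modulo \<open>K M\<close>. Families have the same
  length \<open>n\<close> for every ideal, with zero summands allowed, so they can be glued index by
  index.\<close>

lemma decomposes_split:
  assumes I: "ideal I R" and e: "e \<in> carrier R" "e \<otimes> (\<one> \<ominus>\<^bsub>R\<^esub> e) \<in> I"
    and y: "decomposes (add_multiples R I (carrier R) e) y"
    and z: "decomposes (add_multiples R I (carrier R) (\<one> \<ominus>\<^bsub>R\<^esub> e)) z"
  shows "\<exists>w. decomposes I w"
proof -
  define f where "f = \<one> \<ominus>\<^bsub>R\<^esub> e"
  have f: "f \<in> carrier R" "f \<otimes> e \<in> I" "e \<otimes> f \<in> I"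
    using e by (simp_all add: R.m_comm f_def)
  define J K where JK: "J = add_multiples R I (carrier R) e" "K = add_multiples R I (carrier R) f"
  have J: "ideal J R" and K: "ideal K R" and IJ: "I \<subseteq> J" and IK: "I \<subseteq> K"
    and eJ: "e \<in> J" and fK: "f \<in> K"
    unfolding JK using e(1) f(1)
    by (simp_all add: R.ideal_add_multiples R.subset_add_multiples I R.oneideal R.mem_add_multiples_self)
  have yM: "y \<in> {..<n} \<rightarrow> carrier M" and zM: "z \<in> {..<n} \<rightarrow> carrier M"
    using y z by (simp_all add: decomposes_def)
  define w where "w l = f \<odot>\<^bsub>M\<^esub> y l \<oplus>\<^bsub>M\<^esub> e \<odot>\<^bsub>M\<^esub> z l" for l
  have wM: "w \<in> {..<n} \<rightarrow> carrier M"
    using funcset_mem[OF yM] funcset_mem[OF zM] e(1) f(1) by (simp add: w_def)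
  have cong: "w l \<ominus>\<^bsub>M\<^esub> y l \<in> IM J \<and> w l \<ominus>\<^bsub>M\<^esub> z l \<in> IM K" if l: "l < n" for l
  proof -
    have c: "y l \<in> carrier M" "z l \<in> carrier M"
      using yM zM l by auto
    define Y Z Y' Z' where d: "Y = f \<odot>\<^bsub>M\<^esub> y l" "Z = e \<odot>\<^bsub>M\<^esub> z l" "Y' = e \<odot>\<^bsub>M\<^esub> y l" "Z' = f \<odot>\<^bsub>M\<^esub> z l"
    have d': "Y \<in> carrier M" "Z \<in> carrier M" "Y' \<in> carrier M" "Z' \<in> carrier M"
      unfolding d using c e(1) f(1) by simp_all
    have split: "v = f \<odot>\<^bsub>M\<^esub> v \<oplus>\<^bsub>M\<^esub> e \<odot>\<^bsub>M\<^esub> v" if "v \<in> carrier M" for v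
    proof -
      have "f \<odot>\<^bsub>M\<^esub> v \<oplus>\<^bsub>M\<^esub> e \<odot>\<^bsub>M\<^esub> v = (f \<oplus> e) \<odot>\<^bsub>M\<^esub> v"
        using that e(1) f(1) by (simp add: smult_l_distr)
      also have "f \<oplus> e = \<one>"
        using e(1) by (simp add: f_def R.minus_eq R.a_assoc R.l_neg)
      finally show ?thesis using that by simp
    qed
    have "w l \<ominus>\<^bsub>M\<^esub> y l = (Y \<oplus>\<^bsub>M\<^esub> Z) \<ominus>\<^bsub>M\<^esub> (Y \<oplus>\<^bsub>M\<^esub> Y')"
      using split[OF c(1)] by (simp add: w_def d)
    also have "\<dots> = Z \<ominus>\<^bsub>M\<^esub> Y'"
      using d' by algebra
    also have "\<dots> = e \<odot>\<^bsub>M\<^esub> (z l \<ominus>\<^bsub>M\<^esub> y l)"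
      using c e(1) by (simp add: d smult_minus_right)
    also have "\<dots> \<in> IM J"
      using c by (intro smult_in_IM J eJ) simp
    finally have 1: "w l \<ominus>\<^bsub>M\<^esub> y l \<in> IM J" .
    have "w l \<ominus>\<^bsub>M\<^esub> z l = (Y \<oplus>\<^bsub>M\<^esub> Z) \<ominus>\<^bsub>M\<^esub> (Z' \<oplus>\<^bsub>M\<^esub> Z)"
      using split[OF c(2)] by (simp add: w_def d)
    also have "\<dots> = Y \<ominus>\<^bsub>M\<^esub> Z'"
      using d' by algebra
    also have "\<dots> = f \<odot>\<^bsub>M\<^esub> (y l \<ominus>\<^bsub>M\<^esub> z l)"
      using c f(1) by (simp add: d smult_minus_right)
    also have "\<dots> \<in> IM K"
      using c by (intro smult_in_IM K fK) simp
    finally show ?thesis using 1 by simp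
  qed
  have wJ: "decomposes J w"
    using decomposes_cong[OF J _ wM] y cong by (simp add: JK)
  have wK: "decomposes K w"
    using decomposes_cong[OF K _ wM] z cong by (simp add: JK f_def)
  have "decomposes I w"
    unfolding decomposes_def
  proof (intro conjI ballI impI allI)
    fix v assume v: "v \<in> carrier M"
    obtain c where c: "c \<in> {..<n} \<rightarrow> carrier R" "v \<ominus>\<^bsub>M\<^esub> lin_comb M {..<n} c w \<in> IM J"
      using wJ v unfolding decomposes_def by blast
    obtain d where d: "d \<in> {..<n} \<rightarrow> carrier R" "v \<ominus>\<^bsub>M\<^esub> lin_comb M {..<n} d w \<in> IM K"
      using wK v unfolding decomposes_def by blast
    define C D where CD: "C = lin_comb M {..<n} c w" "D = lin_comb M {..<n} d w"
    have CDM: "C \<in> carrier M" "D \<in> carrier M"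
      unfolding CD by (intro lin_comb_closed c d wM)+
    have fc: "(\<lambda>l. f \<otimes> c l) \<in> {..<n} \<rightarrow> carrier R" and ed: "(\<lambda>l. e \<otimes> d l) \<in> {..<n} \<rightarrow> carrier R"
      using c(1) d(1) e(1) f(1) by auto
    \<comment> \<open>The two expansions of \<open>v\<close> are glued in the same way. Since
      \<open>f\<close> carries \<open>J M\<close> and \<open>e\<close> carries \<open>K M\<close>
      into \<open>I M\<close>, both errors disappear modulo \<open>I M\<close>.\<close>
    have comb: "lin_comb M {..<n} (\<lambda>l. f \<otimes> c l \<oplus> e \<otimes> d l) w = f \<odot>\<^bsub>M\<^esub> C \<oplus>\<^bsub>M\<^esub> e \<odot>\<^bsub>M\<^esub> D"
      unfolding CD using c(1) d(1) e(1) f(1) wM fc ed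
      by (simp add: lin_comb_add lin_comb_smult)
    have "(f \<oplus> e) \<odot>\<^bsub>M\<^esub> v = v"
      using e(1) v by (simp add: f_def R.minus_eq R.a_assoc R.l_neg)
    then have "v = f \<odot>\<^bsub>M\<^esub> v \<oplus>\<^bsub>M\<^esub> e \<odot>\<^bsub>M\<^esub> v"
      using v e(1) f(1) by (simp add: smult_l_distr)
    then have "v \<ominus>\<^bsub>M\<^esub> lin_comb M {..<n} (\<lambda>l. f \<otimes> c l \<oplus> e \<otimes> d l) w
        = (f \<odot>\<^bsub>M\<^esub> v \<oplus>\<^bsub>M\<^esub> e \<odot>\<^bsub>M\<^esub> v) \<ominus>\<^bsub>M\<^esub> (f \<odot>\<^bsub>M\<^esub> C \<oplus>\<^bsub>M\<^esub> e \<odot>\<^bsub>M\<^esub> D)"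
      unfolding comb by simp
    also have "\<dots> = (f \<odot>\<^bsub>M\<^esub> v \<ominus>\<^bsub>M\<^esub> f \<odot>\<^bsub>M\<^esub> C) \<oplus>\<^bsub>M\<^esub> (e \<odot>\<^bsub>M\<^esub> v \<ominus>\<^bsub>M\<^esub> e \<odot>\<^bsub>M\<^esub> D)"
      using v CDM e(1) f(1) by (simp add: M.minus_eq M.minus_add M.a_ac)
    also have "\<dots> = f \<odot>\<^bsub>M\<^esub> (v \<ominus>\<^bsub>M\<^esub> C) \<oplus>\<^bsub>M\<^esub> e \<odot>\<^bsub>M\<^esub> (v \<ominus>\<^bsub>M\<^esub> D)"
      using v CDM e(1) f(1) by (simp add: smult_minus_right)
    also have "\<dots> \<in> IM I"
      using c(2) d(2) annihilated_IM[OF I e(1) f(1) f(3)] annihilated_IM[OF I f(1) e(1) f(2)]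
      by (intro submoduleE(5)[OF submodule_IM[OF I]]) (simp_all add: JK CD)
    finally show "\<exists>c\<in>{..<n} \<rightarrow> carrier R. v \<ominus>\<^bsub>M\<^esub> lin_comb M {..<n} c w \<in> IM I"
      using fc ed by (intro bexI[of _ "\<lambda>l. f \<otimes> c l \<oplus> e \<otimes> d l"]) auto
  next
    fix c l assume c: "c \<in> {..<n} \<rightarrow> carrier R" "lin_comb M {..<n} c w \<in> IM I" and l: "l < n"
    then have "c l \<odot>\<^bsub>M\<^esub> w l \<in> IM J" "c l \<odot>\<^bsub>M\<^esub> w l \<in> IM K"
      using wJ wK IM_mono[OF IJ] IM_mono[OF IK] unfolding decomposes_def by blast+
    then show "c l \<odot>\<^bsub>M\<^esub> w l \<in> IM I"
      using IM_split[OF I e] by (simp add: JK f_def)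
  qed (rule wM)
  then show ?thesis by blast
qed

text \<open>A combination of \<open>x\<close> that lies in \<open>I M\<close> also has coefficients
  in \<open>I\<close>; the difference of the two coefficient vectors is a relation of
  \<open>M\<close>. So the rows of \<open>r\<close> generate all relations modulo \<open>I\<close>,
  as \<open>diagonalize\<close> requires.\<close>

lemma decomposes_chain_ideal:
  assumes I: "ideal I R" and chain: "chain_ideal R I"
  shows "\<exists>y. decomposes I y"
proof -
  note N = submodule_IM[OF I]
  have rel0: "lin_comb M {..<n} (r j) x \<in> IM I" if "j < k" for j
    using relation[OF that] submodule_zero[OF N] by simp
  have gen: "\<exists>s\<in>{..<k} \<rightarrow> carrier R. \<forall>l\<in>{..<n}. c l \<ominus>\<^bsub>R\<^esub> (\<Oplus>j\<in>{..<k}. s j \<otimes> r j l) \<in> I"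
    if c: "c \<in> {..<n} \<rightarrow> carrier R" and cI: "lin_comb M {..<n} c x \<in> IM I" for c
  proof -
    obtain i where i: "i \<in> {..<n} \<rightarrow> I" "lin_comb M {..<n} c x = lin_comb M {..<n} i x"
      using cI unfolding IM_def by blast
    have iR: "i \<in> {..<n} \<rightarrow> carrier R"
      by (rule ideal_funcset[OF I i(1)])
    have "lin_comb M {..<n} (\<lambda>l. c l \<ominus>\<^bsub>R\<^esub> i l) x = \<zero>\<^bsub>M\<^esub>"
      using lin_comb_diff[OF _ c iR x_closed] i(2) lin_comb_closed[OF iR x_closed]
      by (simp add: M.minus_eq M.r_neg)
    moreover have "(\<lambda>l. c l \<ominus>\<^bsub>R\<^esub> i l) \<in> {..<n} \<rightarrow> carrier R"
      using c iR by auto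
    ultimately obtain s where s: "s \<in> {..<k} \<rightarrow> carrier R"
      "\<And>l. l < n \<Longrightarrow> c l \<ominus>\<^bsub>R\<^esub> i l = (\<Oplus>j\<in>{..<k}. s j \<otimes> r j l)"
      using relations_generated by blast
    have "c l \<ominus>\<^bsub>R\<^esub> (\<Oplus>j\<in>{..<k}. s j \<otimes> r j l) \<in> I" if l: "l < n" for l
    proof -
      have "c l \<in> carrier R" "i l \<in> carrier R"
        using c iR l by auto
      then have "c l \<ominus>\<^bsub>R\<^esub> (c l \<ominus>\<^bsub>R\<^esub> i l) = i l"
        by algebra
      then show ?thesis
        using s(2)[OF l] i(1) l by auto
    qed
    then show ?thesis
      using s(1) by auto
  qed
  obtain y where y: "y \<in> {..<n} \<rightarrow> carrier M"
    and span: "\<And>c. c \<in> {..<n} \<rightarrow> carrier R \<Longrightarrow>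
      \<exists>d\<in>{..<n} \<rightarrow> carrier R. lin_comb M {..<n} c x = lin_comb M {..<n} d y"
    and indep: "\<And>c. c \<in> {..<n} \<rightarrow> carrier R \<Longrightarrow> lin_comb M {..<n} c y \<in> IM I \<Longrightarrow>
      \<forall>l\<in>{..<n}. c l \<odot>\<^bsub>M\<^esub> y l \<in> IM I"
    using diagonalize[OF I chain N smult_in_IM[OF I] _ x_closed r_closed rel0 gen] by blast
  have "\<exists>c\<in>{..<n} \<rightarrow> carrier R. z \<ominus>\<^bsub>M\<^esub> lin_comb M {..<n} c y \<in> IM I" if z: "z \<in> carrier M" for z
  proof -
    obtain c where c: "c \<in> {..<n} \<rightarrow> carrier R" "z = lin_comb M {..<n} c x"
      using generated[OF z] by blast
    obtain d where d: "d \<in> {..<n} \<rightarrow> carrier R" "z = lin_comb M {..<n} d y"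
      using span[OF c(1)] c(2) by auto
    have "z \<ominus>\<^bsub>M\<^esub> lin_comb M {..<n} d y = \<zero>\<^bsub>M\<^esub>"
      using d(2) z by (simp add: M.minus_eq M.r_neg)
    then show ?thesis
      using d(1) submodule_zero[OF N] by (intro bexI[of _ d]) simp_all
  qed
  then show ?thesis
    unfolding decomposes_def using y indep by (intro exI[of _ y]) auto
qed

text \<open>\<open>decomposes I y\<close> amounts to finitely many membership conditions, because the relations of \<open>y\<close>
  modulo \<open>I\<close> are generated by the relations of \<open>x\<close>, rewritten in terms of \<open>y\<close>, and by those that
  arise from expressing \<open>y\<close> in terms of \<open>x\<close> and back.\<close>

lemma decomposes_chain_mem:
  assumes C: "C \<noteq> {}" "subset.chain {I. ideal I R} C" and y: "decomposes (\<Union>C) y"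
  shows "\<exists>J\<in>C. decomposes J y"
proof -
  let ?S = "{..<n}" and ?U = "\<Union>C"
  have U: "ideal ?U R"
    by (rule R.ideal_chain_Union[OF C(2,1)])
  note N = submodule_IM[OF U]
  have yM: "y \<in> ?S \<rightarrow> carrier M"
    and y_gen: "\<And>z. z \<in> carrier M \<Longrightarrow> \<exists>c\<in>?S \<rightarrow> carrier R. z \<ominus>\<^bsub>M\<^esub> lin_comb M ?S c y \<in> IM ?U"
    and y_indep: "\<And>c l. c \<in> ?S \<rightarrow> carrier R \<Longrightarrow> lin_comb M ?S c y \<in> IM ?U \<Longrightarrow> l < n \<Longrightarrow> c l \<odot>\<^bsub>M\<^esub> y l \<in> IM ?U"
    using y unfolding decomposes_def by blast+
  have yl: "y l \<in> carrier M" and xl: "x l \<in> carrier M" if "l < n" for l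
    using yM x_closed that by auto
  \<comment> \<open>Two matrices: \<open>y = B x\<close> holds exactly, but \<open>x = A y\<close>
    only modulo \<open>IM ?U\<close>, with error \<open>w\<close>.\<close>
  have "\<exists>c\<in>?S \<rightarrow> carrier R. y l = lin_comb M ?S c x" if "l < n" for l
    using generated[OF yl[OF that]] .
  then obtain B where B: "\<And>l. l < n \<Longrightarrow> B l \<in> ?S \<rightarrow> carrier R" "\<And>l. l < n \<Longrightarrow> y l = lin_comb M ?S (B l) x"
    by metis
  have "\<exists>c\<in>?S \<rightarrow> carrier R. x i \<ominus>\<^bsub>M\<^esub> lin_comb M ?S c y \<in> IM ?U" if "i < n" for i
    using y_gen[OF xl[OF that]] .
  then obtain A where A: "\<And>i. i < n \<Longrightarrow> A i \<in> ?S \<rightarrow> carrier R"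
    "\<And>i. i < n \<Longrightarrow> x i \<ominus>\<^bsub>M\<^esub> lin_comb M ?S (A i) y \<in> IM ?U"
    by metis
  have AR: "A i l \<in> carrier R" and BR: "B i l \<in> carrier R" if "i < n" "l < n" for i l
    using A(1) B(1) that by auto
  define w where "w i = x i \<ominus>\<^bsub>M\<^esub> lin_comb M ?S (A i) y" for i
  have Ay: "(\<lambda>i. lin_comb M ?S (A i) y) \<in> ?S \<rightarrow> carrier M"
    using A(1) yM by (auto intro!: lin_comb_closed)
  have wM: "w \<in> ?S \<rightarrow> carrier M"
    using xl funcset_mem[OF Ay] by (simp add: w_def)
  have via_A: "lin_comb M ?S c w = lin_comb M ?S c x \<ominus>\<^bsub>M\<^esub> lin_comb M ?S (\<lambda>l. \<Oplus>i\<in>?S. c i \<otimes> A i l) y"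
    if c: "c \<in> ?S \<rightarrow> carrier R" for c
  proof -
    have "lin_comb M ?S c w = lin_comb M ?S c x \<ominus>\<^bsub>M\<^esub> lin_comb M ?S c (\<lambda>i. lin_comb M ?S (A i) y)"
      unfolding w_def using c x_closed Ay by (rule lin_comb_diff_right)
    also have "lin_comb M ?S c (\<lambda>i. lin_comb M ?S (A i) y) = lin_comb M ?S (\<lambda>l. \<Oplus>i\<in>?S. c i \<otimes> A i l) y"
      using c A(1) yM by (intro lin_comb_lin_comb) auto
    finally show ?thesis .
  qed
  have colA: "(\<lambda>i. A i l) \<in> ?S \<rightarrow> carrier R" and colB: "(\<lambda>i. B i l) \<in> ?S \<rightarrow> carrier R" if "l < n" for l
    using AR BR that by simp_all
  have cA: "(\<lambda>l. \<Oplus>i\<in>?S. c i \<otimes> A i l) \<in> ?S \<rightarrow> carrier R"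
    and cB: "(\<lambda>l. \<Oplus>i\<in>?S. c i \<otimes> B i l) \<in> ?S \<rightarrow> carrier R" if "c \<in> ?S \<rightarrow> carrier R" for c
    using R.finsum_mult_closed[OF that colA] R.finsum_mult_closed[OF that colB] by simp_all
  have rel_A: "lin_comb M ?S (\<lambda>l. \<Oplus>i\<in>?S. c i \<otimes> A i l) y = lin_comb M ?S c x \<ominus>\<^bsub>M\<^esub> lin_comb M ?S c w"
    if c: "c \<in> ?S \<rightarrow> carrier R" for c
  proof -
    define u v t where uvt: "u = lin_comb M ?S c x" "v = lin_comb M ?S (\<lambda>l. \<Oplus>i\<in>?S. c i \<otimes> A i l) y"
      "t = lin_comb M ?S c w"
    have "u \<in> carrier M" "v \<in> carrier M"
      unfolding uvt by (intro lin_comb_closed c x_closed cA[OF c] yM)+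
    moreover have "t = u \<ominus>\<^bsub>M\<^esub> v"
      unfolding uvt by (rule via_A[OF c])
    moreover have "v = u \<ominus>\<^bsub>M\<^esub> (u \<ominus>\<^bsub>M\<^esub> v)" if "u \<in> carrier M" "v \<in> carrier M"
      using that by algebra
    ultimately show ?thesis
      by (simp add: uvt)
  qed
  have cw: "lin_comb M ?S c w \<in> IM J" if "ideal J R" "c \<in> ?S \<rightarrow> carrier R" "\<And>i. i < n \<Longrightarrow> w i \<in> IM J" for c J
    using that submoduleE(4)[OF submodule_IM[OF that(1)]]
    by (intro lin_comb_in_submodule[OF submodule_IM[OF that(1)]]) auto
  \<comment> \<open>The matrix \<open>r A\<close>, whose rows are relations of \<open>y\<close>
    modulo \<open>IM ?U\<close>.\<close>
  define E where "E j l = (\<Oplus>i\<in>?S. r j i \<otimes> A i l)" for j l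
  have ER: "E j \<in> ?S \<rightarrow> carrier R" if "j < k" for j
    unfolding E_def[abs_def] by (rule cA[OF r_closed[OF that]])
  have E: "E j l \<odot>\<^bsub>M\<^esub> y l \<in> IM ?U" if j: "j < k" and l: "l < n" for j l
  proof -
    have "lin_comb M ?S (E j) y = lin_comb M ?S (r j) x \<ominus>\<^bsub>M\<^esub> lin_comb M ?S (r j) w"
      unfolding E_def[abs_def] by (rule rel_A[OF r_closed[OF j]])
    also have "\<dots> \<in> IM ?U"
      using relation[OF j] submodule_zero[OF N] cw[OF U r_closed[OF j]] A(2)
      by (intro submodule_diff[OF N]) (simp_all add: w_def)
    finally show ?thesis
      using y_indep[OF ER[OF j] _ l] by blast
  qed
  \<comment> \<open>The matrix \<open>1 - B A\<close>, which records the defect of going from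
    \<open>y\<close> to \<open>x\<close> and back.\<close>
  define D where "D k l = (if l = k then \<one> else \<zero>) \<ominus>\<^bsub>R\<^esub> (\<Oplus>i\<in>?S. B k i \<otimes> A i l)" for k l
  have BA: "(\<lambda>l. \<Oplus>i\<in>?S. B k i \<otimes> A i l) \<in> ?S \<rightarrow> carrier R" if "k < n" for k
    by (rule cA[OF B(1)[OF that]])
  have DR: "D k \<in> ?S \<rightarrow> carrier R" if "k < n" for k
    using funcset_mem[OF BA[OF that]] by (simp add: D_def)
  have D: "D k l \<odot>\<^bsub>M\<^esub> y l \<in> IM ?U" if k: "k < n" and l: "l < n" for k l
  proof -
    have "lin_comb M ?S (D k) y
        = lin_comb M ?S (\<lambda>l. if l = k then \<one> else \<zero>) y \<ominus>\<^bsub>M\<^esub> lin_comb M ?S (\<lambda>l. \<Oplus>i\<in>?S. B k i \<otimes> A i l) y"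
      unfolding D_def[abs_def] using BA[OF k] yM by (intro lin_comb_diff) auto
    also have "lin_comb M ?S (\<lambda>l. if l = k then \<one> else \<zero>) y = y k"
      using lin_comb_delta[of ?S k \<one> y] k yM yl by simp
    also have "lin_comb M ?S (\<lambda>l. \<Oplus>i\<in>?S. B k i \<otimes> A i l) y = y k \<ominus>\<^bsub>M\<^esub> lin_comb M ?S (B k) w"
      using rel_A[OF B(1)[OF k]] B(2)[OF k] by simp
    also have "y k \<ominus>\<^bsub>M\<^esub> (y k \<ominus>\<^bsub>M\<^esub> lin_comb M ?S (B k) w) = lin_comb M ?S (B k) w"
    proof -
      have "u \<ominus>\<^bsub>M\<^esub> (u \<ominus>\<^bsub>M\<^esub> v) = v" if "u \<in> carrier M" "v \<in> carrier M" for u v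
        using that by algebra
      then show ?thesis
        using yl[OF k] lin_comb_closed[OF B(1)[OF k] wM] by blast
    qed
    also have "\<dots> \<in> IM ?U"
      using cw[OF U B(1)[OF k]] A(2) by (simp add: w_def)
    finally show ?thesis
      using y_indep[OF DR[OF k] _ l] by blast
  qed
  \<comment> \<open>One \<open>J\<close> in the chain serves all of these elements: \<open>w\<close>
    makes \<open>y\<close> generate modulo \<open>J M\<close>, and the other two families yield
    independence.\<close>
  define F where "F = w ` ?S \<union> (\<lambda>(j, l). E j l \<odot>\<^bsub>M\<^esub> y l) ` ({..<k} \<times> ?S) \<union> (\<lambda>(k, l). D k l \<odot>\<^bsub>M\<^esub> y l) ` (?S \<times> ?S)"
  have "finite F" "F \<subseteq> IM ?U"
    using A(2) D E by (auto simp: F_def w_def)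
  then obtain J where JC: "J \<in> C" and FJ: "F \<subseteq> IM J"
    using IM_chain_finite[OF C] by blast
  have J: "ideal J R"
    using JC C(2) by (auto simp: subset_chain_def)
  note NJ = submodule_IM[OF J]
  have wJ: "w i \<in> IM J" if "i < n" for i
    using FJ that by (auto simp: F_def)
  have EJ: "E j l \<odot>\<^bsub>M\<^esub> y l \<in> IM J" if "j < k" "l < n" for j l
    using FJ that by (force simp: F_def)
  have DJ: "D k l \<odot>\<^bsub>M\<^esub> y l \<in> IM J" if "k < n" "l < n" for k l
    using FJ that by (force simp: F_def)
  have "decomposes J y"
    unfolding decomposes_def
  proof (intro conjI ballI impI allI)
    fix z assume z: "z \<in> carrier M"
    obtain c where c: "c \<in> ?S \<rightarrow> carrier R" "z = lin_comb M ?S c x"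
      using generated[OF z] by blast
    have "z \<ominus>\<^bsub>M\<^esub> lin_comb M ?S (\<lambda>l. \<Oplus>i\<in>?S. c i \<otimes> A i l) y \<in> IM J"
      using via_A[OF c(1)] cw[OF J c(1) wJ] c(2) by simp
    then show "\<exists>c\<in>?S \<rightarrow> carrier R. z \<ominus>\<^bsub>M\<^esub> lin_comb M ?S c y \<in> IM J"
      using cA[OF c(1)] by (rule bexI)
  next
    fix c l assume c: "c \<in> ?S \<rightarrow> carrier R" and cJ: "lin_comb M ?S c y \<in> IM J" and l: "l < n"
    \<comment> \<open>\<open>g = c B\<close> holds the coefficients over \<open>x\<close>. As the
      combination lies in \<open>J M\<close>, it also has coefficients \<open>h\<close> in
      \<open>J\<close>, so \<open>g - h\<close> is a relation of \<open>M\<close>, of the form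
      \<open>s r\<close>.\<close>
    define g where "g i = (\<Oplus>t\<in>?S. c t \<otimes> B t i)" for i
    have g: "g \<in> ?S \<rightarrow> carrier R"
      unfolding g_def[abs_def] by (rule cB[OF c])
    have "lin_comb M ?S c y = lin_comb M ?S c (\<lambda>t. lin_comb M ?S (B t) x)"
      using B c x_closed by (intro lin_comb_cong) (auto intro!: lin_comb_closed)
    also have "\<dots> = lin_comb M ?S g x"
      unfolding g_def[abs_def] using c B(1) x_closed by (intro lin_comb_lin_comb) auto
    finally obtain h where h: "h \<in> ?S \<rightarrow> J" "lin_comb M ?S g x = lin_comb M ?S h x"
      using cJ unfolding IM_def by auto
    have hR: "h \<in> ?S \<rightarrow> carrier R"
      by (rule ideal_funcset[OF J h(1)])
    have "lin_comb M ?S (\<lambda>i. g i \<ominus>\<^bsub>R\<^esub> h i) x = \<zero>\<^bsub>M\<^esub>"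
      using lin_comb_diff[OF _ g hR x_closed] h(2) lin_comb_closed[OF hR x_closed]
      by (simp add: M.minus_eq M.r_neg)
    moreover have "(\<lambda>i. g i \<ominus>\<^bsub>R\<^esub> h i) \<in> ?S \<rightarrow> carrier R"
      using funcset_mem[OF g] funcset_mem[OF hR] by simp
    ultimately obtain s where s: "s \<in> {..<k} \<rightarrow> carrier R"
      "\<And>i. i < n \<Longrightarrow> g i \<ominus>\<^bsub>R\<^esub> h i = (\<Oplus>j\<in>{..<k}. s j \<otimes> r j i)"
      using relations_generated by blast
    have rR: "(\<lambda>j. r j i) \<in> {..<k} \<rightarrow> carrier R" if "i < n" for i
      using r_closed that by auto
    \<comment> \<open>The entries at \<open>l\<close> of the terms in
      \<open>c = c (1 - B A) + h A + (g - h) A\<close>, where \<open>c B = g\<close> and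
      \<open>g - h = s r\<close>. The first and third are controlled by \<open>D\<close> and
      \<open>E\<close>, the second lies in \<open>J\<close>.\<close>
    define a1 a2 a3 where a: "a1 = (\<Oplus>t\<in>?S. c t \<otimes> D t l)" "a2 = (\<Oplus>i\<in>?S. A i l \<otimes> h i)"
      "a3 = (\<Oplus>j\<in>{..<k}. s j \<otimes> E j l)"
    have Dl: "(\<lambda>t. D t l) \<in> ?S \<rightarrow> carrier R" and El: "(\<lambda>j. E j l) \<in> {..<k} \<rightarrow> carrier R"
      using DR ER l by auto
    have aR: "a1 \<in> carrier R" "a2 \<in> carrier R" "a3 \<in> carrier R"
      unfolding a by (intro R.finsum_mult_closed c Dl colA[OF l] hR s(1) El)+
    have cl: "c l \<in> carrier R"
      using c l by auto
    define G where "G = (\<Oplus>i\<in>?S. A i l \<otimes> g i)"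
    have GR: "G \<in> carrier R"
      unfolding G_def by (intro R.finsum_mult_closed colA[OF l] g)
    have "G \<ominus>\<^bsub>R\<^esub> a2 = (\<Oplus>i\<in>?S. A i l \<otimes> (g i \<ominus>\<^bsub>R\<^esub> h i))"
      unfolding G_def a by (rule R.finsum_mult_diff_right[OF colA[OF l] g hR, symmetric])
    also have "\<dots> = (\<Oplus>i\<in>?S. (\<Oplus>j\<in>{..<k}. s j \<otimes> r j i) \<otimes> A i l)"
      using s R.finsum_mult_closed[OF s(1) rR] AR l by (intro R.finsum_cong') (auto simp: R.m_comm)
    also have "\<dots> = a3"
      unfolding a E_def using s(1) r_closed colA[OF l]
      by (intro R.finsum_finsum_mult[symmetric]) auto
    finally have Ga: "G \<ominus>\<^bsub>R\<^esub> a2 = a3" .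
    have delta: "(\<Oplus>t\<in>?S. c t \<otimes> (if l = t then \<one> else \<zero>)) = c l"
    proof -
      have "(\<Oplus>t\<in>?S. c t \<otimes> (if l = t then \<one> else \<zero>)) = (\<Oplus>t\<in>?S. if l = t then c t else \<zero>)"
        using funcset_mem[OF c] by (intro R.finsum_cong') auto
      also have "\<dots> = c l"
        using c l by (intro R.finsum_singleton) auto
      finally show ?thesis .
    qed
    have BAl: "(\<lambda>t. \<Oplus>i\<in>?S. B t i \<otimes> A i l) \<in> ?S \<rightarrow> carrier R"
      using funcset_mem[OF BA] l by simp
    have "a1 = (\<Oplus>t\<in>?S. c t \<otimes> (if l = t then \<one> else \<zero>)) \<ominus>\<^bsub>R\<^esub> (\<Oplus>t\<in>?S. c t \<otimes> (\<Oplus>i\<in>?S. B t i \<otimes> A i l))"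
      unfolding a D_def using c BAl by (intro R.finsum_mult_diff_right) auto
    also have "(\<Oplus>t\<in>?S. c t \<otimes> (\<Oplus>i\<in>?S. B t i \<otimes> A i l)) = (\<Oplus>i\<in>?S. g i \<otimes> A i l)"
      unfolding g_def using c B(1) colA[OF l] by (intro R.finsum_finsum_mult) auto
    also have "\<dots> = G"
      unfolding G_def using AR l funcset_mem[OF g] by (intro R.finsum_cong') (auto simp: R.m_comm)
    finally have a1: "a1 = c l \<ominus>\<^bsub>R\<^esub> G"
      by (simp add: delta)
    have "c l = (c l \<ominus>\<^bsub>R\<^esub> G) \<oplus> (a2 \<oplus> (G \<ominus>\<^bsub>R\<^esub> a2))"
      using cl GR aR by algebra
    then have "c l = a1 \<oplus> (a2 \<oplus> a3)"
      unfolding a1[symmetric] Ga .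
    then have "c l \<odot>\<^bsub>M\<^esub> y l = a1 \<odot>\<^bsub>M\<^esub> y l \<oplus>\<^bsub>M\<^esub> (a2 \<odot>\<^bsub>M\<^esub> y l \<oplus>\<^bsub>M\<^esub> a3 \<odot>\<^bsub>M\<^esub> y l)"
      using aR yl[OF l] by (simp add: smult_l_distr)
    moreover have "a1 \<odot>\<^bsub>M\<^esub> y l \<in> IM J"
      unfolding a using smult_finsum_left[OF _ c Dl yl[OF l]] DJ[OF _ l] funcset_mem[OF c]
        submoduleE(4)[OF NJ] by (auto intro!: lin_comb_in_submodule[OF NJ])
    moreover have "a3 \<odot>\<^bsub>M\<^esub> y l \<in> IM J"
      unfolding a using smult_finsum_left[OF _ s(1) El yl[OF l]] EJ[OF _ l] funcset_mem[OF s(1)]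
        submoduleE(4)[OF NJ] by (auto intro!: lin_comb_in_submodule[OF NJ])
    moreover have "a2 \<odot>\<^bsub>M\<^esub> y l \<in> IM J"
    proof (rule smult_in_IM[OF J _ yl[OF l]])
      show "a2 \<in> J"
        unfolding a using h(1) AR l by (intro R.ideal_finsum J R.ideal_mult_left) auto
    qed
    ultimately show "c l \<odot>\<^bsub>M\<^esub> y l \<in> IM J"
      using submoduleE(5)[OF NJ] by simp
  qed (rule yM)
  then show ?thesis
    using JC by blast
qed

theorem decomposes_zero:
  assumes "\<And>I. ideal I R \<Longrightarrow> connected_ideal R I \<Longrightarrow> chain_ideal R I"
  shows "\<exists>y. decomposes {\<zero>} y"
proof (rule R.ideal_property_connected_induct[where P = "\<lambda>I. \<exists>y. decomposes I y"])
  fix C assume "C \<noteq> {}" "subset.chain {I. ideal I R} C" "\<exists>y. decomposes (\<Union>C) y"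
  then show "\<exists>I\<in>C. \<exists>y. decomposes I y"
    using decomposes_chain_mem by blast
next
  fix I e assume "ideal I R" "e \<in> carrier R" "e \<otimes> (\<one> \<ominus>\<^bsub>R\<^esub> e) \<in> I"
    "\<exists>y. decomposes (add_multiples R I (carrier R) e) y"
    "\<exists>y. decomposes (add_multiples R I (carrier R) (\<one> \<ominus>\<^bsub>R\<^esub> e)) y"
  then show "\<exists>y. decomposes I y"
    using decomposes_split by blast
next
  show "\<exists>y. decomposes (carrier R) y"
    using decomposes_improper by blast
next
  fix I assume "ideal I R" "connected_ideal R I"
  then show "\<exists>y. decomposes I y"
    using assms decomposes_chain_ideal by blast
qed (rule R.zeroideal)

end

section \<open>From exact sequences to coordinates, and from coordinates to direct sums\<close>

definition free_unit :: "('a, 'r) ring_scheme \<Rightarrow> nat \<Rightarrow> nat \<Rightarrow> nat \<Rightarrow> 'a" where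
  "free_unit R n i = (\<lambda>j\<in>{..<n}. if j = i then \<one>\<^bsub>R\<^esub> else \<zero>\<^bsub>R\<^esub>)"

lemma (in cring) free_unit_closed: "free_unit R n i \<in> carrier (free_module R n)"
  by (auto simp: free_unit_def free_module_def)

context module begin

text \<open>Linearity is stated for a bare function on the carrier, so that \<open>\<phi>\<close>
  can also be a coordinate function \<open>\<lambda>u. g u i\<close> with values in the regular
  module.\<close>

lemma free_module_hom_eq:
  assumes closed: "\<And>u. u \<in> carrier (free_module R n) \<Longrightarrow> \<phi> u \<in> carrier M"
    and add: "\<And>u v. u \<in> carrier (free_module R n) \<Longrightarrow> v \<in> carrier (free_module R n) \<Longrightarrow>
      \<phi> (u \<oplus>\<^bsub>free_module R n\<^esub> v) = \<phi> u \<oplus>\<^bsub>M\<^esub> \<phi> v"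
    and smult: "\<And>a u. a \<in> carrier R \<Longrightarrow> u \<in> carrier (free_module R n) \<Longrightarrow>
      \<phi> (a \<odot>\<^bsub>free_module R n\<^esub> u) = a \<odot>\<^bsub>M\<^esub> \<phi> u"
    and c: "c \<in> carrier (free_module R n)"
  shows "\<phi> c = lin_comb M {..<n} c (\<lambda>i. \<phi> (free_unit R n i))"
proof -
  let ?F = "free_module R n"
  have cR: "c j \<in> carrier R" if "j < n" for j
    using c that by (auto simp: free_module_def)
  \<comment> \<open>The coordinates are switched on one at a time: each step adds \<open>c t\<close>
    times a basis vector.\<close>
  define trunc where "trunc t = (\<lambda>j\<in>{..<n}. if j < t then c j else \<zero>)" for t
  have trunc: "trunc t \<in> carrier ?F" for t
    using cR by (auto simp: trunc_def free_module_def)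
  have hom_trunc: "\<phi> (trunc t) = lin_comb M {..<t} c (\<lambda>i. \<phi> (free_unit R n i))" if "t \<le> n" for t
    using that
  proof (induction t)
    case 0
    have "trunc 0 = \<zero> \<odot>\<^bsub>?F\<^esub> trunc 0"
      by (auto simp: trunc_def free_module_def)
    then show ?case
      using smult[OF R.zero_closed trunc[of 0]] closed[OF trunc[of 0]] by simp
  next
    case (Suc t)
    have "trunc (Suc t) = (c t \<odot>\<^bsub>?F\<^esub> free_unit R n t) \<oplus>\<^bsub>?F\<^esub> trunc t"
      using cR Suc.prems by (auto simp: trunc_def free_module_def free_unit_def fun_eq_iff less_Suc_eq)
    moreover have "c t \<odot>\<^bsub>?F\<^esub> free_unit R n t \<in> carrier ?F"
      using cR Suc.prems by (auto simp: free_module_def free_unit_def)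
    ultimately have "\<phi> (trunc (Suc t)) = c t \<odot>\<^bsub>M\<^esub> \<phi> (free_unit R n t) \<oplus>\<^bsub>M\<^esub> \<phi> (trunc t)"
      using add[OF _ trunc[of t]] smult[OF _ R.free_unit_closed] cR[of t] Suc.prems by simp
    also have "\<phi> (trunc t) = lin_comb M {..<t} c (\<lambda>i. \<phi> (free_unit R n i))"
      using Suc by simp
    also have "c t \<odot>\<^bsub>M\<^esub> \<phi> (free_unit R n t) \<oplus>\<^bsub>M\<^esub> lin_comb M {..<t} c (\<lambda>i. \<phi> (free_unit R n i))
        = lin_comb M (insert t {..<t}) c (\<lambda>i. \<phi> (free_unit R n i))"
      using cR Suc.prems closed[OF R.free_unit_closed] by (intro lin_comb_insert[symmetric]) auto
    finally show ?case
      by (simp add: lessThan_Suc)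
  qed
  have "trunc n = c"
    using c by (auto simp: trunc_def free_module_def fun_eq_iff PiE_iff extensional_def)
  with hom_trunc[of n] show ?thesis
    by simp
qed

text \<open>The generators are the images of the basis under \<open>f\<close> and the relation
  vectors those under \<open>g\<close>; exactness says that the latter generate all
  relations.\<close>

lemma finitely_presented_imp_presented_module:
  assumes "finitely_presented R M"
  shows "\<exists>n x k r. presented_module R M n x k r"
proof -
  obtain k n g f where g: "g \<in> module_homs R (free_module R k) (free_module R n)"
    and f: "f \<in> module_homs R (free_module R n) M"
    and surj: "f ` carrier (free_module R n) = carrier M"
    and ker: "{x \<in> carrier (free_module R n). f x = \<zero>\<^bsub>M\<^esub>} = g ` carrier (free_module R k)"
    using assms[unfolded finitely_presented_def] by (elim exE bexE conjE) (rule that)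
  let ?F = "free_module R n" and ?G = "free_module R k"
  have f_closed: "f u \<in> carrier M" if "u \<in> carrier ?F" for u
    using f that by (auto simp: module_homs_def)
  have f_eq: "f c = lin_comb M {..<n} c (\<lambda>i. f (free_unit R n i))" if "c \<in> carrier ?F" for c
    using f that by (intro free_module_hom_eq) (auto simp: module_homs_def)
  have g_closed: "g u \<in> carrier ?F" if "u \<in> carrier ?G" for u
    using g that by (auto simp: module_homs_def)
  have carr: "carrier ?F = {..<n} \<rightarrow>\<^sub>E carrier R" "carrier ?G = {..<k} \<rightarrow>\<^sub>E carrier R"
    by (simp_all add: free_module_def)
  have g_eq: "g s i = (\<Oplus>j\<in>{..<k}. s j \<otimes> g (free_unit R k j) i)" if s: "s \<in> carrier ?G" and i: "i < n" for s i
  proof -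
    interpret reg: module R "regular_module R"
      by (rule R.module_regular_module)
    have gi: "g u i \<in> carrier R" if "u \<in> carrier ?G" for u
      using g_closed[OF that] i by (auto simp: carr)
    have "g (u \<oplus>\<^bsub>?G\<^esub> v) i = g u i \<oplus> g v i" if "u \<in> carrier ?G" "v \<in> carrier ?G" for u v
    proof -
      have "g (u \<oplus>\<^bsub>?G\<^esub> v) = g u \<oplus>\<^bsub>?F\<^esub> g v"
        using g that by (auto simp: module_homs_def)
      then show ?thesis
        using i by (simp add: free_module_def)
    qed
    moreover have "g (a \<odot>\<^bsub>?G\<^esub> u) i = a \<otimes> g u i" if "a \<in> carrier R" "u \<in> carrier ?G" for a u
    proof -
      have "g (a \<odot>\<^bsub>?G\<^esub> u) = a \<odot>\<^bsub>?F\<^esub> g u"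
        using g that by (auto simp: module_homs_def)
      then show ?thesis
        using i by (simp add: free_module_def)
    qed
    ultimately have "g s i = lin_comb (regular_module R) {..<k} s (\<lambda>j. g (free_unit R k j) i)"
      using s gi by (intro reg.free_module_hom_eq[where \<phi> = "\<lambda>u. g u i"]) (simp_all add: regular_module_def)
    also have "\<dots> = (\<Oplus>j\<in>{..<k}. s j \<otimes> g (free_unit R k j) i)"
      using s gi[OF R.free_unit_closed] by (intro R.lin_comb_regular_module) (auto simp: carr)
    finally show ?thesis .
  qed
  define x where "x i = f (free_unit R n i)" for i
  define r where "r j = g (free_unit R k j)" for j
  have f_x: "f c = lin_comb M {..<n} c x" if "c \<in> carrier ?F" for c
    using f_eq[OF that] by (simp add: x_def[abs_def])
  have x: "x \<in> {..<n} \<rightarrow> carrier M"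
    using f_closed[OF R.free_unit_closed] by (simp add: x_def)
  have r: "r j \<in> carrier ?F" "f (r j) = \<zero>\<^bsub>M\<^esub>" for j
    using ker R.free_unit_closed[of k j] g_closed[of "free_unit R k j"] by (auto simp: r_def)
  have "presented_module R M n x k r"
  proof unfold_locales
    show "r j \<in> {..<n} \<rightarrow> carrier R" for j
      using r(1)[of j] by (auto simp: carr)
    show "\<exists>c\<in>{..<n} \<rightarrow> carrier R. z = lin_comb M {..<n} c x" if z: "z \<in> carrier M" for z
    proof -
      have "z \<in> f ` carrier ?F"
        using surj z by simp
      then obtain c where "c \<in> carrier ?F" "z = f c"
        by blast
      then show ?thesis
        using f_x[of c] by (intro bexI[of _ c]) (auto simp: carr)
    qed
    show "lin_comb M {..<n} (r j) x = \<zero>\<^bsub>M\<^esub>" for j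
      using r[of j] f_x[of "r j"] by simp
    show "\<exists>s\<in>{..<k} \<rightarrow> carrier R. \<forall>i<n. c i = (\<Oplus>j\<in>{..<k}. s j \<otimes> r j i)"
      if c: "c \<in> {..<n} \<rightarrow> carrier R" and c0: "lin_comb M {..<n} c x = \<zero>\<^bsub>M\<^esub>" for c
    proof -
      \<comment> \<open>Elements of the free module are extensional, so \<open>c\<close> is cut off
        outside \<open>{..<n}\<close>.\<close>
      define d where "d = restrict c {..<n}"
      have d: "d \<in> carrier ?F"
        using c by (auto simp: d_def carr)
      have "lin_comb M {..<n} d x = lin_comb M {..<n} c x"
        using c x by (intro lin_comb_cong) (auto simp: d_def)
      then have "d \<in> g ` carrier ?G"
        using f_x[OF d] c0 d by (simp add: ker[symmetric])
      then obtain s where s: "s \<in> carrier ?G" "d = g s"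
        by blast
      have "c i = (\<Oplus>j\<in>{..<k}. s j \<otimes> r j i)" if "i < n" for i
        using g_eq[OF s(1) that] fun_cong[OF s(2), of i] that by (simp add: r_def d_def)
      moreover have "s \<in> {..<k} \<rightarrow> carrier R"
        using s(1) by (auto simp: carr)
      ultimately show ?thesis by blast
    qed
  qed (rule x)
  then show ?thesis by blast
qed

text \<open>\<open>internal_direct_sum\<close> speaks of a set of submodules, so the family must be
  made injective. After the indices with zero generator are discarded in \<open>T\<close>, two equal
  cyclic submodules would contradict independence.\<close>

lemma internal_direct_sum_cyclic:
  assumes S: "finite S" and y: "y \<in> S \<rightarrow> carrier M"
    and gen: "\<And>z. z \<in> carrier M \<Longrightarrow> \<exists>c\<in>S \<rightarrow> carrier R. z = lin_comb M S c y"
    and indep: "\<And>c l. c \<in> S \<rightarrow> carrier R \<Longrightarrow> lin_comb M S c y = \<zero>\<^bsub>M\<^esub> \<Longrightarrow> l \<in> S \<Longrightarrow> c l \<odot>\<^bsub>M\<^esub> y l = \<zero>\<^bsub>M\<^esub>"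
  shows "\<exists>\<C>. (\<forall>N\<in>\<C>. cyclic_submodule R M N) \<and> internal_direct_sum R M \<C>"
proof -
  have yM: "y l \<in> carrier M" if "l \<in> S" for l
    using y that by auto
  have unique: "c l \<odot>\<^bsub>M\<^esub> y l = d l \<odot>\<^bsub>M\<^esub> y l"
    if c: "c \<in> S \<rightarrow> carrier R" and d: "d \<in> S \<rightarrow> carrier R"
      and eq: "lin_comb M S c y = lin_comb M S d y" and l: "l \<in> S" for c d l
  proof -
    have cl: "c l \<in> carrier R" "d l \<in> carrier R"
      using c d l by auto
    have "lin_comb M S (\<lambda>l. c l \<ominus>\<^bsub>R\<^esub> d l) y = \<zero>\<^bsub>M\<^esub>"
      using lin_comb_diff[OF S c d y] eq lin_comb_closed[OF d y] by (simp add: M.minus_eq M.r_neg)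
    moreover have "(\<lambda>l. c l \<ominus>\<^bsub>R\<^esub> d l) \<in> S \<rightarrow> carrier R"
      using funcset_mem[OF c] funcset_mem[OF d] by simp
    ultimately have "(c l \<ominus>\<^bsub>R\<^esub> d l) \<odot>\<^bsub>M\<^esub> y l = \<zero>\<^bsub>M\<^esub>"
      using indep l by blast
    then show ?thesis
      using M.minus_eq_zeroD[of "c l \<odot>\<^bsub>M\<^esub> y l" "d l \<odot>\<^bsub>M\<^esub> y l"] cl yM[OF l] by (simp add: smult_minus_left)
  qed
  define T where "T = {l \<in> S. y l \<noteq> \<zero>\<^bsub>M\<^esub>}"
  define cyc where "cyc l = (\<lambda>a. a \<odot>\<^bsub>M\<^esub> y l) ` carrier R" for l
  have T: "finite T" "T \<subseteq> S"
    using S by (auto simp: T_def)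
  have cyc_self: "y l \<in> cyc l" if "l \<in> S" for l
    unfolding cyc_def using yM[OF that] by (intro image_eqI[of _ _ \<one>]) simp_all
  have cyc_sub: "submodule (cyc l) R M" if l: "l \<in> S" for l
  proof (rule submoduleI')
    show "cyc l \<subseteq> carrier M"
      using yM[OF l] by (auto simp: cyc_def)
    show "\<zero>\<^bsub>M\<^esub> \<in> cyc l"
      unfolding cyc_def using yM[OF l] by (intro image_eqI[of _ _ \<zero>]) simp_all
    fix u v assume "u \<in> cyc l" "v \<in> cyc l"
    then obtain a b where "a \<in> carrier R" "b \<in> carrier R" "u = a \<odot>\<^bsub>M\<^esub> y l" "v = b \<odot>\<^bsub>M\<^esub> y l"
      unfolding cyc_def by blast
    then show "u \<oplus>\<^bsub>M\<^esub> v \<in> cyc l"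
      unfolding cyc_def using yM[OF l] by (intro image_eqI[of _ _ "a \<oplus> b"]) (simp_all add: smult_l_distr)
  next
    fix a u assume a: "a \<in> carrier R" and "u \<in> cyc l"
    then obtain b where "b \<in> carrier R" "u = b \<odot>\<^bsub>M\<^esub> y l"
      unfolding cyc_def by blast
    then show "a \<odot>\<^bsub>M\<^esub> u \<in> cyc l"
      unfolding cyc_def using yM[OF l] a by (intro image_eqI[of _ _ "a \<otimes> b"]) (simp_all add: smult_assoc1)
  qed
  have inj: "inj_on cyc T"
  proof (rule inj_onI, rule ccontr)
    fix i j assume ij: "i \<in> T" "j \<in> T" "cyc i = cyc j" "i \<noteq> j"
    then have iS: "i \<in> S" and jS: "j \<in> S"
      using T by auto
    have "y i \<in> cyc j"
      using cyc_self[OF iS] ij(3) by simp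
    then obtain a where a: "a \<in> carrier R" "y i = a \<odot>\<^bsub>M\<^esub> y j"
      unfolding cyc_def by blast
    \<comment> \<open>Two expansions of \<open>y i\<close>: as itself and as a multiple of
      \<open>y j\<close>. Comparing their terms at \<open>i\<close> gives
      \<open>y i = 0\<close>.\<close>
    let ?c = "\<lambda>l. if l = i then \<one> else \<zero>" and ?d = "\<lambda>l. if l = j then a else \<zero>"
    have "lin_comb M S ?c y = lin_comb M S ?d y"
      using lin_comb_delta[OF S iS R.one_closed y] lin_comb_delta[OF S jS a(1) y] a(2) yM[OF iS] by simp
    then have "?c i \<odot>\<^bsub>M\<^esub> y i = ?d i \<odot>\<^bsub>M\<^esub> y i"
      using a(1) by (intro unique iS) auto
    then show False
      using ij yM[OF iS] by (simp add: T_def)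
  qed
  define \<C> where "\<C> = cyc ` T"
  have finC: "finite \<C>"
    using T by (simp add: \<C>_def)
  \<comment> \<open>A choice of one element from each summand is a coefficient vector, extended by 0
    outside \<open>T\<close>. This turns existence and uniqueness of the components into statements
    about \<open>lin_comb\<close>.\<close>
  have family: "\<exists>a\<in>S \<rightarrow> carrier R. (\<forall>l\<in>T. Y (cyc l) = a l \<odot>\<^bsub>M\<^esub> y l) \<and>
      (\<Oplus>\<^bsub>M\<^esub>N\<in>{N\<in>\<C>. Y N \<noteq> \<zero>\<^bsub>M\<^esub>}. Y N) = lin_comb M S a y"
    if Y: "Y \<in> (\<Pi>\<^sub>E N\<in>\<C>. N)" for Y
  proof -
    have Yc: "Y (cyc l) \<in> cyc l" if "l \<in> T" for l
      using Y that by (auto simp: \<C>_def)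
    have YM: "Y N \<in> carrier M" if "N \<in> \<C>" for N
      using that Yc cyc_sub T(2) submoduleE(1) unfolding \<C>_def by blast
    have "\<exists>b. b \<in> carrier R \<and> Y (cyc l) = b \<odot>\<^bsub>M\<^esub> y l" if "l \<in> T" for l
      using Yc[OF that] by (auto simp: cyc_def)
    then obtain b where b: "\<And>l. l \<in> T \<Longrightarrow> b l \<in> carrier R \<and> Y (cyc l) = b l \<odot>\<^bsub>M\<^esub> y l"
      by metis
    define a where "a l = (if l \<in> T then b l else \<zero>)" for l
    have a: "a \<in> S \<rightarrow> carrier R" "\<And>l. l \<in> T \<Longrightarrow> Y (cyc l) = a l \<odot>\<^bsub>M\<^esub> y l"
      using b by (auto simp: a_def)
    have "(\<Oplus>\<^bsub>M\<^esub>N\<in>{N\<in>\<C>. Y N \<noteq> \<zero>\<^bsub>M\<^esub>}. Y N) = (\<Oplus>\<^bsub>M\<^esub>N\<in>\<C>. Y N)"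
      using finC YM by (intro M.add.finprod_mono_neutral_cong_left) auto
    also have "\<dots> = (\<Oplus>\<^bsub>M\<^esub>l\<in>T. Y (cyc l))"
      unfolding \<C>_def using inj YM by (intro M.finsum_reindex) (auto simp: \<C>_def)
    also have "\<dots> = (\<Oplus>\<^bsub>M\<^esub>l\<in>S. a l \<odot>\<^bsub>M\<^esub> y l)"
      using S T a(1) yM funcset_mem[OF a(1)]
      by (intro M.add.finprod_mono_neutral_cong_left) (auto simp: a(2) a_def)
    finally show ?thesis
      unfolding lin_comb_def using a by blast
  qed
  have "internal_direct_sum R M \<C>"
    unfolding internal_direct_sum_def
  proof (intro conjI ballI)
    fix N assume "N \<in> \<C>"
    then show "submodule N R M"
      using cyc_sub T(2) by (auto simp: \<C>_def)
  next
    fix z assume "z \<in> carrier M"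
    then obtain c where c: "c \<in> S \<rightarrow> carrier R" "z = lin_comb M S c y"
      using gen by blast
    define Y where "Y = (\<lambda>N\<in>\<C>. c (the_inv_into T cyc N) \<odot>\<^bsub>M\<^esub> y (the_inv_into T cyc N))"
    have Ycyc: "Y (cyc l) = c l \<odot>\<^bsub>M\<^esub> y l" if "l \<in> T" for l
      using that by (simp add: Y_def \<C>_def the_inv_into_f_f[OF inj])
    have Ymem: "Y N \<in> N" if "N \<in> \<C>" for N
    proof -
      obtain l where l: "l \<in> T" "N = cyc l"
        using \<open>N \<in> \<C>\<close> by (auto simp: \<C>_def)
      then have "c l \<in> carrier R"
        using c(1) T(2) by auto
      then show ?thesis
        unfolding l(2) Ycyc[OF l(1)] by (simp add: cyc_def)
    qed
    have Y: "Y \<in> (\<Pi>\<^sub>E N\<in>\<C>. N)"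
      using Ymem by (auto simp: Y_def)
    show "\<exists>!Y. Y \<in> (\<Pi>\<^sub>E N\<in>\<C>. N) \<and> finite {N \<in> \<C>. Y N \<noteq> \<zero>\<^bsub>M\<^esub>} \<and>
        z = (\<Oplus>\<^bsub>M\<^esub>N\<in>{N \<in> \<C>. Y N \<noteq> \<zero>\<^bsub>M\<^esub>}. Y N)"
    proof (rule ex1I[of _ Y], intro conjI)
      obtain a where a: "a \<in> S \<rightarrow> carrier R" "\<And>l. l \<in> T \<Longrightarrow> Y (cyc l) = a l \<odot>\<^bsub>M\<^esub> y l"
        "(\<Oplus>\<^bsub>M\<^esub>N\<in>{N\<in>\<C>. Y N \<noteq> \<zero>\<^bsub>M\<^esub>}. Y N) = lin_comb M S a y"
        using family[OF Y] by blast
      have eq: "a l \<odot>\<^bsub>M\<^esub> y l = c l \<odot>\<^bsub>M\<^esub> y l" if "l \<in> S" for l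
      proof (cases "l \<in> T")
        case True
        then show ?thesis using a(2) Ycyc by simp
      next
        case False
        then have "y l = \<zero>\<^bsub>M\<^esub>"
          using that by (simp add: T_def)
        then show ?thesis
          using funcset_mem[OF a(1) that] funcset_mem[OF c(1) that] by simp
      qed
      have "lin_comb M S a y = lin_comb M S c y"
        unfolding lin_comb_def
        using eq lin_comb_term_funcset[OF c(1) y] by (intro M.finsum_cong') auto
      then show "z = (\<Oplus>\<^bsub>M\<^esub>N\<in>{N \<in> \<C>. Y N \<noteq> \<zero>\<^bsub>M\<^esub>}. Y N)"
        using a(3) c(2) by simp
    next
      fix Y' assume Y': "Y' \<in> (\<Pi>\<^sub>E N\<in>\<C>. N) \<and> finite {N \<in> \<C>. Y' N \<noteq> \<zero>\<^bsub>M\<^esub>} \<and>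
        z = (\<Oplus>\<^bsub>M\<^esub>N\<in>{N \<in> \<C>. Y' N \<noteq> \<zero>\<^bsub>M\<^esub>}. Y' N)"
      then obtain a where a: "a \<in> S \<rightarrow> carrier R" "\<And>l. l \<in> T \<Longrightarrow> Y' (cyc l) = a l \<odot>\<^bsub>M\<^esub> y l"
        "(\<Oplus>\<^bsub>M\<^esub>N\<in>{N\<in>\<C>. Y' N \<noteq> \<zero>\<^bsub>M\<^esub>}. Y' N) = lin_comb M S a y"
        using family[of Y'] by blast
      have "lin_comb M S a y = lin_comb M S c y"
        using Y' a(3) c(2) by simp
      then have "Y' (cyc l) = Y (cyc l)" if "l \<in> T" for l
        using unique[OF a(1) c(1) _ subsetD[OF T(2) that]] a(2)[OF that] Ycyc[OF that] by simp
      then show "Y' = Y"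
        using Y' Y by (intro PiE_ext[of Y' \<C> "\<lambda>N. N" Y]) (auto simp: \<C>_def)
    qed (use Y finC in auto)
  qed
  moreover have "cyclic_submodule R M N" if "N \<in> \<C>" for N
    using that yM T(2) by (auto simp: \<C>_def cyc_def cyclic_submodule_def)
  ultimately show ?thesis
    by blast
qed

end

text \<open>At the zero ideal congruence modulo \<open>IM I\<close> is equality, so
  \<open>decomposes\<close> supplies the premises of
  \<open>internal_direct_sum_cyclic\<close>.\<close>

theorem (in cring) elementary_divisor_ringI:
  assumes chain: "\<And>I. ideal I R \<Longrightarrow> connected_ideal R I \<Longrightarrow> chain_ideal R I"
  shows "elementary_divisor_ring TYPE('n) R"
  unfolding elementary_divisor_ring_def
proof (intro allI impI; elim conjE)
  fix M :: "('a, 'n) module"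
  assume M: "module R M" and "finitely_presented R M"
  then obtain n x k r where "presented_module R M n x k r"
    using module.finitely_presented_imp_presented_module by blast
  then interpret presented_module R M n x k r .
  obtain y where y: "decomposes {\<zero>} y"
    using decomposes_zero[OF chain] by blast
  have yM: "y \<in> {..<n} \<rightarrow> carrier M"
    using y by (simp add: decomposes_def)
  show "\<exists>\<C>. (\<forall>N\<in>\<C>. cyclic_submodule R M N) \<and> internal_direct_sum R M \<C>"
  proof (rule internal_direct_sum_cyclic[OF _ yM])
    fix z assume z: "z \<in> carrier M"
    then obtain c where c: "c \<in> {..<n} \<rightarrow> carrier R" "z \<ominus>\<^bsub>M\<^esub> lin_comb M {..<n} c y = \<zero>\<^bsub>M\<^esub>"
      using y unfolding decomposes_def IM_zero by blast
    then have "z = lin_comb M {..<n} c y"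
      using M.minus_eq_zeroD[OF z lin_comb_closed[OF c(1) yM]] by simp
    then show "\<exists>c\<in>{..<n} \<rightarrow> carrier R. z = lin_comb M {..<n} c y"
      using c(1) by blast
  next
    fix c l assume "c \<in> {..<n} \<rightarrow> carrier R" "lin_comb M {..<n} c y = \<zero>\<^bsub>M\<^esub>" "l \<in> {..<n}"
    then show "c l \<odot>\<^bsub>M\<^esub> y l = \<zero>\<^bsub>M\<^esub>"
      using y unfolding decomposes_def IM_zero by blast
  qed simp
qed

theorem theorem3p7:
  fixes R :: "('a, 'r) ring_scheme"
  assumes "cring R"
    and "infinite (UNIV :: 'm set)"
    and "\<exists>h :: 'a \<Rightarrow> 'm. inj_on h (carrier R)"
    and "\<And>M :: ('a, 'm) module.
      module R M \<Longrightarrow> indecomposable_module R M \<Longrightarrow> local_ring (End_ring R M)"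
  shows "clean_ring R \<and> elementary_divisor_ring TYPE('n) R"
proof -
  obtain h :: "'a \<Rightarrow> 'm" where "inj_on h (carrier R)"
    using assms(3) by blast
  with assms interpret local_indecomposables R h
    by (intro local_indecomposables.intro local_indecomposables_axioms.intro)
  show ?thesis
    using clean_ringI elementary_divisor_ringI connected_imp_local local_imp_chain by blast
qed

end
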